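(* Let $A=(\mathbb{K}\langle\underline x\rangle,S,I,\prec)$ be a PBW-reduction-algebra over a field $\mathbb{K}$ and let $\mathbf{u}\in\mathbb{Z}^n$ be a weight vector on $A$. 1. The $\mathbb{K}$-subalgebra $F^{\mathbf{u}}_0A$ of $A$ is generated by residue classes of finitely many standard monomials. Moreover, such a generating set is computable. 2. The $\mathbb{K}$-subalgebra $F_0^{\mathbf{u}}A$ is isomorphic to a PBW-reduction-algebra. 3. For every $j\in\mathbb{Z}$ the $F^{\mathbf{u}}_0A$-module $F^{\mathbf{u}}_jA$ is generated by residue classes of finitely many standard monomials. Moreover, such generating sets are computable.
   Context: $\mathbb{K}\langle\underline x\rangle=\mathbb{K}\langle x_1,\dots,x_n\rangle$ is the free associative algebra; $\mathbb{K}[\underline x]$ is viewed as its $\mathbb{K}$-subspace spanned by the standard monomials $\underline x^\alpha=x_1^{\alpha_1}\cdots x_n^{\alpha_n}$, $\alpha\in\mathbb{N}^n$. A monomial ordering on standard monomials is a total order with $\underline x^\alpha\prec\underline x^{\beta}\Rightarrow\underline x^{\alpha+\gamma}\prec\underline x^{\beta+\gamma}$; it is a well-ordering if $1\preceq\underline x^\alpha$ always. $\operatorname{lm}(p)$ and $\operatorname{le}(p)$ are the leading monomial and its exponent for $0\neq p\in\mathbb{K}[\underline x]$. A commutation system $(S,\prec)$ consists of a monomial ordering $\prec$ and a set $S=\{x_jx_i-c_{ij}x_ix_j-d_{ij}\mid 1\le i<j\le n\}$ with $c_{ij}\in\mathbb{K}^*$, $d_{ij}\in\mathbb{K}[\underline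 x]$, $d_{ij}=0$ or $\operatorname{lm}(d_{ij})\prec x_ix_j$, such that every element of $\mathbb{K}\langle\underline x\rangle$ can be transformed into an element of $\mathbb{K}[\underline x]$ by finitely many $\mathbb{K}$-linear reductions, each replacing one monomial $m\,x_jx_i\,m'$ by $m(c_{ij}x_ix_j+d_{ij})m'$. For $G\subseteq\mathbb{K}[\underline x]$ put $\operatorname{l}_\prec(G)=\{\operatorname{le}(g)\mid 0\ne g\in G\}$ and $\operatorname{L}_\prec(G)=\operatorname{l}_\prec(G)+\mathbb{N}^n$. A PBW-reduction datum $(\mathbb{K}\langle\underline x\rangle,S,I,\prec)$ is a commutation system $(S,\prec)$ with $\prec$ a well-ordering together with a finite set $I\subseteq\mathbb{K}[\underline x]$ such that $\operatorname{L}_\prec(I)=\operatorname{l}_\prec(\langle I\cup S\rangle\cap\mathbb{K}[\underline x])$ ($\langle\cdot\rangle$ the two-sided ideal). The algebra $\mathbb{K}\langle\underline x\rangle/\langle I\cup S\rangle$ is the associated PBW-reduction-algebra, and by abuse of notation one writes $A=(\mathbb{K}\langle\underline x\rangle,S,I,\prec)$ (the number of variables is arbitrary). For $\mathbf{u}\in\mathbb{Z}^n$ the $\mathbf{u}$-degree of a monomial $x_{i_1}\cdots x_{i_k}$ is $\sum_j\mathbf{u}_{i_j}$, and $\deg_{\mathbf{u}}$ of an element of $\mathbb{K}\langle\underline x\rangle$ is the maximum over its monomials ($-\infty$ for $0$). $\mathbf{u}$ is a weight vector on $A$ if $\deg_{\mathbf{u}}(d_{ij})\le\deg_{\mathbf{u}}(x_ix_j)$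 for all $i<j$. $F^{\mathbf{u}}_kA$ is the image in $A$ of $F^{\mathbf{u}}_k\mathbb{K}\langle\underline x\rangle=\{r\mid\deg_{\mathbf{u}}(r)\le k\}$. For a weight vector, $F^{\mathbf{u}}_kA\cdot F^{\mathbf{u}}_lA\subseteq F^{\mathbf{u}}_{k+l}A$. "Computable" means: by an algorithm from the given data (PBW-reduction datum and weight vector, and $j$). *)

theory Defs
  imports
    "HOL-Algebra.QuotRing"
    "HOL-Algebra.Generated_Rings"
    "HOL-Library.Poly_Mapping"
    "HOL-Library.Extended"
begin

section \<open>The free associative algebra\<close>

text \<open>
  Words over the letters \<open>1, \<dots>, n\<close> form the free monoid under concatenation; writing this monoid
  additively makes \<open>nat list \<Rightarrow>\<^sub>0 'k\<close> (finitely supported functions with the convolution product)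
  the free associative algebra.
\<close>

instantiation list :: (type) monoid_add
begin

definition zero_list :: "'a list" where "zero_list = []"
definition plus_list :: "'a list \<Rightarrow> 'a list \<Rightarrow> 'a list" where "plus_list = append"

instance
  by standard (simp_all add: zero_list_def plus_list_def)

end

type_synonym 'k ncpoly = "nat list \<Rightarrow>\<^sub>0 'k"
type_synonym expo = "nat \<Rightarrow>\<^sub>0 nat"

definition free_alg :: "nat \<Rightarrow> 'k::field ncpoly ring" where
  "free_alg n = \<lparr>carrier = {f. \<forall>w\<in>Poly_Mapping.keys f. set w \<subseteq> {1..n}},
     mult = (*), one = 1, zero = 0, add = (+)\<rparr>"

definition const :: "'k::field \<Rightarrow> 'k ncpoly" where
  "const a = Poly_Mapping.single [] a"

definition word :: "nat list \<Rightarrow> 'k::field ncpoly" where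
  "word w = Poly_Mapping.single w 1"

definition exps :: "nat \<Rightarrow> expo set" where
  "exps n = {\<alpha>. Poly_Mapping.keys \<alpha> \<subseteq> {1..n}}"

text \<open>The word of the standard monomial \<open>x\<^sub>1 ^ \<alpha>\<^sub>1 \<cdots> x\<^sub>n ^ \<alpha>\<^sub>n\<close>.\<close>

definition std_word :: "nat \<Rightarrow> expo \<Rightarrow> nat list" where
  "std_word n \<alpha> = concat (map (\<lambda>i. replicate (Poly_Mapping.lookup \<alpha> i) i) [1..<Suc n])"

definition std_space :: "nat \<Rightarrow> 'k::field ncpoly set" where
  "std_space n = {f. Poly_Mapping.keys f \<subseteq> std_word n ` exps n}"

definition std_supp :: "nat \<Rightarrow> 'k::field ncpoly \<Rightarrow> expo set" where
  "std_supp n f = {\<alpha> \<in> exps n. Poly_Mapping.lookup f (std_word n \<alpha>) \<noteq> 0}"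

section \<open>Monomial orderings\<close>

text \<open>An ordering is given by its strict part, of which only the restriction to \<open>exps n\<close> matters.\<close>

definition monomial_ordering :: "nat \<Rightarrow> (expo \<Rightarrow> expo \<Rightarrow> bool) \<Rightarrow> bool" where
  "monomial_ordering n lt \<longleftrightarrow>
     irreflp_on (exps n) lt \<and> transp_on (exps n) lt \<and> totalp_on (exps n) lt \<and>
     (\<forall>\<alpha>\<in>exps n. \<forall>\<beta>\<in>exps n. \<forall>\<gamma>\<in>exps n. lt \<alpha> \<beta> \<longrightarrow> lt (\<alpha> + \<gamma>) (\<beta> + \<gamma>))"

definition well_ordering :: "nat \<Rightarrow> (expo \<Rightarrow> expo \<Rightarrow> bool) \<Rightarrow> bool" where
  "well_ordering n lt \<longleftrightarrow> (\<forall>\<alpha>\<in>exps n. \<alpha> = 0 \<or> lt 0 \<alpha>)"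

text \<open>Only meaningful for nonzero \<open>p \<in> std_space n\<close>.\<close>

definition le_exp :: "nat \<Rightarrow> (expo \<Rightarrow> expo \<Rightarrow> bool) \<Rightarrow> 'k::field ncpoly \<Rightarrow> expo" where
  "le_exp n lt p = (THE \<alpha>. \<alpha> \<in> std_supp n p \<and> (\<forall>\<beta>\<in>std_supp n p. \<beta> = \<alpha> \<or> lt \<beta> \<alpha>))"

definition l_set :: "nat \<Rightarrow> (expo \<Rightarrow> expo \<Rightarrow> bool) \<Rightarrow> 'k::field ncpoly set \<Rightarrow> expo set" where
  "l_set n lt G = {le_exp n lt g | g. g \<in> G \<and> g \<noteq> 0}"

definition L_set :: "nat \<Rightarrow> (expo \<Rightarrow> expo \<Rightarrow> bool) \<Rightarrow> 'k::field ncpoly set \<Rightarrow> expo set" where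
  "L_set n lt G = {\<alpha> + \<gamma> | \<alpha> \<gamma>. \<alpha> \<in> l_set n lt G \<and> \<gamma> \<in> exps n}"

section \<open>PBW-reduction data\<close>

text \<open>
  \<open>cc i j\<close> and \<open>dd i j\<close> are the \<open>c\<^sub>i\<^sub>j\<close> and \<open>d\<^sub>i\<^sub>j\<close> of the commutation relations; only their values for
  \<open>1 \<le> i < j \<le> nv\<close> matter.
\<close>

record (overloaded) ('k::zero) pbw_data =
  nv :: nat
  cc :: "nat \<Rightarrow> nat \<Rightarrow> 'k"
  dd :: "nat \<Rightarrow> nat \<Rightarrow> 'k ncpoly"
  II :: "'k ncpoly set"
  prec :: "expo \<Rightarrow> expo \<Rightarrow> bool"

definition comm_rels :: "'k::field pbw_data \<Rightarrow> 'k ncpoly set" where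
  "comm_rels D = {word [j, i] - const (cc D i j) * word [i, j] - dd D i j | i j.
     1 \<le> i \<and> i < j \<and> j \<le> nv D}"

text \<open>
  A single reduction is the \<open>K\<close>-linear map that replaces the monomial \<open>m x\<^sub>j x\<^sub>i m'\<close> by
  \<open>m (c\<^sub>i\<^sub>j x\<^sub>i x\<^sub>j + d\<^sub>i\<^sub>j) m'\<close> and fixes every other monomial.
\<close>

definition reduction ::
  "'k::field pbw_data \<Rightarrow> nat \<Rightarrow> nat \<Rightarrow> nat list \<Rightarrow> nat list \<Rightarrow> 'k ncpoly \<Rightarrow> 'k ncpoly" where
  "reduction D i j m m' f =
     (let a = Poly_Mapping.lookup f (m @ [j, i] @ m') in
      f - const a * word (m @ [j, i] @ m')
        + const a * (word m * (const (cc D i j) * word [i, j] + dd D i j) * word m'))"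

definition reduces :: "'k::field pbw_data \<Rightarrow> 'k ncpoly \<Rightarrow> 'k ncpoly \<Rightarrow> bool" where
  "reduces D f g \<longleftrightarrow> (\<exists>i j m m'. 1 \<le> i \<and> i < j \<and> j \<le> nv D \<and>
     set m \<subseteq> {1..nv D} \<and> set m' \<subseteq> {1..nv D} \<and> g = reduction D i j m m' f)"

definition commutation_system :: "'k::field pbw_data \<Rightarrow> bool" where
  "commutation_system D \<longleftrightarrow>
     monomial_ordering (nv D) (prec D) \<and>
     (\<forall>i j. 1 \<le> i \<and> i < j \<and> j \<le> nv D \<longrightarrow>
        cc D i j \<noteq> 0 \<and> dd D i j \<in> std_space (nv D) \<and>
        (dd D i j = 0 \<or>
         prec D (le_exp (nv D) (prec D) (dd D i j))
                (Poly_Mapping.single i 1 + Poly_Mapping.single j 1))) \<and>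
     (\<forall>f\<in>carrier (free_alg (nv D)). \<exists>g\<in>std_space (nv D). (reduces D)\<^sup>*\<^sup>* f g)"

definition pbw_ideal :: "'k::field pbw_data \<Rightarrow> 'k ncpoly set" where
  "pbw_ideal D = genideal (free_alg (nv D)) (II D \<union> comm_rels D)"

definition pbw_datum :: "'k::field pbw_data \<Rightarrow> bool" where
  "pbw_datum D \<longleftrightarrow>
     commutation_system D \<and> well_ordering (nv D) (prec D) \<and>
     finite (II D) \<and> II D \<subseteq> std_space (nv D) \<and>
     L_set (nv D) (prec D) (II D) = l_set (nv D) (prec D) (pbw_ideal D \<inter> std_space (nv D))"

definition pbw_alg :: "'k::field pbw_data \<Rightarrow> 'k ncpoly set ring" where
  "pbw_alg D = free_alg (nv D) Quot pbw_ideal D"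

definition residue :: "'k::field pbw_data \<Rightarrow> 'k ncpoly \<Rightarrow> 'k ncpoly set" where
  "residue D f = pbw_ideal D +>\<^bsub>free_alg (nv D)\<^esub> f"

definition std_residue :: "'k::field pbw_data \<Rightarrow> expo \<Rightarrow> 'k ncpoly set" where
  "std_residue D \<alpha> = residue D (word (std_word (nv D) \<alpha>))"

text \<open>
  The \<open>K\<close>-structure of \<open>pbw_alg D\<close> is given by the residue classes of the constants (which need not
  form a copy of \<open>K\<close>, as the quotient may be the zero ring). So the \<open>K\<close>-subalgebra generated by \<open>G\<close>
  is the unital subring generated by \<open>G\<close> and the constants, and a \<open>K\<close>-algebra isomorphism is a ring
  isomorphism that is compatible with the constants.
\<close>

definition subalg_gen :: "'k::field pbw_data \<Rightarrow> 'k ncpoly set set \<Rightarrow> 'k ncpoly set set" where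
  "subalg_gen D G = generate_ring (pbw_alg D) (range (\<lambda>a. residue D (const a)) \<union> G)"

definition iso_to_pbw_alg ::
  "'k::field pbw_data \<Rightarrow> 'k ncpoly set set \<Rightarrow> 'k pbw_data \<Rightarrow> bool" where
  "iso_to_pbw_alg D B D' \<longleftrightarrow>
     (\<exists>h \<in> ring_iso ((pbw_alg D)\<lparr>carrier := B\<rparr>) (pbw_alg D').
        \<forall>a. h (residue D (const a)) = residue D' (const a))"

text \<open>The left submodule of \<open>pbw_alg D\<close> over the subring \<open>R\<close> generated by \<open>G\<close>.\<close>

definition submod_gen ::
  "'k::field pbw_data \<Rightarrow> 'k ncpoly set set \<Rightarrow> 'k ncpoly set set \<Rightarrow> 'k ncpoly set set" where
  "submod_gen D R G = \<Inter>{M. additive_subgroup M (pbw_alg D) \<and>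
     (\<forall>r\<in>R. \<forall>m\<in>M. r \<otimes>\<^bsub>pbw_alg D\<^esub> m \<in> M) \<and> G \<subseteq> M}"

section \<open>Weight filtrations\<close>

text \<open>Only the entries \<open>u 1, \<dots>, u n\<close> of a weight vector matter.\<close>

definition word_deg :: "(nat \<Rightarrow> int) \<Rightarrow> nat list \<Rightarrow> int" where
  "word_deg u w = sum_list (map u w)"

definition deg :: "(nat \<Rightarrow> int) \<Rightarrow> 'k::field ncpoly \<Rightarrow> int extended" where
  "deg u f = (if f = 0 then Minf else Fin (Max (word_deg u ` Poly_Mapping.keys f)))"

definition weight_vector :: "'k::field pbw_data \<Rightarrow> (nat \<Rightarrow> int) \<Rightarrow> bool" where
  "weight_vector D u \<longleftrightarrow> (\<forall>i j. 1 \<le> i \<and> i < j \<and> j \<le> nv D \<longrightarrow>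
     deg u (dd D i j) \<le> deg u (word [i, j] :: 'k ncpoly))"

definition filt :: "'k::field pbw_data \<Rightarrow> (nat \<Rightarrow> int) \<Rightarrow> int \<Rightarrow> 'k ncpoly set set" where
  "filt D u k = residue D ` {r \<in> carrier (free_alg (nv D)). deg u r \<le> Fin k}"

section \<open>Algorithms over a field\<close>

text \<open>
  Algorithms are programs of a WHILE language over binary trees (S-expressions) whose leaves carry
  integers or elements of the field. Integer arithmetic, field arithmetic and equality tests are
  elementary operations, and the monomial ordering is accessed through an oracle that compares two
  encoded exponent vectors. Programs contain no field constants other than integers and do not
  depend on the oracle.

  Truth values are \<open>VInt 1\<close> and \<open>VInt 0\<close>; ill-typed operations return \<open>VNil\<close>.
\<close>

datatype 'k val = VNil | VInt int | VFld 'k | VPair "'k val" "'k val"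

datatype wexp =
    Var nat
  | IntC int
  | FldC int
  | NilC
  | Pair wexp wexp
  | Head wexp
  | Tail wexp
  | Plus wexp wexp
  | Minus wexp wexp
  | Times wexp wexp
  | Inverse wexp
  | Leq wexp wexp
  | Eq wexp wexp
  | Prec wexp wexp

datatype wcom =
    Assign nat wexp
  | Seq wcom wcom
  | While wexp wcom

definition vbool :: "bool \<Rightarrow> 'k val" where
  "vbool b = VInt (if b then 1 else 0)"

fun vhead :: "'k val \<Rightarrow> 'k val" where
  "vhead (VPair v w) = v"
| "vhead _ = VNil"

fun vtail :: "'k val \<Rightarrow> 'k val" where
  "vtail (VPair v w) = w"
| "vtail _ = VNil"

fun vplus :: "'k::field val \<Rightarrow> 'k val \<Rightarrow> 'k val" where
  "vplus (VInt a) (VInt b) = VInt (a + b)"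
| "vplus (VFld a) (VFld b) = VFld (a + b)"
| "vplus _ _ = VNil"

fun vminus :: "'k::field val \<Rightarrow> 'k val \<Rightarrow> 'k val" where
  "vminus (VInt a) (VInt b) = VInt (a - b)"
| "vminus (VFld a) (VFld b) = VFld (a - b)"
| "vminus _ _ = VNil"

fun vtimes :: "'k::field val \<Rightarrow> 'k val \<Rightarrow> 'k val" where
  "vtimes (VInt a) (VInt b) = VInt (a * b)"
| "vtimes (VFld a) (VFld b) = VFld (a * b)"
| "vtimes _ _ = VNil"

fun vinverse :: "'k::field val \<Rightarrow> 'k val" where
  "vinverse (VFld a) = VFld (inverse a)"
| "vinverse _ = VNil"

fun vleq :: "'k val \<Rightarrow> 'k val \<Rightarrow> 'k val" where
  "vleq (VInt a) (VInt b) = vbool (a \<le> b)"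
| "vleq _ _ = VNil"

primrec wexp_val ::
  "('k::field val \<Rightarrow> 'k val \<Rightarrow> bool) \<Rightarrow> (nat \<Rightarrow> 'k val) \<Rightarrow> wexp \<Rightarrow> 'k val" where
  "wexp_val P s (Var x) = s x"
| "wexp_val P s (IntC a) = VInt a"
| "wexp_val P s (FldC a) = VFld (of_int a)"
| "wexp_val P s NilC = VNil"
| "wexp_val P s (Pair e f) = VPair (wexp_val P s e) (wexp_val P s f)"
| "wexp_val P s (Head e) = vhead (wexp_val P s e)"
| "wexp_val P s (Tail e) = vtail (wexp_val P s e)"
| "wexp_val P s (Plus e f) = vplus (wexp_val P s e) (wexp_val P s f)"
| "wexp_val P s (Minus e f) = vminus (wexp_val P s e) (wexp_val P s f)"
| "wexp_val P s (Times e f) = vtimes (wexp_val P s e) (wexp_val P s f)"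
| "wexp_val P s (Inverse e) = vinverse (wexp_val P s e)"
| "wexp_val P s (Leq e f) = vleq (wexp_val P s e) (wexp_val P s f)"
| "wexp_val P s (Eq e f) = vbool (wexp_val P s e = wexp_val P s f)"
| "wexp_val P s (Prec e f) = vbool (P (wexp_val P s e) (wexp_val P s f))"

inductive exec ::
  "('k::field val \<Rightarrow> 'k val \<Rightarrow> bool) \<Rightarrow> wcom \<Rightarrow> (nat \<Rightarrow> 'k val) \<Rightarrow> (nat \<Rightarrow> 'k val) \<Rightarrow> bool"
  for P where
  Assign: "exec P (Assign x e) s (s(x := wexp_val P s e))"
| Seq: "exec P p s s' \<Longrightarrow> exec P q s' s'' \<Longrightarrow> exec P (Seq p q) s s''"
| WhileF: "wexp_val P s e = VInt 0 \<Longrightarrow> exec P (While e p) s s"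
| WhileT: "wexp_val P s e \<noteq> VInt 0 \<Longrightarrow> exec P p s s' \<Longrightarrow> exec P (While e p) s' s'' \<Longrightarrow>
    exec P (While e p) s s''"

text \<open>Input and output are passed in variable \<open>0\<close>.\<close>

definition computes ::
  "('k::field val \<Rightarrow> 'k val \<Rightarrow> bool) \<Rightarrow> wcom \<Rightarrow> 'k val \<Rightarrow> 'k val \<Rightarrow> bool" where
  "computes P p v w \<longleftrightarrow> (\<exists>s. exec P p ((\<lambda>_. VNil)(0 := v)) s \<and> s 0 = w)"

subsection \<open>Encoding of the data\<close>

fun vlist :: "'k val list \<Rightarrow> 'k val" where
  "vlist [] = VNil"
| "vlist (v # vs) = VPair v (vlist vs)"

definition code_exp :: "nat \<Rightarrow> expo \<Rightarrow> 'k val" where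
  "code_exp n \<alpha> = vlist (map (\<lambda>i. VInt (int (Poly_Mapping.lookup \<alpha> i))) [1..<Suc n])"

definition code_exps :: "nat \<Rightarrow> expo list \<Rightarrow> 'k val" where
  "code_exps n as = vlist (map (code_exp n) as)"

definition prec_oracle :: "'k::field pbw_data \<Rightarrow> 'k val \<Rightarrow> 'k val \<Rightarrow> bool" where
  "prec_oracle D v w \<longleftrightarrow> (\<exists>\<alpha>\<in>exps (nv D). \<exists>\<beta>\<in>exps (nv D).
     v = code_exp (nv D) \<alpha> \<and> w = code_exp (nv D) \<beta> \<and> prec D \<alpha> \<beta>)"

text \<open>
  Elements of \<open>std_space n\<close> and the finite set \<open>II D\<close> are encoded as lists in an arbitrary order,
  so encoding is a relation; an algorithm has to succeed on every encoding of its input.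
\<close>

definition encodes_poly :: "nat \<Rightarrow> 'k val \<Rightarrow> 'k::field ncpoly \<Rightarrow> bool" where
  "encodes_poly n v f \<longleftrightarrow> (\<exists>as. distinct as \<and> set as = std_supp n f \<and>
     v = vlist (map (\<lambda>\<alpha>. VPair (VFld (Poly_Mapping.lookup f (std_word n \<alpha>))) (code_exp n \<alpha>)) as))"

definition encodes_rels :: "'k val \<Rightarrow> 'k::field pbw_data \<Rightarrow> bool" where
  "encodes_rels v D \<longleftrightarrow> (\<exists>dv.
     (\<forall>i j. 1 \<le> i \<and> i < j \<and> j \<le> nv D \<longrightarrow> encodes_poly (nv D) (dv i j) (dd D i j)) \<and>
     v = vlist (concat (map (\<lambda>i. map (\<lambda>j. VPair (VFld (cc D i j)) (dv i j)) [Suc i..<Suc (nv D)])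
                            [1..<Suc (nv D)])))"

definition encodes_gens :: "'k val \<Rightarrow> 'k::field pbw_data \<Rightarrow> bool" where
  "encodes_gens v D \<longleftrightarrow> (\<exists>fs vs. distinct fs \<and> set fs = II D \<and>
     list_all2 (encodes_poly (nv D)) vs fs \<and> v = vlist vs)"

definition encodes_datum :: "'k val \<Rightarrow> 'k::field pbw_data \<Rightarrow> bool" where
  "encodes_datum v D \<longleftrightarrow> (\<exists>r g. encodes_rels r D \<and> encodes_gens g D \<and>
     v = vlist [VInt (int (nv D)), r, g])"

definition code_weight :: "nat \<Rightarrow> (nat \<Rightarrow> int) \<Rightarrow> 'k val" where
  "code_weight n u = vlist (map (\<lambda>i. VInt (u i)) [1..<Suc n])"

end

theory Submission
  imports Defs "HOL-Library.Multiset" "HOL-Library.Infinite_Set"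
begin

text \<open>
  Everything rests on straightening. Modulo the commutation relations every word is a nonzero
  multiple of its sorted rearrangement plus standard monomials of smaller exponent, and for a weight
  vector those smaller terms do not have larger weight (lemma \<open>straighten\<close>). Therefore
  \<open>F\<^sub>k A\<close> is spanned by the standard monomials of weight at most \<open>k\<close>, and the product of the standard
  monomials with exponents \<open>\<gamma>\<close> and \<open>\<beta>\<close> is a nonzero multiple of the one with exponent \<open>\<gamma> + \<beta>\<close> up to
  smaller terms of no larger weight. The monomial ordering is well-founded by Dickson's lemma, so
  induction along it (lemma \<open>filt_subsetI\<close>) turns the generation of \<open>F\<^sub>0 A\<close> as an algebra and of
  \<open>F\<^sub>j A\<close> as a module into statements about exponents: generate the monoid \<open>M\<^sub>0\<close> of exponents of
  weight at most \<open>0\<close>, and the set \<open>M\<^sub>j\<close> of exponents of weight at most \<open>j\<close> under addition of \<open>M\<^sub>0\<close>.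

  These statements have an explicit solution. If some coordinate of an element of \<open>M\<^sub>j\<close> exceeds
  \<open>j\<^sup>2 + 1 + u\<^sub>1\<^sup>2 + \<dots> + u\<^sub>n\<^sup>2\<close>, then a unit vector or a combination of two unit vectors of weight
  zero can be split off (lemma \<open>box_split\<close>). So the exponents below this bound generate, and they
  can be listed by a program that only reads the weights and \<open>j\<close>.

  To present \<open>F\<^sub>0 A\<close>, take one variable for each generator of \<open>M\<^sub>0\<close>, and order the exponents of the new
  variables by their images in \<open>M\<^sub>0\<close>. For two generators \<open>x\<^sup>\<alpha>\<close> and \<open>x\<^sup>\<beta>\<close>, both \<open>x\<^sup>\<alpha> x\<^sup>\<beta>\<close> and
  \<open>x\<^sup>\<beta> x\<^sup>\<alpha>\<close> are nonzero multiples of \<open>x\<close> to the power \<open>\<alpha> + \<beta>\<close> up to smaller terms, and the smaller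
  terms lift to the new variables; this yields the commutation relations (lemma \<open>lift_relation\<close>).
  By Dickson's lemma finitely many elements of the kernel of the resulting map onto \<open>F\<^sub>0 A\<close> account
  for all its leading exponents. They generate the kernel together with the commutation relations,
  since an ideal that contains these relations is determined by its leading exponents
  (lemma \<open>ideal_determined_by_l_set\<close>).
\<close>

section \<open>Words and their exponents\<close>

definition words :: "nat \<Rightarrow> nat list set" where
  "words n = {w. set w \<subseteq> {1..n}}"

definition std_words :: "nat \<Rightarrow> nat list set" where
  "std_words n = {w \<in> words n. sorted w}"

definition wexp :: "nat list \<Rightarrow> expo" where
  "wexp w = sum_list (map (\<lambda>i. Poly_Mapping.single i 1) w)"

lemma wexp_simps [simp]:
  "wexp [] = 0" "wexp (i # w) = Poly_Mapping.single i 1 + wexp w" "wexp (v @ w) = wexp v + wexp w"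
  by (simp_all add: wexp_def)

lemma lookup_wexp: "Poly_Mapping.lookup (wexp w) i = count_list w i"
  by (induction w) (auto simp: lookup_add lookup_single when_def)

lemma wexp_mset: "wexp w = sum_mset (image_mset (\<lambda>i. Poly_Mapping.single i 1) (mset w))"
  by (simp add: wexp_def sum_mset_sum_list flip: mset_map)

lemma wexp_cong_mset: "mset v = mset w \<Longrightarrow> wexp v = wexp w"
  by (simp add: wexp_mset)

lemma wexp_eq_iff: "wexp v = wexp w \<longleftrightarrow> mset v = mset w"
  by (auto simp: poly_mapping_eq_iff multiset_eq_iff fun_eq_iff lookup_wexp count_mset wexp_cong_mset)

lemma wexp_sort [simp]: "wexp (sort w) = wexp w"
  by (simp add: wexp_eq_iff)

lemma wexp_in_exps: "w \<in> words n \<Longrightarrow> wexp w \<in> exps n"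
  by (auto simp: words_def exps_def in_keys_iff lookup_wexp count_list_0_iff)

lemma count_list_std_word: "count_list (std_word n \<alpha>) i = (if i \<in> {1..n} then Poly_Mapping.lookup \<alpha> i else 0)"
proof -
  have *: "count_list (concat (map (\<lambda>i. replicate (f i) i) xs)) i = (if i \<in> set xs then f i else 0)"
    if "distinct xs" for xs and f :: "nat \<Rightarrow> nat"
    using that
  proof (induction xs)
    case (Cons a xs)
    have "count_list (replicate (f a) a) i = (if i = a then f a else 0)"
      by (induction "f a") (auto simp flip: count_mset)
    with Cons show ?case by (auto simp: count_list_append)
  qed simp
  show ?thesis
    unfolding std_word_def by (subst *) auto
qed

lemma sorted_std_word: "sorted (std_word n \<alpha>)"
proof -
  have *: "sorted (concat (map (\<lambda>i. replicate (f i) i) xs))" if "sorted xs" for xs and f :: "nat \<Rightarrow> nat"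
    using that by (induction xs) (auto simp: sorted_append sorted_replicate)
  show ?thesis unfolding std_word_def by (rule *) (simp del: upt_Suc)
qed

lemma std_word_in_std_words: "std_word n \<alpha> \<in> std_words n"
proof -
  have "set (std_word n \<alpha>) \<subseteq> {1..n}" unfolding std_word_def by auto
  then show ?thesis by (simp add: std_words_def words_def sorted_std_word)
qed

lemma wexp_std_word: "\<alpha> \<in> exps n \<Longrightarrow> wexp (std_word n \<alpha>) = \<alpha>"
  by (auto simp: poly_mapping_eq_iff fun_eq_iff lookup_wexp count_list_std_word exps_def in_keys_iff)

lemma std_word_wexp: "w \<in> words n \<Longrightarrow> std_word n (wexp w) = sort w"
  by (metis mset_sort properties_for_sort sorted_std_word wexp_eq_iff wexp_in_exps wexp_std_word)

lemma std_word_wexp_std: "w \<in> std_words n \<Longrightarrow> std_word n (wexp w) = w"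
  by (simp add: std_words_def std_word_wexp sorted_sort_id)

lemma std_words_subset: "std_words n \<subseteq> words n"
  by (auto simp: std_words_def)

lemma sort_in_std_words: "w \<in> words n \<Longrightarrow> sort w \<in> std_words n"
  by (simp add: std_words_def words_def)

lemma wexp_inj_std: "v \<in> std_words n \<Longrightarrow> w \<in> std_words n \<Longrightarrow> wexp v = wexp w \<longleftrightarrow> v = w"
  by (metis std_word_wexp_std)

lemma std_word_image: "std_word n ` exps n = std_words n"
  using std_words_subset
  by (auto simp: image_iff std_word_in_std_words intro!: bexI[of _ "wexp _"] wexp_in_exps std_word_wexp_std[symmetric])

lemma words_append [simp]: "v @ w \<in> words n \<longleftrightarrow> v \<in> words n \<and> w \<in> words n"
  by (auto simp: words_def)

lemma words_Nil_Cons [simp]: "[] \<in> words n" "i # w \<in> words n \<longleftrightarrow> i \<in> {1..n} \<and> w \<in> words n"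
  by (auto simp: words_def)

lemma exps_closed [simp]: "0 \<in> exps n" "\<alpha> \<in> exps n \<Longrightarrow> \<beta> \<in> exps n \<Longrightarrow> \<alpha> + \<beta> \<in> exps n"
  using keys_add[of \<alpha> \<beta>] by (auto simp: exps_def)

lemma exps_addD: "\<alpha> + \<beta> \<in> exps n \<Longrightarrow> \<alpha> \<in> exps n \<and> \<beta> \<in> exps n"
  by (auto simp: exps_def subset_iff in_keys_iff lookup_add)

lemma exps_single: "i \<in> {1..n} \<Longrightarrow> Poly_Mapping.single i k \<in> exps n"
  by (auto simp: exps_def)

lemma word_deg_append [simp]: "word_deg u (v @ w) = word_deg u v + word_deg u w"
  by (simp add: word_deg_def)

lemma word_deg_cong_mset: "mset v = mset w \<Longrightarrow> word_deg u v = word_deg u w"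
  unfolding word_deg_def by (metis mset_map sum_mset_sum_list)

section \<open>Noncommutative polynomials with restricted support\<close>

definition supported_on :: "nat list set \<Rightarrow> 'k::field ncpoly set" where
  "supported_on X = {f. Poly_Mapping.keys f \<subseteq> X}"

lemma word_mult: "word v * word w = (word (v @ w) :: 'k::field ncpoly)"
  by (simp add: word_def mult_single plus_list_def)

lemma word_Nil: "word [] = (1 :: 'k::field ncpoly)"
  by (simp add: word_def single_one flip: zero_list_def)

lemma keys_word [simp]: "Poly_Mapping.keys (word w :: 'k::field ncpoly) = {w}" "word w \<noteq> (0 :: 'k ncpoly)"
  by (auto simp: word_def poly_mapping_eq_iff fun_eq_iff lookup_single intro!: exI[of _ w])

lemma const_mult_word: "const a * word w = (Poly_Mapping.single w a :: 'k::field ncpoly)"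
  by (simp add: word_def const_def mult_single plus_list_def)

lemma const_hom [simp]: "const 0 = (0 :: 'k::field ncpoly)" "const 1 = (1 :: 'k ncpoly)"
  "const (a + b) = (const a + const b :: 'k ncpoly)" "const (a - b) = (const a - const b :: 'k ncpoly)"
  "const (- a) = (- const a :: 'k ncpoly)"
  "const (a * b) = (const a * const b :: 'k ncpoly)"
proof -
  show "const (a * b) = (const a * const b :: 'k ncpoly)"
    by (simp add: const_def mult_single plus_list_def)
qed (simp_all add: const_def single_add single_diff single_uminus single_one flip: zero_list_def)

lemma ncpoly_expand: "f = (\<Sum>w\<in>Poly_Mapping.keys f. const (Poly_Mapping.lookup f w) * word w)"
  for f :: "'k::field ncpoly"
  by (rule poly_mapping_eqI)
     (auto simp: const_mult_word lookup_sum lookup_single when_def in_keys_iff)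

lemma ncpoly_induct [consumes 1, case_names zero add]:
  fixes f :: "'k::field ncpoly"
  assumes "f \<in> supported_on X"
    and "P 0" and "\<And>a w g. w \<in> X \<Longrightarrow> g \<in> supported_on X \<Longrightarrow> P g \<Longrightarrow> P (const a * word w + g)"
  shows "P f"
proof -
  have *: "P (\<Sum>w\<in>Y. const (c w) * word w) \<and> (\<Sum>w\<in>Y. const (c w) * word w) \<in> supported_on X"
    if "finite Y" "Y \<subseteq> X" for Y and c :: "nat list \<Rightarrow> 'k"
    using that
  proof (induction Y rule: finite_induct)
    case empty
    then show ?case by (simp add: assms(2) supported_on_def)
  next
    case (insert w Y)
    have "const (c w) * word w \<in> supported_on X"
      using insert.prems by (auto simp: supported_on_def const_mult_word)
    then show ?case
      using insert assms(3)[of w "\<Sum>w\<in>Y. const (c w) * word w" "c w"]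
        keys_add[of "const (c w) * word w" "\<Sum>w\<in>Y. const (c w) * word w"]
      by (auto simp: supported_on_def)
  qed
  show ?thesis
    using *[of "Poly_Mapping.keys f" "Poly_Mapping.lookup f"] assms(1)
    by (simp add: supported_on_def flip: ncpoly_expand)
qed

lemma const_commute: "f * const a = const a * (f :: 'k::field ncpoly)"
proof -
  have "f \<in> supported_on UNIV" by (simp add: supported_on_def)
  then show ?thesis
  proof (induction rule: ncpoly_induct)
    case (add b w g)
    have "const b * word w * const a = const a * (const b * word w)"
      by (simp add: const_def word_def mult_single plus_list_def mult.commute)
    then show ?case by (simp add: algebra_simps add.IH)
  qed simp
qed

lemma lookup_const_mult [simp]:
  "Poly_Mapping.lookup (const a * f) w = a * Poly_Mapping.lookup (f :: 'k::field ncpoly) w"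
proof -
  have "f \<in> supported_on UNIV" by (simp add: supported_on_def)
  then show ?thesis
  proof (induction rule: ncpoly_induct)
    case (add b v g)
    have "const a * (const b * word v + g) = const (a * b) * word v + const a * g"
      by (simp add: algebra_simps)
    moreover have "Poly_Mapping.lookup (const c * word v) w = (if v = w then c else 0)" for c :: 'k
      by (simp add: const_mult_word lookup_single when_def)
    ultimately show ?case by (simp only: lookup_add add.IH) (simp add: algebra_simps)
  qed simp
qed

lemma supported_on_zero [simp]: "0 \<in> supported_on X"
  by (simp add: supported_on_def)

lemma supported_on_add: "f \<in> supported_on X \<Longrightarrow> g \<in> supported_on X \<Longrightarrow> f + g \<in> supported_on X"
  using keys_add[of f g] by (auto simp: supported_on_def)

lemma supported_on_const_mult: "f \<in> supported_on X \<Longrightarrow> const a * f \<in> supported_on X"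
  by (auto simp: supported_on_def in_keys_iff)

lemma supported_on_uminus: "f \<in> supported_on X \<Longrightarrow> - f \<in> supported_on X"
  by (auto simp: supported_on_def in_keys_iff)

lemma supported_on_diff: "f \<in> supported_on X \<Longrightarrow> g \<in> supported_on X \<Longrightarrow> f - g \<in> supported_on X"
  by (metis diff_conv_add_uminus supported_on_add supported_on_uminus)

lemma word_supported [simp]: "word w \<in> supported_on X \<longleftrightarrow> w \<in> X"
  by (auto simp: supported_on_def word_def)

lemma supported_on_mono: "X \<subseteq> Y \<Longrightarrow> f \<in> supported_on X \<Longrightarrow> f \<in> supported_on Y"
  by (auto simp: supported_on_def)

lemma supported_on_mult:
  assumes "f \<in> supported_on X" "g \<in> supported_on Y" "\<And>v w. v \<in> X \<Longrightarrow> w \<in> Y \<Longrightarrow> v @ w \<in> Z"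
  shows "f * g \<in> supported_on Z"
  using keys_mult[of f g] assms by (fastforce simp: supported_on_def plus_list_def)

lemma carrier_free_alg: "carrier (free_alg n) = supported_on (words n)"
  by (auto simp: free_alg_def supported_on_def words_def)

lemma free_alg_ops [simp]:
  "monoid.mult (free_alg n) = (*)" "add (free_alg n) = (+)" "one (free_alg n) = 1" "zero (free_alg n) = 0"
  by (simp_all add: free_alg_def)

lemma const_in_carrier: "const a \<in> carrier (free_alg n)"
  by (auto simp: free_alg_def const_def)

lemma one_in_carrier: "1 \<in> supported_on (words n)"
  by (simp add: words_def flip: word_Nil)

text \<open>
  Standard monomials correspond to sorted words, so that standard polynomials and their exponents can
  be treated through the words in their support.
\<close>

lemma std_space_alt: "std_space n = supported_on (std_words n)"
  by (simp add: std_space_def supported_on_def std_word_image)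

lemma std_supp_alt: "f \<in> std_space n \<Longrightarrow> std_supp n f = wexp ` Poly_Mapping.keys f"
proof (intro equalityI subsetI)
  fix \<alpha> assume "\<alpha> \<in> std_supp n f"
  then have "\<alpha> \<in> exps n" "std_word n \<alpha> \<in> Poly_Mapping.keys f"
    by (auto simp: std_supp_def in_keys_iff)
  then show "\<alpha> \<in> wexp ` Poly_Mapping.keys f"
    by (metis imageI wexp_std_word)
next
  fix \<alpha> assume f: "f \<in> std_space n" and "\<alpha> \<in> wexp ` Poly_Mapping.keys f"
  then obtain w where "w \<in> Poly_Mapping.keys f" "\<alpha> = wexp w" "w \<in> std_words n"
    by (auto simp: std_space_alt supported_on_def)
  then show "\<alpha> \<in> std_supp n f"
    using std_words_subset[of n] by (auto simp: std_supp_def std_word_wexp_std wexp_in_exps in_keys_iff)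
qed

lemma ring_free_alg: "ring (free_alg n :: 'k::field ncpoly ring)"
proof (rule ringI)
  show "abelian_group (free_alg n :: 'k ncpoly ring)"
  proof (rule abelian_groupI)
    fix x :: "'k ncpoly" assume "x \<in> carrier (free_alg n)"
    then show "\<exists>y\<in>carrier (free_alg n). y \<oplus>\<^bsub>free_alg n\<^esub> x = \<zero>\<^bsub>free_alg n\<^esub>"
      by (intro bexI[of _ "- x"]) (auto simp: carrier_free_alg supported_on_uminus)
  qed (auto simp: carrier_free_alg supported_on_add add.assoc add.commute)
  show "Group.monoid (free_alg n :: 'k ncpoly ring)"
    by unfold_locales
       (auto simp: carrier_free_alg mult.assoc one_in_carrier intro: supported_on_mult)
qed (auto simp: carrier_free_alg algebra_simps)

lemma a_inv_free_alg:
  "f \<in> carrier (free_alg n) \<Longrightarrow> \<ominus>\<^bsub>free_alg n\<^esub> f = - (f :: 'k::field ncpoly)"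
proof -
  interpret ring "free_alg n :: 'k ncpoly ring" by (rule ring_free_alg)
  assume "f \<in> carrier (free_alg n)"
  then show "\<ominus>\<^bsub>free_alg n\<^esub> f = - f"
    by (intro minus_equality) (auto simp: carrier_free_alg supported_on_uminus)
qed

lemma a_minus_free_alg:
  "f \<in> carrier (free_alg n) \<Longrightarrow> g \<in> carrier (free_alg n) \<Longrightarrow> f \<ominus>\<^bsub>free_alg n\<^esub> g = f - g"
  by (simp add: a_minus_def a_inv_free_alg)

subsection \<open>Linear extension\<close>

definition lin_ext :: "(nat list \<Rightarrow> 'k::field ncpoly) \<Rightarrow> 'k ncpoly \<Rightarrow> 'k ncpoly" where
  "lin_ext F f = (\<Sum>w\<in>Poly_Mapping.keys f. const (Poly_Mapping.lookup f w) * F w)"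

lemma lin_ext_superset:
  assumes "finite X" "Poly_Mapping.keys f \<subseteq> X"
  shows "lin_ext F f = (\<Sum>w\<in>X. const (Poly_Mapping.lookup f w) * F w)"
  unfolding lin_ext_def
  using assms by (intro sum.mono_neutral_left) (auto simp: in_keys_iff)

lemma lin_ext_add: "lin_ext F (f + g) = lin_ext F f + lin_ext F g"
proof -
  let ?X = "Poly_Mapping.keys f \<union> Poly_Mapping.keys g"
  have "lin_ext F (f + g) = (\<Sum>w\<in>?X. const (Poly_Mapping.lookup (f + g) w) * F w)"
    by (rule lin_ext_superset) (use keys_add[of f g] in auto)
  also have "\<dots> = (\<Sum>w\<in>?X. const (Poly_Mapping.lookup f w) * F w)
                 + (\<Sum>w\<in>?X. const (Poly_Mapping.lookup g w) * F w)"
    by (simp add: lookup_add algebra_simps sum.distrib)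
  also have "\<dots> = lin_ext F f + lin_ext F g"
    by (simp add: lin_ext_superset[of ?X])
  finally show ?thesis .
qed

lemma lin_ext_const_mult: "lin_ext F (const a * f) = const a * lin_ext F f"
proof -
  have "Poly_Mapping.keys (const a * f) \<subseteq> Poly_Mapping.keys f" by (auto simp: in_keys_iff)
  then show ?thesis
    by (subst lin_ext_superset[of "Poly_Mapping.keys f"])
       (auto simp: lin_ext_def sum_distrib_left mult.assoc)
qed

lemma lin_ext_word [simp]: "lin_ext F (word w) = F w"
  by (simp add: lin_ext_def word_def)

lemma lin_ext_diff: "lin_ext F (f - g) = lin_ext F f - lin_ext F g"
  using lin_ext_add[of F "f - g" g] by (simp add: algebra_simps)

lemma lin_ext_zero [simp]: "lin_ext F 0 = 0"
  by (simp add: lin_ext_def)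

lemma lin_ext_mult:
  assumes "\<And>v w. F (v @ w) = F v * F w"
  shows "lin_ext F (f * g) = lin_ext F f * lin_ext F g"
proof -
  have w: "lin_ext F (word v * h) = F v * lin_ext F h" for v and h :: "'a ncpoly"
  proof -
    have "h \<in> supported_on UNIV" by (simp add: supported_on_def)
    then show ?thesis
    proof (induction rule: ncpoly_induct)
      case (add a w g)
      have "word v * (const a * word w + g) = const a * word (v @ w) + word v * g"
        by (simp add: algebra_simps word_mult[symmetric]) (metis const_commute mult.assoc)
      moreover have "F v * (const a * F w) = const a * (F v * F w)"
        by (metis const_commute mult.assoc)
      ultimately show ?case
        by (simp add: lin_ext_add lin_ext_const_mult add.IH assms distrib_left)
    qed simp
  qed
  have "f \<in> supported_on UNIV" by (simp add: supported_on_def)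
  then show ?thesis
  proof (induction rule: ncpoly_induct)
    case (add a v h)
    then show ?case
      by (simp add: distrib_right lin_ext_add mult.assoc lin_ext_const_mult w)
  qed simp
qed


section \<open>Dickson's lemma and monomial orderings\<close>

text \<open>
  The indices whose value is at most every later value are unbounded, because each tail of the
  sequence attains its minimum; they form the desired subsequence.
\<close>

lemma nat_mono_subseq:
  fixes f :: "nat \<Rightarrow> nat"
  obtains r :: "nat \<Rightarrow> nat" where "strict_mono r" "\<And>i j. i \<le> j \<Longrightarrow> f (r i) \<le> f (r j)"
proof -
  let ?S = "{m. \<forall>k\<ge>m. f m \<le> f k}"
  have "\<exists>m\<ge>N. m \<in> ?S" for N
  proof -
    obtain m where "m \<ge> N" "\<And>k. k \<ge> N \<Longrightarrow> f m \<le> f k"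
      using ex_has_least_nat[of "\<lambda>m. m \<ge> N" N f] by auto
    then show ?thesis by (intro exI[of _ m]) auto
  qed
  then have inf: "infinite ?S"
    unfolding infinite_nat_iff_unbounded_le by blast
  show thesis
  proof (rule that)
    show "strict_mono (enumerate ?S)" by (rule strict_mono_enumerate[OF inf])
    show "f (enumerate ?S i) \<le> f (enumerate ?S j)" if "i \<le> j" for i j
      using enumerate_in_set[OF inf, of i] that
        strict_mono_less_eq[OF strict_mono_enumerate[OF inf], of i j] by auto
  qed
qed

lemma dickson_subseq:
  fixes f :: "nat \<Rightarrow> expo"
  assumes "finite K"
  shows "\<exists>r :: nat \<Rightarrow> nat. strict_mono r \<and>
    (\<forall>k\<in>K. \<forall>i j. i \<le> j \<longrightarrow> Poly_Mapping.lookup (f (r i)) k \<le> Poly_Mapping.lookup (f (r j)) k)"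
  using assms
proof (induction K rule: finite_induct)
  case empty
  show ?case by (intro exI[of _ id]) (auto simp: strict_mono_def)
next
  case (insert k K)
  then obtain r :: "nat \<Rightarrow> nat" where r: "strict_mono r"
    "\<forall>k\<in>K. \<forall>i j. i \<le> j \<longrightarrow> Poly_Mapping.lookup (f (r i)) k \<le> Poly_Mapping.lookup (f (r j)) k"
    by blast
  obtain q :: "nat \<Rightarrow> nat" where q: "strict_mono q"
    "\<And>i j. i \<le> j \<Longrightarrow> Poly_Mapping.lookup (f (r (q i))) k \<le> Poly_Mapping.lookup (f (r (q j))) k"
    by (rule nat_mono_subseq[of "\<lambda>i. Poly_Mapping.lookup (f (r i)) k"]) blast
  have "strict_mono (r \<circ> q)" using r q by (simp add: strict_mono_o)
  moreover have "\<forall>k\<in>insert k K. \<forall>i j. i \<le> j \<longrightarrow>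
      Poly_Mapping.lookup (f ((r \<circ> q) i)) k \<le> Poly_Mapping.lookup (f ((r \<circ> q) j)) k"
    using r q by (auto simp: strict_mono_less_eq)
  ultimately show ?case by blast
qed

text \<open>
  Dickson's lemma: componentwise comparison of exponents is a well-quasi-order. A subsequence along
  which all coordinates increase is found by refining once per coordinate.
\<close>

lemma dickson:
  fixes f :: "nat \<Rightarrow> expo"
  assumes "\<And>i. f i \<in> exps n"
  shows "\<exists>i j \<gamma>. i < j \<and> \<gamma> \<in> exps n \<and> f j = f i + \<gamma>"
proof -
  obtain r :: "nat \<Rightarrow> nat" where r: "strict_mono r"
    "\<forall>k\<in>{1..n}. \<forall>i j. i \<le> j \<longrightarrow> Poly_Mapping.lookup (f (r i)) k \<le> Poly_Mapping.lookup (f (r j)) k"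
    using dickson_subseq[of "{1..n}" f] by auto
  have le: "Poly_Mapping.lookup (f (r 0)) k \<le> Poly_Mapping.lookup (f (r 1)) k" for k
  proof (cases "k \<in> {1..n}")
    case False
    then have "Poly_Mapping.lookup (f (r 0)) k = 0"
      using assms[of "r 0"] by (auto simp: exps_def in_keys_iff subset_iff simp del: atLeastAtMost_iff)
    then show ?thesis by simp
  qed (use r(2) in simp)
  have "f (r 1) = f (r 0) + (f (r 1) - f (r 0))"
    using le by (intro poly_mapping_eqI) (simp add: lookup_add lookup_minus)
  moreover have "r 0 < r 1" using r(1) by (simp add: strict_mono_def)
  moreover have "f (r 1) - f (r 0) \<in> exps n"
    using exps_addD[of "f (r 0)" "f (r 1) - f (r 0)" n] calculation(1) assms[of "r 1"] by simp
  ultimately show ?thesis by blast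
qed

text \<open>Every ideal of the monoid of exponents is generated by its finitely many minimal elements.\<close>

lemma dickson_finite_generators:
  assumes "L \<subseteq> exps n" and closed: "\<And>\<alpha> \<gamma>. \<alpha> \<in> L \<Longrightarrow> \<gamma> \<in> exps n \<Longrightarrow> \<alpha> + \<gamma> \<in> L"
  obtains G where "finite G" "G \<subseteq> L" "L = {\<alpha> + \<gamma> | \<alpha> \<gamma>. \<alpha> \<in> G \<and> \<gamma> \<in> exps n}"
proof -
  define G where "G = {\<alpha>\<in>L. \<forall>\<beta>\<in>L. \<forall>\<gamma>. \<alpha> = \<beta> + \<gamma> \<longrightarrow> \<gamma> = 0}"
  have GL: "G \<subseteq> L" by (auto simp: G_def)
  have "finite G"
  proof (rule ccontr)
    assume "infinite G"
    then obtain f :: "nat \<Rightarrow> expo" where f: "inj f" "range f \<subseteq> G"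
      by (meson infinite_countable_subset)
    then have G: "f i \<in> G" for i by blast
    then have "f i \<in> exps n" for i using GL assms(1) by blast
    then obtain i j \<gamma> where ij: "i < j" "f j = f i + \<gamma>"
      using dickson[of f n] by blast
    have "\<gamma> = 0" using G[of i] G[of j] ij(2) unfolding G_def mem_Collect_eq by blast
    then have "f i = f j" using ij by simp
    with ij(1) f show False by (simp add: inj_eq)
  qed
  moreover have "\<alpha> \<in> {\<alpha> + \<gamma> | \<alpha> \<gamma>. \<alpha> \<in> G \<and> \<gamma> \<in> exps n}" if "\<alpha> \<in> L" for \<alpha>
    using that
  proof (induction "\<Sum>k\<in>{1..n}. Poly_Mapping.lookup \<alpha> k" arbitrary: \<alpha> rule: less_induct)
    case less
    show ?case
    proof (cases "\<alpha> \<in> G")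
      case True
      then show ?thesis by (intro CollectI exI[of _ \<alpha>] exI[of _ 0]) simp
    next
      case False
      then obtain \<beta> \<gamma> where b: "\<beta> \<in> L" "\<alpha> = \<beta> + \<gamma>" "\<gamma> \<noteq> 0"
        using less.prems unfolding G_def mem_Collect_eq by blast
      have g: "\<gamma> \<in> exps n" using b less.prems assms(1) exps_addD by blast
      have "Poly_Mapping.keys \<gamma> \<noteq> {}" using \<open>\<gamma> \<noteq> 0\<close>
        by (metis all_not_in_conv in_keys_iff lookup_zero poly_mapping_eqI)
      then obtain k where "k \<in> Poly_Mapping.keys \<gamma>" by blast
      then have "k \<in> {1..n}" "Poly_Mapping.lookup \<gamma> k > 0"
        using g by (auto simp: exps_def in_keys_iff simp del: atLeastAtMost_iff)
      then have "(\<Sum>k\<in>{1..n}. Poly_Mapping.lookup \<gamma> k) > 0"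
        by (meson finite_atLeastAtMost sum_pos2 zero_le)
      then have "(\<Sum>k\<in>{1..n}. Poly_Mapping.lookup \<beta> k) < (\<Sum>k\<in>{1..n}. Poly_Mapping.lookup \<alpha> k)"
        by (simp add: b lookup_add sum.distrib)
      from less.hyps[OF this b(1)] obtain \<beta>' \<gamma>' where
        bg: "\<beta> = \<beta>' + \<gamma>'" "\<beta>' \<in> G" "\<gamma>' \<in> exps n"
        by (elim CollectE exE conjE)
      have "\<alpha> = \<beta>' + (\<gamma>' + \<gamma>)" "\<gamma>' + \<gamma> \<in> exps n" using b g bg by (simp_all add: add.assoc)
      then show ?thesis using bg(2) by (intro CollectI exI conjI)
    qed
  qed
  moreover have "\<alpha> + \<gamma> \<in> L" if "\<alpha> \<in> G" "\<gamma> \<in> exps n" for \<alpha> \<gamma>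
    using closed that GL by blast
  ultimately have "L = {\<alpha> + \<gamma> | \<alpha> \<gamma>. \<alpha> \<in> G \<and> \<gamma> \<in> exps n}" by blast
  with \<open>finite G\<close> GL show thesis by (rule that)
qed

locale well_monomial_ordering =
  fixes n :: nat and lt :: "expo \<Rightarrow> expo \<Rightarrow> bool" (infix "\<prec>" 50)
  assumes monomial: "monomial_ordering n (\<prec>)" and well: "well_ordering n (\<prec>)"
begin

lemma irrefl: "\<alpha> \<in> exps n \<Longrightarrow> \<not> \<alpha> \<prec> \<alpha>"
  using monomial by (auto simp: monomial_ordering_def irreflp_on_def)

lemma trans: "\<lbrakk>\<alpha> \<prec> \<beta>; \<beta> \<prec> \<gamma>; \<alpha> \<in> exps n; \<beta> \<in> exps n; \<gamma> \<in> exps n\<rbrakk> \<Longrightarrow> \<alpha> \<prec> \<gamma>"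
  using monomial unfolding monomial_ordering_def transp_on_def by blast

lemma total: "\<lbrakk>\<alpha> \<in> exps n; \<beta> \<in> exps n; \<alpha> \<noteq> \<beta>\<rbrakk> \<Longrightarrow> \<alpha> \<prec> \<beta> \<or> \<beta> \<prec> \<alpha>"
  using monomial unfolding monomial_ordering_def totalp_on_def by blast

lemma add_mono: "\<lbrakk>\<alpha> \<prec> \<beta>; \<alpha> \<in> exps n; \<beta> \<in> exps n; \<gamma> \<in> exps n\<rbrakk> \<Longrightarrow> \<alpha> + \<gamma> \<prec> \<beta> + \<gamma>"
  using monomial unfolding monomial_ordering_def by blast

lemma less_add: "\<lbrakk>\<alpha> \<in> exps n; \<gamma> \<in> exps n; \<gamma> \<noteq> 0\<rbrakk> \<Longrightarrow> \<alpha> \<prec> \<alpha> + \<gamma>"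
  using well add_mono[of 0 \<gamma> \<alpha>] by (auto simp: well_ordering_def add.commute)

text \<open>
  In a descending chain some exponent would divide a later one by Dickson's lemma, hence not exceed it.
\<close>

lemma wf_ordering: "wf {(\<alpha>, \<beta>). \<alpha> \<in> exps n \<and> \<beta> \<in> exps n \<and> \<alpha> \<prec> \<beta>}" (is "wf ?R")
  unfolding wf_iff_no_infinite_down_chain
proof
  assume "\<exists>f. \<forall>i. (f (Suc i), f i) \<in> ?R"
  then obtain f where f: "\<And>i. f i \<in> exps n" "\<And>i. f (Suc i) \<prec> f i" by blast
  have desc: "f (i + Suc k) \<prec> f i" for i k
  proof (induction k)
    case (Suc k)
    then show ?case using trans[OF f(2)[of "i + Suc k"] Suc f(1) f(1) f(1)] by simp
  qed (use f in simp)
  obtain i j \<gamma> where "i < j" "\<gamma> \<in> exps n" "f j = f i + \<gamma>" using dickson f by blast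
  then obtain k where k: "j = i + Suc k" using less_iff_Suc_add[of i j] by auto
  have less: "f i + \<gamma> \<prec> f i" using desc[of i k] \<open>f j = f i + \<gamma>\<close> k by simp
  have "\<gamma> \<noteq> 0" using less irrefl[OF f(1), of i] by auto
  then have "f i \<prec> f i + \<gamma>" using less_add[OF f(1) \<open>\<gamma> \<in> exps n\<close>] by blast
  then have "f i \<prec> f i" using trans[OF _ less] f(1) \<open>\<gamma> \<in> exps n\<close> by simp
  then show False using irrefl f(1) by blast
qed

lemma max_exponent:
  "\<lbrakk>finite S; S \<noteq> {}; S \<subseteq> exps n\<rbrakk> \<Longrightarrow> \<exists>\<alpha>\<in>S. \<forall>\<beta>\<in>S. \<beta> = \<alpha> \<or> \<beta> \<prec> \<alpha>"
proof (induction S rule: finite_ne_induct)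
  case (insert \<gamma> S)
  then obtain \<alpha> where a: "\<alpha> \<in> S" "\<forall>\<beta>\<in>S. \<beta> = \<alpha> \<or> \<beta> \<prec> \<alpha>" by auto
  show ?case
  proof (cases "\<gamma> \<prec> \<alpha>")
    case True
    then show ?thesis using a by (intro bexI[of _ \<alpha>]) auto
  next
    case False
    then have "\<alpha> \<prec> \<gamma>" using total[of \<alpha> \<gamma>] a insert by auto
    then have "\<beta> \<prec> \<gamma>" if "\<beta> \<in> S" for \<beta>
      using that a trans[of \<beta> \<alpha> \<gamma>] insert.prems subsetD[of S "exps n"] by auto
    then show ?thesis by (intro bexI[of _ \<gamma>]) auto
  qed
qed simp

lemma le_expI:
  assumes "f \<in> std_space n" "w \<in> Poly_Mapping.keys f"
    and max: "\<And>v. v \<in> Poly_Mapping.keys f \<Longrightarrow> v = w \<or> wexp v \<prec> wexp w"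
  shows "le_exp n (\<prec>) f = wexp w"
  unfolding le_exp_def std_supp_alt[OF assms(1)]
proof (rule the_equality)
  show "wexp w \<in> wexp ` Poly_Mapping.keys f \<and>
        (\<forall>\<beta>\<in>wexp ` Poly_Mapping.keys f. \<beta> = wexp w \<or> \<beta> \<prec> wexp w)"
    using assms by auto
  fix \<alpha> assume a: "\<alpha> \<in> wexp ` Poly_Mapping.keys f \<and>
        (\<forall>\<beta>\<in>wexp ` Poly_Mapping.keys f. \<beta> = \<alpha> \<or> \<beta> \<prec> \<alpha>)"
  have k: "v \<in> Poly_Mapping.keys f \<Longrightarrow> wexp v \<in> exps n" for v
    using assms(1) std_words_subset by (auto simp: std_space_alt supported_on_def intro!: wexp_in_exps)
  obtain v where v: "v \<in> Poly_Mapping.keys f" "\<alpha> = wexp v" using a by blast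
  have w: "wexp w = wexp v \<or> wexp w \<prec> wexp v" using a v assms(2) by auto
  have "\<not> (wexp v \<prec> wexp w \<and> wexp w \<prec> wexp v)"
    using trans[of "wexp v" "wexp w" "wexp v"] irrefl[of "wexp v"] k[OF v(1)] k[OF assms(2)] by blast
  then show "\<alpha> = wexp w" using w max[OF v(1)] v(2) by auto
qed

lemma leading_word:
  assumes "f \<in> std_space n" "f \<noteq> 0"
  obtains w where "w \<in> Poly_Mapping.keys f" "le_exp n (\<prec>) f = wexp w"
    "\<And>v. v \<in> Poly_Mapping.keys f \<Longrightarrow> v = w \<or> wexp v \<prec> wexp w"
proof -
  have sub: "Poly_Mapping.keys f \<subseteq> std_words n" using assms(1) by (simp add: std_space_alt supported_on_def)
  have "\<exists>\<alpha>\<in>wexp ` Poly_Mapping.keys f. \<forall>\<beta>\<in>wexp ` Poly_Mapping.keys f. \<beta> = \<alpha> \<or> \<beta> \<prec> \<alpha>"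
  proof (rule max_exponent)
    show "wexp ` Poly_Mapping.keys f \<subseteq> exps n"
      using sub std_words_subset[of n] by (auto intro!: wexp_in_exps)
  qed (use assms(2) in simp_all)
  then obtain \<alpha> where "\<alpha> \<in> wexp ` Poly_Mapping.keys f"
      and max: "\<forall>\<beta>\<in>wexp ` Poly_Mapping.keys f. \<beta> = \<alpha> \<or> \<beta> \<prec> \<alpha>" by (elim bexE)
  then obtain w where w1: "w \<in> Poly_Mapping.keys f" "\<alpha> = wexp w" by (elim imageE)
  have w: "w \<in> Poly_Mapping.keys f"
      "\<And>v. v \<in> Poly_Mapping.keys f \<Longrightarrow> wexp v = wexp w \<or> wexp v \<prec> wexp w"
    using w1 bspec[OF max imageI] by simp_all
  have max: "v = w \<or> wexp v \<prec> wexp w" if v: "v \<in> Poly_Mapping.keys f" for v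
    using w(2)[OF v] wexp_inj_std[of v n w] sub v w(1) by auto
  show thesis by (rule that[OF w(1) le_expI[OF assms(1) w(1) max] max])
qed

end

section \<open>Two-sided ideals of the free algebra\<close>

lemma ideal_facts:
  assumes "ideal J (free_alg n :: 'k::field ncpoly ring)"
  shows "J \<subseteq> supported_on (words n)" "0 \<in> J"
    "\<And>f g. f \<in> J \<Longrightarrow> g \<in> J \<Longrightarrow> f + g \<in> J" "\<And>f g. f \<in> J \<Longrightarrow> g \<in> J \<Longrightarrow> f - g \<in> J"
    "\<And>f g. f \<in> J \<Longrightarrow> g \<in> supported_on (words n) \<Longrightarrow> g * f \<in> J"
    "\<And>f g. f \<in> J \<Longrightarrow> g \<in> supported_on (words n) \<Longrightarrow> f * g \<in> J"
    "\<And>f a. f \<in> J \<Longrightarrow> const a * f \<in> J"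
proof -
  interpret ideal J "free_alg n :: 'k ncpoly ring" by fact
  show sub: "J \<subseteq> supported_on (words n)" using a_subset by (simp add: carrier_free_alg)
  show "0 \<in> J" using additive_subgroup.zero_closed[OF is_additive_subgroup] by simp
  show add: "f + g \<in> J" if "f \<in> J" "g \<in> J" for f g using additive_subgroup.a_closed[OF is_additive_subgroup] that by simp
  show l: "g * f \<in> J" if "f \<in> J" "g \<in> supported_on (words n)" for f g
    using I_l_closed that by (simp add: carrier_free_alg)
  show "f * g \<in> J" if "f \<in> J" "g \<in> supported_on (words n)" for f g
    using I_r_closed that by (simp add: carrier_free_alg)
  show c: "const a * f \<in> J" if "f \<in> J" for f a
    using l[OF that] const_in_carrier[of a n] by (simp add: carrier_free_alg)
  show "f - g \<in> J" if "f \<in> J" "g \<in> J" for f g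
    using add[OF that(1) c[OF that(2), of "-1"]] by simp
qed

definition linear_map :: "('k::field ncpoly \<Rightarrow> 'k ncpoly) \<Rightarrow> bool" where
  "linear_map L \<longleftrightarrow> (\<forall>f g. L (f + g) = L f + L g) \<and> (\<forall>a f. L (const a * f) = const a * L f)"

lemma linear_map_id: "linear_map (\<lambda>f. f)"
  by (simp add: linear_map_def)

lemma linear_map_lin_ext: "linear_map (lin_ext F)"
  by (simp add: linear_map_def lin_ext_add lin_ext_const_mult)

lemma linear_map_sandwich: "linear_map (\<lambda>f. p * f * q)"
  by (simp add: linear_map_def algebra_simps) (metis const_commute mult.assoc)

text \<open>
  This reduces statements about normal forms and preimages modulo an ideal from polynomials to words.
  The maps in question are the identity, multiplication from both sides and substitutions.
\<close>

lemma linear_congruence: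
  assumes J: "ideal J (free_alg n :: 'k::field ncpoly ring)"
    and L: "linear_map L" and M: "linear_map M"
    and w: "\<And>w. w \<in> X \<Longrightarrow> \<exists>g\<in>supported_on Y. L (word w) - M g \<in> J"
    and f: "f \<in> supported_on X"
  shows "\<exists>g\<in>supported_on Y. L f - M g \<in> J"
  using f
proof (induction rule: ncpoly_induct)
  case zero
  have "L 0 = 0" "M 0 = 0"
    using L M unfolding linear_map_def by (metis const_hom(1) mult_zero_left)+
  then show ?case using ideal_facts(2)[OF J] by (intro bexI[of _ 0]) auto
next
  case (add a v h)
  then obtain g g' where g: "g \<in> supported_on Y" "L h - M g \<in> J"
    "g' \<in> supported_on Y" "L (word v) - M g' \<in> J" using w by blast
  have "L (const a * word v + h) - M (const a * g' + g) =
        const a * (L (word v) - M g') + (L h - M g)"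
    using L M by (simp add: linear_map_def algebra_simps)
  then show ?case using g ideal_facts[OF J]
    by (metis supported_on_add supported_on_const_mult)
qed

section \<open>Straightening\<close>

text \<open>
  The setting of straightening is shared by the given algebra and by the candidate for a presentation
  of \<open>F\<^sub>0 A\<close>, at a stage where termination of its reductions and its Groebner basis are still to be
  established.
\<close>

locale commutation_relations =
  fixes D :: "'k::field pbw_data"
  assumes ord: "well_monomial_ordering (nv D) (prec D)"
    and cc_nonzero: "\<And>i j. 1 \<le> i \<Longrightarrow> i < j \<Longrightarrow> j \<le> nv D \<Longrightarrow> cc D i j \<noteq> 0"
    and dd_std: "\<And>i j. 1 \<le> i \<Longrightarrow> i < j \<Longrightarrow> j \<le> nv D \<Longrightarrow> dd D i j \<in> supported_on (std_words (nv D))"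
    and dd_lower: "\<And>i j w. 1 \<le> i \<Longrightarrow> i < j \<Longrightarrow> j \<le> nv D \<Longrightarrow> w \<in> Poly_Mapping.keys (dd D i j) \<Longrightarrow>
       prec D (wexp w) (Poly_Mapping.single i 1 + Poly_Mapping.single j 1)"
begin

sublocale well_monomial_ordering "nv D" "prec D" by (rule ord)

abbreviation "n \<equiv> nv D"

abbreviation prec_infix (infix "\<prec>" 50) where "prec_infix \<equiv> prec D"

text \<open>
  Words are compared by their exponents and then lexicographically, so that a reduction step replaces
  a word by smaller ones.
\<close>

definition word_order :: "(nat list \<times> nat list) set" where
  "word_order = inv_image ({(\<alpha>, \<beta>). \<alpha> \<in> exps n \<and> \<beta> \<in> exps n \<and> \<alpha> \<prec> \<beta>} <*lex*> lenlex less_than)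
     (\<lambda>w. (wexp w, w))"

lemma wf_word_order: "wf word_order"
  unfolding word_order_def by (intro wf_inv_image wf_lex_prod wf_ordering wf_lenlex wf_less_than)

lemma swap_decreases:
  assumes "m @ [j, i] @ m' \<in> words n" "i < j"
  shows "(m @ [i, j] @ m', m @ [j, i] @ m') \<in> word_order"
proof -
  have "(m @ [i, j] @ m', m @ [j, i] @ m') \<in> lenlex less_than"
    using assms(2) by (auto simp: lenlex_conv lex_append_leftI)
  moreover have "wexp (m @ [i, j] @ m') = wexp (m @ [j, i] @ m')" by (simp add: ac_simps)
  ultimately show ?thesis by (simp add: word_order_def)
qed

lemma lower_exponent:
  assumes "m @ [j, i] @ m' \<in> words n" "i < j" "z \<in> Poly_Mapping.keys (dd D i j)"
  shows "wexp (m @ z @ m') \<prec> wexp (m @ [j, i] @ m')" "z \<in> std_words n" "m @ z @ m' \<in> words n"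
proof -
  have ij: "1 \<le> i" "i < j" "j \<le> n" using assms by (auto simp: words_def)
  show z: "z \<in> std_words n" using dd_std[OF ij] assms(3) by (auto simp: supported_on_def)
  then have zw: "z \<in> words n" using std_words_subset by blast
  then show "m @ z @ m' \<in> words n" using assms(1) by simp
  have ex: "wexp m \<in> exps n" "wexp m' \<in> exps n" "wexp z \<in> exps n" "wexp [i, j] \<in> exps n"
    using assms(1) zw by (intro wexp_in_exps; simp)+
  have "wexp z \<prec> wexp [i, j]" using dd_lower[OF ij assms(3)] by simp
  then have "wexp z + (wexp m + wexp m') \<prec> wexp [i, j] + (wexp m + wexp m')"
    using ex by (intro add_mono) auto
  then show "wexp (m @ z @ m') \<prec> wexp (m @ [j, i] @ m')" by (simp add: ac_simps)
qed

lemma lower_decreases: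
  assumes "m @ [j, i] @ m' \<in> words n" "i < j" "z \<in> Poly_Mapping.keys (dd D i j)"
  shows "(m @ z @ m', m @ [j, i] @ m') \<in> word_order"
proof -
  have "wexp (m @ z @ m') \<in> exps n" "wexp (m @ [j, i] @ m') \<in> exps n"
    using lower_exponent(3)[OF assms] assms(1) wexp_in_exps by blast+
  then show ?thesis using lower_exponent(1)[OF assms] by (simp add: word_order_def del: wexp_simps)
qed

lemma descent:
  assumes "w \<in> words n" "w \<notin> std_words n"
  obtains m j i m' where "w = m @ [j, i] @ m'" "i < j"
proof -
  have "\<exists>m j i m'. w = m @ [j, i] @ m' \<and> i < j" if "\<not> sorted w" for w :: "nat list"
    using that
  proof (induction w)
    case (Cons a w)
    show ?case
    proof (cases "sorted w")
      case False
      then show ?thesis using Cons.IH by (metis append_Cons)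
    next
      case True
      then obtain b w' where "w = b # w'" "b < a" using Cons.prems
        by (cases w) fastforce+
      then show ?thesis by (metis append_Cons append_Nil)
    qed
  qed simp
  moreover have "\<not> sorted w" using assms by (simp add: std_words_def)
  ultimately show thesis using that by blast
qed

definition below :: "(nat \<Rightarrow> int) \<Rightarrow> nat list \<Rightarrow> nat list set" where
  "below u w = {v \<in> std_words n. wexp v \<prec> wexp w \<and> word_deg u v \<le> word_deg u w}"

lemma below_trans:
  "v \<in> words n \<Longrightarrow> w \<in> words n \<Longrightarrow> wexp v \<prec> wexp w \<Longrightarrow> word_deg u v \<le> word_deg u w \<Longrightarrow>
    below u v \<subseteq> below u w"
  using trans wexp_in_exps std_words_subset unfolding below_def by fastforce

lemma weight_vector_keys:
  assumes "weight_vector D u" "1 \<le> i" "i < j" "j \<le> n" "z \<in> Poly_Mapping.keys (dd D i j)"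
  shows "word_deg u z \<le> u i + u j"
proof -
  have "dd D i j \<noteq> 0" using assms(5) by auto
  moreover have "deg u (dd D i j) \<le> deg u (word [i, j] :: 'k ncpoly)"
    using assms by (auto simp: weight_vector_def)
  ultimately have "Max (word_deg u ` Poly_Mapping.keys (dd D i j)) \<le> u i + u j"
    by (simp add: deg_def word_deg_def)
  moreover have "word_deg u z \<le> Max (word_deg u ` Poly_Mapping.keys (dd D i j))"
    using assms(5) by (intro Max_ge) auto
  ultimately show ?thesis by linarith
qed

text \<open>
  Induction along the ordering of words. For a descent \<open>w = m x\<^sub>j x\<^sub>i m'\<close> the commutation relation
  replaces \<open>w\<close> by a nonzero multiple of the word with the two letters exchanged, which has the same
  sorted rearrangement, plus words of smaller exponent. The weight does not increase because
  \<open>d\<^sub>i\<^sub>j\<close> has at most the weight of \<open>x\<^sub>i x\<^sub>j\<close>.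
\<close>

theorem straighten:
  assumes J: "ideal J (free_alg n)" and rels: "comm_rels D \<subseteq> J" and u: "weight_vector D u"
    and "w \<in> words n"
  shows "\<exists>c r. c \<noteq> 0 \<and> r \<in> supported_on (below u w) \<and> word w - (const c * word (sort w) + r) \<in> J"
  using \<open>w \<in> words n\<close>
proof (induction w rule: wf_induct_rule[OF wf_word_order])
  case (1 w)
  note Jf = ideal_facts[OF J]
  show ?case
  proof (cases "w \<in> std_words n")
    case True
    then show ?thesis using Jf(2)
      by (intro exI[of _ 1] exI[of _ 0]) (simp add: std_words_def sorted_sort_id)
  next
    case False
    then obtain m j i m' where w: "w = m @ [j, i] @ m'" "i < j" using descent[OF "1.prems"] by blast
    have ij: "1 \<le> i" "i < j" "j \<le> n" and m: "m \<in> words n" "m' \<in> words n"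
      using "1.prems" w by (auto simp: words_def)
    define w' where "w' = m @ [i, j] @ m'"
    define d where "d = dd D i j"
    have ws: "mset w' = mset w" by (simp add: w w'_def)
    have ww: "wexp w' = wexp w" "word_deg u w' = word_deg u w" "sort w' = sort w"
      using ws by (auto intro: wexp_cong_mset word_deg_cong_mset properties_for_sort)
    have "(w', w) \<in> word_order" "w' \<in> words n"
      using swap_decreases[of m j i m'] "1.prems" w by (simp_all add: w'_def)
    from "1.IH"[OF this] obtain c r where c: "c \<noteq> 0" "r \<in> supported_on (below u w)"
      "word w' - (const c * word (sort w) + r) \<in> J"
      unfolding below_def ww by blast
    have "\<exists>g\<in>supported_on (below u w). word m * d * word m' - g \<in> J"
    proof (rule linear_congruence[OF J linear_map_sandwich linear_map_id])
      show "d \<in> supported_on (Poly_Mapping.keys d)" by (simp add: supported_on_def)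
      fix z assume z: "z \<in> Poly_Mapping.keys d"
      let ?v = "m @ z @ m'"
      note low = lower_exponent[of m j i m' z, folded w(1) d_def, OF "1.prems" w(2) z]
      have dz: "word_deg u ?v \<le> word_deg u w"
        using weight_vector_keys[OF u ij, of z] z by (simp add: w d_def word_deg_def)
      have "(?v, w) \<in> word_order" using lower_decreases "1.prems" w z by (auto simp: d_def)
      from "1.IH"[OF this low(3)] obtain c r where c: "r \<in> supported_on (below u ?v)"
        "word ?v - (const c * word (sort ?v) + r) \<in> J"
        by blast
      have "sort ?v \<in> below u w"
        using sort_in_std_words[OF low(3)] low(1) dz word_deg_cong_mset[of "sort ?v" ?v u]
        by (simp add: below_def del: word_deg_append wexp_simps)
      then have "const c * word (sort ?v) + r \<in> supported_on (below u w)"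
        using c(1) below_trans[OF low(3) "1.prems" low(1) dz]
        by (intro supported_on_add supported_on_const_mult) (auto intro: supported_on_mono)
      moreover have "word m * word z * word m' = (word ?v :: 'k ncpoly)" by (simp add: word_mult)
      ultimately show "\<exists>g\<in>supported_on (below u w). word m * word z * word m' - g \<in> J"
        using c(2) by auto
    qed
    then obtain g where g: "g \<in> supported_on (below u w)" "word m * d * word m' - g \<in> J" by blast
    \<comment> \<open>Insert the straightened forms of \<open>w'\<close> and of the lower terms into the commutation relation.\<close>
    have "word [j, i] - const (cc D i j) * word [i, j] - d \<in> J"
      using rels ij unfolding comm_rels_def d_def by blast
    then have "word m * (word [j, i] - const (cc D i j) * word [i, j] - d) * word m' \<in> J"
      using Jf m by simp
    moreover have "word m * (word [j, i] - const (cc D i j) * word [i, j] - d) * word m' =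
        word w - const (cc D i j) * word w' - word m * d * word m'"
    proof -
      have "word w = word m * word [j, i] * (word m' :: 'k ncpoly)"
        "word w' = word m * word [i, j] * (word m' :: 'k ncpoly)"
        by (simp_all add: w w'_def word_mult)
      moreover have "word m * (const (cc D i j) * word [i, j]) * word m' =
          const (cc D i j) * (word m * word [i, j] * word m')"
        by (metis const_commute mult.assoc)
      ultimately show ?thesis by (simp only: left_diff_distrib right_diff_distrib)
    qed
    ultimately have "word w - const (cc D i j) * word w' - word m * d * word m' \<in> J" by simp
    moreover have "const (cc D i j) * (word w' - (const c * word (sort w) + r)) \<in> J"
      by (rule Jf(7)[OF c(3)])
    ultimately have "word w - const (cc D i j) * word w' - word m * d * word m'
      + const (cc D i j) * (word w' - (const c * word (sort w) + r)) + (word m * d * word m' - g) \<in> J"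
      using g(2) by (intro Jf(3))
    moreover have "word w - const (cc D i j) * word w' - word m * d * word m'
      + const (cc D i j) * (word w' - (const c * word (sort w) + r)) + (word m * d * word m' - g)
      = word w - (const (cc D i j * c) * word (sort w) + (const (cc D i j) * r + g))"
      by (simp add: algebra_simps) (metis const_commute mult.assoc)
    moreover have "const (cc D i j) * r + g \<in> supported_on (below u w)"
      using c g by (intro supported_on_add supported_on_const_mult)
    ultimately show ?thesis using c(1) cc_nonzero[OF ij]
      by (intro exI[of _ "cc D i j * c"] exI[of _ "const (cc D i j) * r + g"]) simp
  qed
qed

end


section \<open>Residue classes\<close>

locale pbw_relations = commutation_relations +
  assumes II_std: "II D \<subseteq> supported_on (std_words (nv D))"
begin

lemma comm_rels_carrier: "comm_rels D \<subseteq> supported_on (words n)"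
proof
  fix f assume "f \<in> comm_rels D"
  then obtain i j where ij: "1 \<le> i" "i < j" "j \<le> n"
    and f: "f = word [j, i] - const (cc D i j) * word [i, j] - dd D i j"
    unfolding comm_rels_def by blast
  have "dd D i j \<in> supported_on (words n)"
    using dd_std[OF ij] supported_on_mono[OF std_words_subset] by blast
  moreover have "[j, i] \<in> words n" "[i, j] \<in> words n" using ij by auto
  ultimately show "f \<in> supported_on (words n)"
    unfolding f by (intro supported_on_diff supported_on_const_mult) simp_all
qed

lemma generators_carrier: "II D \<union> comm_rels D \<subseteq> carrier (free_alg n)"
  using comm_rels_carrier II_std supported_on_mono[OF std_words_subset]
  by (auto simp: carrier_free_alg)

lemma ideal_pbw: "ideal (pbw_ideal D) (free_alg n)"
  unfolding pbw_ideal_def using ring.genideal_ideal[OF ring_free_alg generators_carrier] .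

lemma generators_in_ideal: "II D \<union> comm_rels D \<subseteq> pbw_ideal D"
  unfolding pbw_ideal_def using ring.genideal_self[OF ring_free_alg generators_carrier] .

lemma comm_rels_in_ideal: "comm_rels D \<subseteq> pbw_ideal D"
  using generators_in_ideal by blast

lemma ring_pbw_alg: "ring (pbw_alg D)"
  unfolding pbw_alg_def by (rule ideal.quotient_is_ring[OF ideal_pbw])

lemma residue_hom: "residue D \<in> ring_hom (free_alg n) (pbw_alg D)"
proof -
  have "residue D = (+>\<^bsub>free_alg n\<^esub>) (pbw_ideal D)" by (simp add: residue_def fun_eq_iff)
  then show ?thesis unfolding pbw_alg_def using ideal.rcos_ring_hom[OF ideal_pbw] by simp
qed

lemma residue_carrier: "f \<in> supported_on (words n) \<Longrightarrow> residue D f \<in> carrier (pbw_alg D)"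
  using ring_hom_closed[OF residue_hom] by (simp add: carrier_free_alg)

lemma residue_add: "f \<in> supported_on (words n) \<Longrightarrow> g \<in> supported_on (words n) \<Longrightarrow>
    residue D (f + g) = residue D f \<oplus>\<^bsub>pbw_alg D\<^esub> residue D g"
  using ring_hom_add[OF residue_hom] by (simp add: carrier_free_alg)

lemma residue_mult: "f \<in> supported_on (words n) \<Longrightarrow> g \<in> supported_on (words n) \<Longrightarrow>
    residue D (f * g) = residue D f \<otimes>\<^bsub>pbw_alg D\<^esub> residue D g"
  using ring_hom_mult[OF residue_hom] by (simp add: carrier_free_alg)

lemma residue_one: "residue D 1 = \<one>\<^bsub>pbw_alg D\<^esub>"
  using ring_hom_one[OF residue_hom] by simp

lemma residue_eq_iff: "f \<in> supported_on (words n) \<Longrightarrow> g \<in> supported_on (words n) \<Longrightarrow>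
    residue D f = residue D g \<longleftrightarrow> f - g \<in> pbw_ideal D"
  using ring.quotient_eq_iff_same_a_r_cos[OF ring_free_alg ideal_pbw, of f g]
  by (simp add: residue_def carrier_free_alg a_minus_free_alg)

lemma residue_zero: "residue D 0 = \<zero>\<^bsub>pbw_alg D\<^esub>"
  using ring_hom_zero[OF residue_hom ring_free_alg ring_pbw_alg] by simp

lemma residue_eq_zero_iff:
  "f \<in> supported_on (words n) \<Longrightarrow> residue D f = \<zero>\<^bsub>pbw_alg D\<^esub> \<longleftrightarrow> f \<in> pbw_ideal D"
  using residue_eq_iff[of f 0] by (simp add: residue_zero)

lemma residue_uminus:
  assumes "f \<in> supported_on (words n)"
  shows "\<ominus>\<^bsub>pbw_alg D\<^esub> residue D f = residue D (- f)"
proof -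
  interpret R: ring "pbw_alg D" by (rule ring_pbw_alg)
  note m = supported_on_uminus[OF assms]
  have "residue D (- f) \<oplus>\<^bsub>pbw_alg D\<^esub> residue D f = \<zero>\<^bsub>pbw_alg D\<^esub>"
    using residue_add[OF m assms] residue_zero by simp
  then show ?thesis
    by (rule R.minus_equality[OF _ residue_carrier[OF assms] residue_carrier[OF m]])
qed

lemma const_words: "const a \<in> supported_on (words n)"
  using const_in_carrier[of a n] by (simp add: carrier_free_alg)

end

section \<open>The weight filtration\<close>

definition wt :: "nat \<Rightarrow> (nat \<Rightarrow> int) \<Rightarrow> expo \<Rightarrow> int" where
  "wt n u \<alpha> = (\<Sum>i\<in>{1..n}. u i * int (Poly_Mapping.lookup \<alpha> i))"

lemma wt_add: "wt n u (\<alpha> + \<beta>) = wt n u \<alpha> + wt n u \<beta>"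
  by (simp add: wt_def lookup_add algebra_simps sum.distrib)

lemma wt_zero [simp]: "wt n u 0 = 0"
  by (simp add: wt_def)

lemma wt_single: "i \<in> {1..n} \<Longrightarrow> wt n u (Poly_Mapping.single i k) = u i * int k"
  by (simp add: wt_def lookup_single when_def if_distrib sum.delta cong: if_cong)

lemma word_deg_wt: "w \<in> words n \<Longrightarrow> word_deg u w = wt n u (wexp w)"
  by (induction w) (auto simp: word_deg_def wt_add wt_single)

lemma deg_le_iff: "Defs.deg u f \<le> Fin k \<longleftrightarrow> f \<in> supported_on {w. word_deg u w \<le> k}"
proof (cases "f = 0")
  case False
  then have "Poly_Mapping.keys f \<noteq> {}" by simp
  then show ?thesis using False by (auto simp: Defs.deg_def supported_on_def)
qed (simp add: Defs.deg_def)

definition words_upto :: "nat \<Rightarrow> (nat \<Rightarrow> int) \<Rightarrow> int \<Rightarrow> nat list set" where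
  "words_upto n u k = {w \<in> words n. word_deg u w \<le> k}"

lemma filt_alt:
  fixes D :: "'k::field pbw_data"
  shows "filt D u k = residue D ` supported_on (words_upto (nv D) u k)"
proof -
  have "{r \<in> carrier (free_alg (nv D)). Defs.deg u r \<le> Fin k} =
      (supported_on (words_upto (nv D) u k) :: 'k ncpoly set)"
    unfolding deg_le_iff carrier_free_alg by (auto simp: supported_on_def words_upto_def)
  then show ?thesis by (simp add: filt_def)
qed

lemma words_upto_subset: "supported_on (words_upto n u k) \<subseteq> supported_on (words n)"
  by (rule subsetI, erule supported_on_mono[rotated]) (auto simp: words_upto_def)

locale weighted_relations = pbw_relations +
  fixes u :: "nat \<Rightarrow> int"
  assumes weight: "weight_vector D u"
begin

lemma straighten_residue:
  assumes "w \<in> words n"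
  obtains c r where "c \<noteq> 0" "r \<in> supported_on (below u w)"
    "word w - (const c * word (sort w) + r) \<in> pbw_ideal D"
  using straighten[OF ideal_pbw comm_rels_in_ideal weight assms] by blast

lemma standard_representative:
  assumes "f \<in> supported_on (words_upto n u k)"
  shows "\<exists>g\<in>supported_on (std_words n \<inter> words_upto n u k). f - g \<in> pbw_ideal D"
proof (rule linear_congruence[OF ideal_pbw linear_map_id linear_map_id _ assms])
  fix w assume "w \<in> words_upto n u k"
  then have w: "w \<in> words n" "word_deg u w \<le> k" by (auto simp: words_upto_def)
  obtain c r where r: "r \<in> supported_on (below u w)"
    "word w - (const c * word (sort w) + r) \<in> pbw_ideal D"
    using straighten_residue[OF w(1)] .
  have "below u w \<subseteq> std_words n \<inter> words_upto n u k"
    using w(2) std_words_subset by (auto simp: below_def words_upto_def)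
  moreover have "sort w \<in> std_words n \<inter> words_upto n u k"
    using sort_in_std_words[OF w(1)] std_words_subset w(2) word_deg_cong_mset[of "sort w" w u]
    by (auto simp: words_upto_def)
  ultimately have "const c * word (sort w) + r \<in> supported_on (std_words n \<inter> words_upto n u k)"
    using r(1) by (intro supported_on_add supported_on_const_mult) (auto intro: supported_on_mono)
  then show "\<exists>g\<in>supported_on (std_words n \<inter> words_upto n u k). word w - g \<in> pbw_ideal D"
    using r(2) by blast
qed

lemma filt_add: "x \<in> filt D u k \<Longrightarrow> y \<in> filt D u k \<Longrightarrow> x \<oplus>\<^bsub>pbw_alg D\<^esub> y \<in> filt D u k"
  unfolding filt_alt
  using residue_add[OF subsetD[OF words_upto_subset] subsetD[OF words_upto_subset], symmetric]
  by (auto intro!: imageI supported_on_add)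

lemma filt_mult: "x \<in> filt D u k \<Longrightarrow> y \<in> filt D u l \<Longrightarrow> x \<otimes>\<^bsub>pbw_alg D\<^esub> y \<in> filt D u (k + l)"
  unfolding filt_alt
  using residue_mult[OF subsetD[OF words_upto_subset] subsetD[OF words_upto_subset], symmetric]
  by (auto intro!: imageI elim!: supported_on_mult simp: words_upto_def)

lemma filt_uminus: "x \<in> filt D u k \<Longrightarrow> \<ominus>\<^bsub>pbw_alg D\<^esub> x \<in> filt D u k"
  unfolding filt_alt
  using residue_uminus[OF subsetD[OF words_upto_subset]]
  by (auto intro!: imageI supported_on_uminus)

lemma filt_carrier: "filt D u k \<subseteq> carrier (pbw_alg D)"
  unfolding filt_alt using residue_carrier words_upto_subset by blast

lemma residue_word_filt: "w \<in> words n \<Longrightarrow> word_deg u w \<le> k \<Longrightarrow> residue D (word w) \<in> filt D u k"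
  unfolding filt_alt by (intro imageI) (simp add: words_upto_def)

lemma residue_const_filt: "residue D (const a) \<in> filt D u 0"
  unfolding filt_alt
  by (intro imageI) (auto simp: supported_on_def const_def words_upto_def word_deg_def)

lemma std_residue_filt: "\<alpha> \<in> exps n \<Longrightarrow> wt n u \<alpha> \<le> k \<Longrightarrow> std_residue D \<alpha> \<in> filt D u k"
  unfolding std_residue_def
  using subsetD[OF std_words_subset std_word_in_std_words]
  by (intro residue_word_filt) (simp_all add: word_deg_wt[of _ n] wexp_std_word)

lemma subring_filt: "subring (filt D u 0) (pbw_alg D)"
proof (rule ring.subringI[OF ring_pbw_alg])
  show "\<one>\<^bsub>pbw_alg D\<^esub> \<in> filt D u 0"
    using residue_const_filt[of 1] by (simp add: residue_one)
qed (use filt_add filt_mult[of _ 0 _ 0] filt_uminus filt_carrier in auto)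

lemma additive_subgroup_filt: "additive_subgroup (filt D u k) (pbw_alg D)"
proof (rule additive_subgroupI)
  interpret R: ring "pbw_alg D" by (rule ring_pbw_alg)
  have "residue D 0 \<in> filt D u k" unfolding filt_alt by (intro imageI) simp
  then show "subgroup (filt D u k) (add_monoid (pbw_alg D))"
    using filt_add filt_uminus filt_carrier by (intro R.add.subgroupI) (auto simp: a_inv_def)
qed

lemma residue_in_subspace:
  assumes add: "\<And>x y. x \<in> T \<Longrightarrow> y \<in> T \<Longrightarrow> x \<oplus>\<^bsub>pbw_alg D\<^esub> y \<in> T"
    and scale: "\<And>a x. x \<in> T \<Longrightarrow> residue D (const a) \<otimes>\<^bsub>pbw_alg D\<^esub> x \<in> T"
    and zero: "\<zero>\<^bsub>pbw_alg D\<^esub> \<in> T"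
    and words: "\<And>w. w \<in> X \<Longrightarrow> w \<in> words n \<and> residue D (word w) \<in> T"
    and f: "f \<in> supported_on X"
  shows "residue D f \<in> T"
proof -
  from f have "residue D f \<in> T \<and> f \<in> supported_on (words n)"
  proof (induction rule: ncpoly_induct)
    case zero
    then show ?case using assms(3) by (simp add: residue_zero)
  next
    case (add a w g)
    have w: "word w \<in> supported_on (words n)" using words[OF add(1)] by simp
    have cw: "const a * word w \<in> supported_on (words n)" by (rule supported_on_const_mult[OF w])
    have "residue D (const a * word w) \<in> T"
      using scale words[OF add(1)] by (simp add: residue_mult[OF const_words w])
    then show ?case
      using assms(1) add.IH cw by (simp add: residue_add supported_on_add)
  qed
  then show ?thesis by blast
qed

text \<open>
  Well-founded induction along the monomial ordering: a linear subspace that contains, for every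
  exponent of weight at most \<open>k\<close>, the residue class of some rearrangement of its standard monomial
  contains \<open>F\<^sub>k A\<close>, because straightening the rearrangement only produces smaller exponents of weight
  at most \<open>k\<close>. The rearrangement may be chosen using that the smaller standard monomials are already
  known to lie in the subspace.
\<close>

lemma filt_subsetI:
  assumes add: "\<And>x y. x \<in> T \<Longrightarrow> y \<in> T \<Longrightarrow> x \<oplus>\<^bsub>pbw_alg D\<^esub> y \<in> T"
    and scale: "\<And>a x. x \<in> T \<Longrightarrow> residue D (const a) \<otimes>\<^bsub>pbw_alg D\<^esub> x \<in> T"
    and zero: "\<zero>\<^bsub>pbw_alg D\<^esub> \<in> T"
    and step: "\<And>\<alpha>. \<lbrakk>\<alpha> \<in> exps n; wt n u \<alpha> \<le> k;
        \<And>\<beta>. \<lbrakk>\<beta> \<in> exps n; wt n u \<beta> \<le> k; \<beta> \<prec> \<alpha>\<rbrakk> \<Longrightarrow> std_residue D \<beta> \<in> T\<rbrakk>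
      \<Longrightarrow> \<exists>w\<in>words n. wexp w = \<alpha> \<and> residue D (word w) \<in> T"
  shows "filt D u k \<subseteq> T"
proof -
  have std: "std_residue D \<alpha> \<in> T" if "\<alpha> \<in> exps n" "wt n u \<alpha> \<le> k" for \<alpha>
    using that
  proof (induction \<alpha> rule: wf_induct_rule[OF wf_ordering])
    case (1 \<alpha>)
    then obtain w where w: "w \<in> words n" "wexp w = \<alpha>" "residue D (word w) \<in> T"
      using step[of \<alpha>] by blast
    obtain c r where c: "c \<noteq> 0" and r: "r \<in> supported_on (below u w)"
      and eq: "word w - (const c * word (sort w) + r) \<in> pbw_ideal D"
      using straighten_residue[OF w(1)] .
    have sw: "sort w = std_word n \<alpha>" using std_word_wexp[OF w(1)] w(2) by simp
    have car: "word w \<in> supported_on (words n)" "word (sort w) \<in> supported_on (words n)"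
      using w(1) sort_in_std_words std_words_subset by auto
    have "below u w \<subseteq> words n" using std_words_subset by (auto simp: below_def)
    then have rc: "r \<in> supported_on (words n)" using r supported_on_mono by blast
    have "residue D r \<in> T"
    proof (rule residue_in_subspace[OF add scale zero _ r])
      fix v assume v: "v \<in> below u w"
      then have vs: "v \<in> std_words n" "v \<in> words n" "wexp v \<prec> \<alpha>" "word_deg u v \<le> word_deg u w"
        using std_words_subset w(2) by (auto simp: below_def)
      have "wexp v \<in> exps n" "wt n u (wexp v) \<le> k"
        using wexp_in_exps[OF vs(2)] vs(4) w "1.prems" word_deg_wt[OF vs(2)] word_deg_wt[OF w(1)] by auto
      then have "std_residue D (wexp v) \<in> T" using "1.IH" vs(3) "1.prems" by blast
      then show "v \<in> words n \<and> residue D (word v) \<in> T"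
        using vs by (simp add: std_residue_def std_word_wexp_std)
    qed
    have "word (sort w) - const (inverse c) * (word w + const (-1) * r)
      = const (- inverse c) * (word w - (const c * word (sort w) + r))"
    proof -
      have "const (inverse c) * (const c * word (sort w)) = word (sort w)"
        using c by (simp add: mult.assoc[symmetric] flip: const_hom(6))
      then show ?thesis by (simp add: algebra_simps)
    qed
    then have "word (sort w) - const (inverse c) * (word w + const (-1) * r) \<in> pbw_ideal D"
      using ideal_facts(7)[OF ideal_pbw eq] by metis
    then have "residue D (word (sort w)) = residue D (const (inverse c) * (word w + const (-1) * r))"
      using car(2) supported_on_const_mult[OF supported_on_add[OF car(1) supported_on_const_mult[OF rc]]]
        residue_eq_iff by blast
    also have "\<dots> = residue D (const (inverse c)) \<otimes>\<^bsub>pbw_alg D\<^esub>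
        (residue D (word w) \<oplus>\<^bsub>pbw_alg D\<^esub> (residue D (const (-1)) \<otimes>\<^bsub>pbw_alg D\<^esub> residue D r))"
      by (simp only: residue_mult residue_add const_words car rc supported_on_const_mult supported_on_add)
    also have "\<dots> \<in> T" using w(3) \<open>residue D r \<in> T\<close> add scale by blast
    finally show ?case by (simp add: std_residue_def sw)
  qed
  show ?thesis
  proof
    fix x assume "x \<in> filt D u k"
    then obtain f where f: "x = residue D f" "f \<in> supported_on (words_upto n u k)"
      by (auto simp: filt_alt)
    then obtain g where g: "g \<in> supported_on (std_words n \<inter> words_upto n u k)" "f - g \<in> pbw_ideal D"
      using standard_representative by blast
    have "g \<in> supported_on (words n)"
      using g(1) supported_on_mono[of "std_words n \<inter> words_upto n u k" "words n"] by (auto simp: words_upto_def)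
    then have "x = residue D g"
      using f g residue_eq_iff[of f g] words_upto_subset by auto
    moreover have "residue D g \<in> T"
    proof (rule residue_in_subspace[OF add scale zero _ g(1)])
      fix w assume "w \<in> std_words n \<inter> words_upto n u k"
      then have w: "w \<in> std_words n" "w \<in> words n" "word_deg u w \<le> k" by (auto simp: words_upto_def)
      then have "std_residue D (wexp w) \<in> T"
        using std[of "wexp w"] wexp_in_exps word_deg_wt by auto
      then show "w \<in> words n \<and> residue D (word w) \<in> T"
        using w by (simp add: std_residue_def std_word_wexp_std)
    qed
    ultimately show "x \<in> T" by simp
  qed
qed

end

section \<open>Decomposing exponents of bounded weight\<close>

text \<open>
  Squares instead of absolute values keep the bound a polynomial, which a program evaluates without
  case distinctions. The summand \<open>1\<close> ensures that splitting off a unit vector from a coordinate above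
  the bound leaves a nonzero rest even if all weights vanish.
\<close>

definition coord_bound :: "nat \<Rightarrow> (nat \<Rightarrow> int) \<Rightarrow> int \<Rightarrow> int" where
  "coord_bound n u j = j * j + 1 + (\<Sum>i\<in>{1..n}. u i * u i)"

definition box :: "nat \<Rightarrow> (nat \<Rightarrow> int) \<Rightarrow> int \<Rightarrow> expo set" where
  "box n u j = {\<alpha> \<in> exps n. wt n u \<alpha> \<le> j \<and> (\<forall>i\<in>{1..n}. int (Poly_Mapping.lookup \<alpha> i) \<le> coord_bound n u j)}"

lemma abs_le_square: "\<bar>a::int\<bar> \<le> a * a"
proof (cases "a = 0")
  case False
  then have "1 * \<bar>a\<bar> \<le> \<bar>a\<bar> * \<bar>a\<bar>" by (intro mult_right_mono) auto
  then show ?thesis by simp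
qed simp

lemma coord_bound_ge: "\<bar>j\<bar> + 1 + (\<Sum>i\<in>{1..n}. \<bar>u i\<bar>) \<le> coord_bound n u j"
  unfolding coord_bound_def by (intro add_mono abs_le_square sum_mono order.refl)

lemma exponent_minus:
  assumes "\<And>k. Poly_Mapping.lookup \<gamma> k \<le> Poly_Mapping.lookup \<alpha> k"
  shows "\<alpha> = \<gamma> + (\<alpha> - \<gamma> :: expo)"
  using assms by (intro poly_mapping_eqI) (simp add: lookup_add lookup_minus)

text \<open>
  If \<open>u\<^sub>i = 0\<close>, then the \<open>i\<close>-th unit vector has weight zero and can be split off. If some coordinate
  \<open>k\<close> whose weight has the opposite sign is at least \<open>\<bar>u\<^sub>i\<bar>\<close>, then \<open>\<bar>u\<^sub>k\<bar>\<close> times the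
  \<open>i\<close>-th and \<open>\<bar>u\<^sub>i\<bar>\<close> times the \<open>k\<close>-th unit vector can be split off, with total weight zero. Otherwise
  the large coordinate \<open>i\<close> dominates the weight. For \<open>u\<^sub>i > 0\<close> this contradicts the bound \<open>j\<close> on the
  weight, and for \<open>u\<^sub>i < 0\<close> the weight is so small that the \<open>i\<close>-th unit vector can be split off.
\<close>

lemma box_split:
  assumes \<alpha>: "\<alpha> \<in> exps n" and j: "wt n u \<alpha> \<le> j" and i: "i \<in> {1..n}"
    and big: "int (Poly_Mapping.lookup \<alpha> i) > coord_bound n u j"
  obtains \<beta> \<gamma> where "\<alpha> = \<gamma> + \<beta>" "\<gamma> \<noteq> 0" "\<beta> \<noteq> 0" "wt n u \<gamma> \<le> 0" "wt n u \<beta> \<le> j"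
proof -
  note split = that
  define S where "S = (\<Sum>k\<in>{1..n}-{i}. \<bar>u k\<bar>)"
  define a where "a = int (Poly_Mapping.lookup \<alpha> i)"
  have bnd: "\<bar>j\<bar> + 1 + \<bar>u i\<bar> + S < a"
    using big coord_bound_ge[where j = j and n = n and u = u] sum.remove[OF _ i, of "\<lambda>k. \<bar>u k\<bar>"] by (simp add: S_def a_def)
  have S: "S \<ge> 0" "\<And>k. k \<in> {1..n}-{i} \<Longrightarrow> \<bar>u k\<bar> \<le> S"
    unfolding S_def by (auto intro!: sum_nonneg member_le_sum)
  have wt: "wt n u \<alpha> = u i * a + (\<Sum>k\<in>{1..n}-{i}. u k * int (Poly_Mapping.lookup \<alpha> k))"
    using sum.remove[OF _ i] by (simp add: wt_def a_def)
  have unit: thesis if "u i \<le> 0" "wt n u \<alpha> - u i \<le> j"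
  proof -
    let ?g = "Poly_Mapping.single i (1::nat)"
    have "a \<ge> 2" using bnd S by linarith
    then have eq: "\<alpha> = ?g + (\<alpha> - ?g)"
      by (intro exponent_minus) (auto simp: lookup_single when_def a_def)
    have "Poly_Mapping.lookup (\<alpha> - ?g) i \<noteq> 0" using \<open>a \<ge> 2\<close> by (simp add: lookup_minus a_def)
    then have "\<alpha> - ?g \<noteq> 0" by (metis lookup_zero)
    moreover have "?g \<noteq> 0" by (metis lookup_single_eq lookup_zero one_neq_zero)
    moreover have "wt n u \<alpha> = u i + wt n u (\<alpha> - ?g)"
      using wt_add[of n u ?g "\<alpha> - ?g"] wt_single[OF i, of u 1] eq by simp
    ultimately show thesis using that wt_single[OF i, of u 1] by (intro split[OF eq]) auto
  qed
  have pair: thesis if k: "k \<in> {1..n} - {i}" "int (Poly_Mapping.lookup \<alpha> k) \<ge> \<bar>u i\<bar>"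
     "u i * u k < 0" for k
  proof -
    let ?g = "Poly_Mapping.single i (nat \<bar>u k\<bar>) + Poly_Mapping.single k (nat \<bar>u i\<bar>)"
    have "a > \<bar>u k\<bar>" using bnd S(2)[OF k(1)] by linarith
    then have eq: "\<alpha> = ?g + (\<alpha> - ?g)"
      using k by (intro exponent_minus) (auto simp: lookup_single lookup_add when_def a_def)
    have "Poly_Mapping.lookup (\<alpha> - ?g) i \<noteq> 0"
      using \<open>a > \<bar>u k\<bar>\<close> k by (simp add: lookup_minus lookup_add lookup_single a_def when_def)
    then have "\<alpha> - ?g \<noteq> 0" by (metis lookup_zero)
    moreover have "Poly_Mapping.lookup ?g i \<noteq> 0"
      using k by (auto simp: lookup_add lookup_single)
    then have "?g \<noteq> 0" by (metis lookup_zero)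
    moreover have "wt n u ?g = u i * \<bar>u k\<bar> + u k * \<bar>u i\<bar>"
      using i k(1) by (simp add: wt_add wt_single)
    then have z: "wt n u ?g = 0"
      using k(3) by (auto simp: abs_if mult_less_0_iff algebra_simps)
    moreover have "wt n u \<alpha> = wt n u (\<alpha> - ?g)" using z eq wt_add[of n u ?g "\<alpha> - ?g"] by simp
    ultimately show thesis using j by (intro split[OF eq]) auto
  qed
  show thesis
  proof (cases "\<exists>k\<in>{1..n} - {i}. int (Poly_Mapping.lookup \<alpha> k) \<ge> \<bar>u i\<bar> \<and> u i * u k < 0")
    case True
    then show ?thesis using pair by blast
  next
    case False
    have small: "u i * u k < 0 \<Longrightarrow> int (Poly_Mapping.lookup \<alpha> k) \<le> \<bar>u i\<bar>"
      if "k \<in> {1..n} - {i}" for k using that False by (meson linear)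
    consider "u i = 0" | "u i > 0" | "u i < 0" by linarith
    then show ?thesis
    proof cases
      case 1
      then show ?thesis using unit j by simp
    next
      case 2
      have "(\<Sum>k\<in>{1..n}-{i}. u k * int (Poly_Mapping.lookup \<alpha> k)) \<ge> (\<Sum>k\<in>{1..n}-{i}. - (\<bar>u i\<bar> * \<bar>u k\<bar>))"
      proof (rule sum_mono)
        fix k assume k: "k \<in> {1..n} - {i}"
        show "u k * int (Poly_Mapping.lookup \<alpha> k) \<ge> - (\<bar>u i\<bar> * \<bar>u k\<bar>)"
        proof (cases "u k < 0")
          case True
          then have "int (Poly_Mapping.lookup \<alpha> k) \<le> \<bar>u i\<bar>" using small[OF k] 2 by (simp add: mult_pos_neg)
          then have "u k * int (Poly_Mapping.lookup \<alpha> k) \<ge> u k * \<bar>u i\<bar>"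
            using True by (intro mult_left_mono_neg) auto
          then show ?thesis using True by (simp add: algebra_simps)
        next
          case False
          then have "u k * int (Poly_Mapping.lookup \<alpha> k) \<ge> 0" by simp
          moreover have "\<bar>u i\<bar> * \<bar>u k\<bar> \<ge> 0" by simp
          ultimately show ?thesis by linarith
        qed
      qed
      then have "wt n u \<alpha> \<ge> u i * a - u i * S"
        using 2 by (simp add: wt S_def sum_negf sum_distrib_left[symmetric])
      moreover have "u i * a - u i * S \<ge> \<bar>j\<bar> + 1"
      proof -
        have "u i * (a - S) \<ge> 1 * (\<bar>j\<bar> + 1)" using 2 bnd by (intro mult_mono) auto
        then show ?thesis by (simp add: algebra_simps)
      qed
      moreover have "j \<le> \<bar>j\<bar>" by simp
      ultimately have False using j by (meson add_le_same_cancel1 not_one_le_zero order.trans)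
      then show ?thesis ..
    next
      case 3
      have "(\<Sum>k\<in>{1..n}-{i}. u k * int (Poly_Mapping.lookup \<alpha> k)) \<le> (\<Sum>k\<in>{1..n}-{i}. \<bar>u i\<bar> * \<bar>u k\<bar>)"
      proof (rule sum_mono)
        fix k assume k: "k \<in> {1..n} - {i}"
        show "u k * int (Poly_Mapping.lookup \<alpha> k) \<le> \<bar>u i\<bar> * \<bar>u k\<bar>"
        proof (cases "u k > 0")
          case True
          then have "int (Poly_Mapping.lookup \<alpha> k) \<le> \<bar>u i\<bar>" using small[OF k] 3 by (simp add: mult_neg_pos)
          then have "u k * int (Poly_Mapping.lookup \<alpha> k) \<le> u k * \<bar>u i\<bar>"
            using True by (intro mult_left_mono) auto
          then show ?thesis using True by (simp add: algebra_simps)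
        next
          case False
          then have "u k * int (Poly_Mapping.lookup \<alpha> k) \<le> 0" by (simp add: mult_nonpos_nonneg)
          moreover have "\<bar>u i\<bar> * \<bar>u k\<bar> \<ge> 0" by simp
          ultimately show ?thesis by linarith
        qed
      qed
      then have "wt n u \<alpha> \<le> u i * a - u i * S"
        using 3 by (simp add: wt S_def sum_distrib_left[symmetric] sum_negf)
      moreover have "(- u i) * (a - S - 1) \<ge> 1 * \<bar>j\<bar>" using 3 bnd by (intro mult_mono) auto
      then have "u i * a - u i * S - u i \<le> - \<bar>j\<bar>" by (simp add: algebra_simps)
      ultimately show ?thesis using unit 3 by linarith
    qed
  qed
qed

lemma box_induct_split:
  assumes "\<alpha> \<in> exps n" "wt n u \<alpha> \<le> j" "\<alpha> \<notin> box n u j"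
  obtains \<beta> \<gamma> where "\<alpha> = \<gamma> + \<beta>" "\<gamma> \<noteq> 0" "\<beta> \<noteq> 0" "\<gamma> \<in> exps n" "\<beta> \<in> exps n" "wt n u \<gamma> \<le> 0" "wt n u \<beta> \<le> j"
proof -
  obtain i where "i \<in> {1..n}" "int (Poly_Mapping.lookup \<alpha> i) > coord_bound n u j"
    using assms by (auto simp: box_def not_le)
  then obtain \<beta> \<gamma> where "\<alpha> = \<gamma> + \<beta>" "\<gamma> \<noteq> 0" "\<beta> \<noteq> 0" "wt n u \<gamma> \<le> 0" "wt n u \<beta> \<le> j"
    using box_split[OF assms(1,2)] by blast
  then show thesis using that exps_addD assms(1) by blast
qed

section \<open>Generators of the weight filtration\<close>

context weighted_relations
begin

lemma std_product:
  assumes "\<gamma> \<in> exps n" "\<beta> \<in> exps n"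
  shows "std_word n \<gamma> @ std_word n \<beta> \<in> words n" "wexp (std_word n \<gamma> @ std_word n \<beta>) = \<gamma> + \<beta>"
    "residue D (word (std_word n \<gamma> @ std_word n \<beta>)) = std_residue D \<gamma> \<otimes>\<^bsub>pbw_alg D\<^esub> std_residue D \<beta>"
  using subsetD[OF std_words_subset std_word_in_std_words]
  by (simp_all add: wexp_std_word assms std_residue_def residue_mult flip: word_mult)

theorem filt_generated_as_algebra: "filt D u 0 = subalg_gen D (std_residue D ` box n u 0)"
proof
  interpret R: ring "pbw_alg D" by (rule ring_pbw_alg)
  let ?H = "range (\<lambda>a. residue D (const a)) \<union> std_residue D ` box n u 0"
  have H: "?H \<subseteq> filt D u 0" using residue_const_filt std_residue_filt by (auto simp: box_def)
  show "subalg_gen D (std_residue D ` box n u 0) \<subseteq> filt D u 0"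
    unfolding subalg_gen_def
    by (rule R.generate_ring_min_subring1[OF _ subring_filt H]) (use H filt_carrier in blast)
  show "filt D u 0 \<subseteq> subalg_gen D (std_residue D ` box n u 0)"
    unfolding subalg_gen_def
  proof (rule filt_subsetI)
    show "residue D (const a) \<otimes>\<^bsub>pbw_alg D\<^esub> x \<in> generate_ring (pbw_alg D) ?H"
      if "x \<in> generate_ring (pbw_alg D) ?H" for a x
      by (intro generate_ring.eng_mult that generate_ring.incl) blast
    fix \<alpha> assume \<alpha>: "\<alpha> \<in> exps n" "wt n u \<alpha> \<le> 0"
      and IH: "\<And>\<beta>. \<lbrakk>\<beta> \<in> exps n; wt n u \<beta> \<le> 0; \<beta> \<prec> \<alpha>\<rbrakk> \<Longrightarrow>
        std_residue D \<beta> \<in> generate_ring (pbw_alg D) ?H"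
    show "\<exists>w\<in>words n. wexp w = \<alpha> \<and> residue D (word w) \<in> generate_ring (pbw_alg D) ?H"
    proof (cases "\<alpha> \<in> box n u 0")
      case True
      then have "std_residue D \<alpha> \<in> generate_ring (pbw_alg D) ?H"
        by (intro generate_ring.incl) blast
      then show ?thesis
        using wexp_std_word[OF \<alpha>(1)] subsetD[OF std_words_subset std_word_in_std_words[of n \<alpha>]]
        by (intro bexI[of _ "std_word n \<alpha>"]) (auto simp: std_residue_def)
    next
      case False
      then obtain \<beta> \<gamma> where bg: "\<alpha> = \<gamma> + \<beta>" "\<gamma> \<noteq> 0" "\<beta> \<noteq> 0" "\<gamma> \<in> exps n" "\<beta> \<in> exps n"
        "wt n u \<gamma> \<le> 0" "wt n u \<beta> \<le> 0"
        using box_induct_split[OF \<alpha>] by blast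
      have "\<beta> \<prec> \<alpha>" "\<gamma> \<prec> \<alpha>"
        using less_add[OF bg(5,4,2)] less_add[OF bg(4,5,3)] bg(1) by (simp_all add: add.commute)
      then have "std_residue D \<gamma> \<otimes>\<^bsub>pbw_alg D\<^esub> std_residue D \<beta> \<in> generate_ring (pbw_alg D) ?H"
        using IH bg by (intro generate_ring.eng_mult) auto
      then show ?thesis using std_product[OF bg(4,5)] bg(1)
        by (intro bexI[of _ "std_word n \<gamma> @ std_word n \<beta>"]) auto
    qed
  qed (use R.zero_in_generate generate_ring.eng_add in auto)
qed

theorem filt_generated_as_module:
  "filt D u j = submod_gen D (filt D u 0) (std_residue D ` box n u j)"
proof
  have "std_residue D ` box n u j \<subseteq> filt D u j" using std_residue_filt by (auto simp: box_def)
  moreover have "\<forall>r\<in>filt D u 0. \<forall>m\<in>filt D u j. r \<otimes>\<^bsub>pbw_alg D\<^esub> m \<in> filt D u j"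
    using filt_mult[of _ 0 _ j] by simp
  ultimately show "submod_gen D (filt D u 0) (std_residue D ` box n u j) \<subseteq> filt D u j"
    unfolding submod_gen_def using additive_subgroup_filt by blast
  show "filt D u j \<subseteq> submod_gen D (filt D u 0) (std_residue D ` box n u j)"
    unfolding submod_gen_def
  proof (rule Inter_greatest, clarify)
    fix M x
    assume M: "additive_subgroup M (pbw_alg D)" "\<forall>r\<in>filt D u 0. \<forall>m\<in>M. r \<otimes>\<^bsub>pbw_alg D\<^esub> m \<in> M"
      "std_residue D ` box n u j \<subseteq> M"
    interpret M: additive_subgroup M "pbw_alg D" by (rule M(1))
    have "filt D u j \<subseteq> M"
    proof (rule filt_subsetI)
      fix \<alpha> assume \<alpha>: "\<alpha> \<in> exps n" "wt n u \<alpha> \<le> j"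
        and IH: "\<And>\<beta>. \<lbrakk>\<beta> \<in> exps n; wt n u \<beta> \<le> j; \<beta> \<prec> \<alpha>\<rbrakk> \<Longrightarrow> std_residue D \<beta> \<in> M"
      show "\<exists>w\<in>words n. wexp w = \<alpha> \<and> residue D (word w) \<in> M"
      proof (cases "\<alpha> \<in> box n u j")
        case True
        then have "std_residue D \<alpha> \<in> M" using M(3) by blast
        then show ?thesis
          using wexp_std_word[OF \<alpha>(1)] subsetD[OF std_words_subset std_word_in_std_words[of n \<alpha>]]
          by (intro bexI[of _ "std_word n \<alpha>"]) (auto simp: std_residue_def)
      next
        case False
        then obtain \<beta> \<gamma> where bg: "\<alpha> = \<gamma> + \<beta>" "\<gamma> \<noteq> 0" "\<beta> \<noteq> 0" "\<gamma> \<in> exps n" "\<beta> \<in> exps n"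
          "wt n u \<gamma> \<le> 0" "wt n u \<beta> \<le> j"
          using box_induct_split[OF \<alpha>] by blast
        have "\<beta> \<prec> \<alpha>" using less_add[OF bg(5,4,2)] bg(1) by (simp add: add.commute)
        then have "std_residue D \<gamma> \<otimes>\<^bsub>pbw_alg D\<^esub> std_residue D \<beta> \<in> M"
          using IH bg M(2) std_residue_filt by auto
        then show ?thesis using std_product[OF bg(4,5)] bg(1)
          by (intro bexI[of _ "std_word n \<gamma> @ std_word n \<beta>"]) auto
      qed
    qed (use M(2) residue_const_filt M.a_closed M.zero_closed in auto)
    then show "x \<in> M" if "x \<in> filt D u j" using that by blast
  qed
qed

end

lemma pbw_datum_relations:
  assumes "pbw_datum A"
  shows "pbw_relations A"
proof -
  have cs: "commutation_system A" and wo: "well_ordering (nv A) (prec A)"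
    and II: "II A \<subseteq> std_space (nv A)" using assms by (auto simp: pbw_datum_def)
  interpret well_monomial_ordering "nv A" "prec A"
    using cs wo by unfold_locales (auto simp: commutation_system_def)
  show ?thesis
  proof unfold_locales
    fix i j w assume ij: "1 \<le> i" "i < j" "j \<le> nv A" and w: "w \<in> Poly_Mapping.keys (dd A i j)"
    have d: "dd A i j \<in> std_space (nv A)" "dd A i j \<noteq> 0"
      "prec A (le_exp (nv A) (prec A) (dd A i j)) (Poly_Mapping.single i 1 + Poly_Mapping.single j 1)"
      using cs ij w unfolding commutation_system_def by fastforce+
    obtain v where v: "v \<in> Poly_Mapping.keys (dd A i j)"
      "le_exp (nv A) (prec A) (dd A i j) = wexp v" "w = v \<or> prec A (wexp w) (wexp v)"
      using leading_word[OF d(1,2)] w by metis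
    have "x \<in> words (nv A)" if "x \<in> Poly_Mapping.keys (dd A i j)" for x
      using that d(1) std_words_subset by (auto simp: std_space_alt supported_on_def)
    then have "wexp v \<in> exps (nv A)" "wexp w \<in> exps (nv A)" using v(1) w wexp_in_exps by blast+
    moreover have "Poly_Mapping.single i 1 + Poly_Mapping.single j 1 \<in> exps (nv A)"
      using ij by (intro exps_closed exps_single) auto
    ultimately show "prec A (wexp w) (Poly_Mapping.single i 1 + Poly_Mapping.single j 1)"
      using v(2,3) d(3) trans by metis
  qed (use cs II in \<open>auto simp: commutation_system_def std_space_alt\<close>)
qed

lemma pbw_datum_weighted:
  "pbw_datum A \<Longrightarrow> weight_vector A u \<Longrightarrow> weighted_relations A u"
  by (simp add: weighted_relations_def weighted_relations_axioms_def pbw_datum_relations)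


section \<open>Termination of reductions\<close>

lemma minus_term_supported:
  "f - const (Poly_Mapping.lookup f w) * word w \<in> supported_on (Poly_Mapping.keys f - {w})"
proof -
  have "Poly_Mapping.lookup (word w :: 'a ncpoly) v = (if v = w then 1 else 0)" for v
    by (simp add: word_def lookup_single when_def)
  then show ?thesis by (auto simp: supported_on_def in_keys_iff lookup_minus split: if_splits)
qed

context commutation_relations
begin

lemma reduction_keys:
  assumes w: "m @ [j, i] @ m' \<in> words n" and ij: "i < j"
  shows "Poly_Mapping.keys (reduction D i j m m' f) \<subseteq>
    (Poly_Mapping.keys f - {m @ [j, i] @ m'}) \<union> {z \<in> words n. (z, m @ [j, i] @ m') \<in> word_order}"
proof -
  let ?w = "m @ [j, i] @ m'" and ?d = "dd D i j"
  let ?Z = "{z \<in> words n. (z, ?w) \<in> word_order}"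
  let ?q = "word m * (const (cc D i j) * word [i, j] + ?d) * word m'"
  have ij': "m @ [i, j] @ m' \<in> ?Z" using swap_decreases[OF w ij] w by simp
  have "?q \<in> supported_on ?Z"
  proof (rule supported_on_mult[OF supported_on_mult[where X = "{m}" and Y = "insert [i, j] (Poly_Mapping.keys ?d)"
        and Z = "(@) m ` insert [i, j] (Poly_Mapping.keys ?d)"], where Y = "{m'}"])
    show "const (cc D i j) * word [i, j] + ?d \<in> supported_on (insert [i, j] (Poly_Mapping.keys ?d))"
      by (intro supported_on_add supported_on_const_mult) (auto simp: supported_on_def)
    show "v @ v' \<in> ?Z" if "v \<in> (@) m ` insert [i, j] (Poly_Mapping.keys ?d)" "v' \<in> {m'}" for v v'
      using that ij' lower_decreases[OF w ij] lower_exponent(3)[OF w ij] by auto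
  qed auto
  then have q: "const (Poly_Mapping.lookup f ?w) * ?q \<in> supported_on ?Z" by (rule supported_on_const_mult)
  have f: "f - const (Poly_Mapping.lookup f ?w) * word ?w \<in> supported_on (Poly_Mapping.keys f - {?w})"
    by (rule minus_term_supported)
  have "reduction D i j m m' f \<in> supported_on ((Poly_Mapping.keys f - {?w}) \<union> ?Z)"
    unfolding reduction_def Let_def
    by (rule supported_on_add[OF supported_on_mono[OF Un_upper1 f] supported_on_mono[OF Un_upper2 q]])
  then show ?thesis by (simp add: supported_on_def)
qed

text \<open>
  Reducing a nonstandard word of \<open>f\<close> replaces it by smaller words, so the nonstandard words of \<open>f\<close>
  decrease in the multiset extension of the ordering of words.
\<close>

theorem reduces_to_standard:
  assumes "f \<in> supported_on (words n)"
  shows "\<exists>g\<in>std_space n. (reduces D)\<^sup>*\<^sup>* f g"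
  using assms
proof (induction "mset_set (Poly_Mapping.keys f - std_words n)" arbitrary: f
    rule: wf_induct_rule[OF wf_mult[OF wf_word_order]])
  case (1 f)
  let ?N = "\<lambda>f. Poly_Mapping.keys f - std_words n"
  show ?case
  proof (cases "?N f = {}")
    case True
    then show ?thesis by (intro bexI[of _ f]) (auto simp: std_space_alt supported_on_def)
  next
    case False
    then obtain w where w: "w \<in> Poly_Mapping.keys f" "w \<notin> std_words n" by blast
    have wn: "w \<in> words n" using w(1) "1.prems" by (auto simp: supported_on_def)
    obtain m j i m' where mj: "w = m @ [j, i] @ m'" "i < j" using descent[OF wn w(2)] .
    define g where "g = reduction D i j m m' f"
    have keys: "Poly_Mapping.keys g \<subseteq> (Poly_Mapping.keys f - {w}) \<union> {z \<in> words n. (z, w) \<in> word_order}"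
      using reduction_keys[of m j i m' f] mj wn by (simp add: g_def)
    have red: "reduces D f g"
      using mj wn unfolding reduces_def g_def words_def by (intro exI[of _ i] exI[of _ j] exI[of _ m] exI[of _ m']) auto
    have "(mset_set (?N f \<inter> ?N g) + mset_set (?N g - ?N f), mset_set (?N f \<inter> ?N g) + mset_set (?N f - ?N g))
      \<in> mult word_order"
    proof (rule one_step_implies_mult)
      have "(w, w) \<notin> word_order" using wf_word_order by (meson wf_not_refl)
      then have "w \<in> ?N f - ?N g" using w keys by auto
      then show "mset_set (?N f - ?N g) \<noteq> {#}"
        "\<forall>k\<in>#mset_set (?N g - ?N f). \<exists>j\<in>#mset_set (?N f - ?N g). (k, j) \<in> word_order"
        using keys by (auto simp: mset_set_empty_iff intro!: bexI[of _ w])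
    qed
    moreover have "mset_set (X \<inter> Y) + mset_set (X - Y) = mset_set X" if "finite X" for X Y :: "nat list set"
      using mset_set_Union[of "X \<inter> Y" "X - Y"] that
      by (metis Diff_disjoint Int_Diff_Un finite_Diff finite_Int inf_assoc inf_bot_right)
    from this[of "?N f" "?N g"] this[of "?N g" "?N f"]
    have "mset_set (?N f \<inter> ?N g) + mset_set (?N f - ?N g) = mset_set (?N f)"
      "mset_set (?N f \<inter> ?N g) + mset_set (?N g - ?N f) = mset_set (?N g)"
      by (simp_all add: Int_commute)
    ultimately have "(mset_set (?N g), mset_set (?N f)) \<in> mult word_order" by simp
    moreover have "g \<in> supported_on (words n)"
      using keys "1.prems" by (auto simp: supported_on_def)
    ultimately obtain h where "h \<in> std_space n" "(reduces D)\<^sup>*\<^sup>* g h" using "1.hyps" by blast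
    then show ?thesis using red by (meson converse_rtranclp_into_rtranclp)
  qed
qed

section \<open>Leading exponents of ideals\<close>

text \<open>
  The zero vector is a weight vector for all commutation relations, so straightening applies to data
  that come without a weight vector.
\<close>

lemma weight_zero: "weight_vector D (\<lambda>_. 0)"
proof -
  have "sum_list (map (\<lambda>_. 0) w) = (0::int)" for w :: "nat list" by (induction w) auto
  then have "word_deg (\<lambda>_. 0) w = 0" for w by (simp add: word_deg_def)
  then have "Defs.deg (\<lambda>_. 0) f \<le> Defs.deg (\<lambda>_. 0) (word w :: 'k ncpoly)" for f :: "'k ncpoly" and w
    by (simp add: Defs.deg_def image_constant_conv)
  then show ?thesis by (simp add: weight_vector_def)
qed

lemma straighten_unweighted:
  assumes J: "ideal J (free_alg n)" and rels: "comm_rels D \<subseteq> J" and w: "w \<in> words n"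
  obtains c r where "c \<noteq> 0" "r \<in> supported_on {v \<in> std_words n. wexp v \<prec> wexp w}"
    "word w - (const c * word (sort w) + r) \<in> J"
  using straighten[OF J rels weight_zero w] supported_on_mono[of "below (\<lambda>_. 0) w"]
  unfolding below_def by (smt (verit, best) Collect_mono_iff supported_on_mono)

lemma standard_representative_mod:
  assumes J: "ideal J (free_alg n)" and rels: "comm_rels D \<subseteq> J" and f: "f \<in> supported_on (words n)"
  shows "\<exists>g\<in>std_space n. f - g \<in> J"
  unfolding std_space_alt
proof (rule linear_congruence[OF J linear_map_id linear_map_id _ f])
  fix w assume w: "w \<in> words n"
  obtain c r where r: "r \<in> supported_on {v \<in> std_words n. wexp v \<prec> wexp w}"
    "word w - (const c * word (sort w) + r) \<in> J"
    using straighten_unweighted[OF J rels w] .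
  have "const c * word (sort w) + r \<in> supported_on (std_words n)"
    using supported_on_mono[OF _ r(1), of "std_words n"] sort_in_std_words[OF w]
    by (intro supported_on_add supported_on_const_mult) auto
  then show "\<exists>g\<in>supported_on (std_words n). word w - g \<in> J" using r(2) by blast
qed

text \<open>
  Multiplying by a standard monomial from the left and straightening multiplies the leading coefficient
  by a nonzero scalar, and all other terms stay below the leading one.
\<close>

lemma l_set_add_closed:
  assumes J: "ideal J (free_alg n)" and rels: "comm_rels D \<subseteq> J"
    and \<alpha>: "\<alpha> \<in> l_set n (\<prec>) (J \<inter> std_space n)" and \<gamma>: "\<gamma> \<in> exps n"
  shows "\<alpha> + \<gamma> \<in> l_set n (\<prec>) (J \<inter> std_space n)"
proof -
  note Jf = ideal_facts[OF J]
  obtain g where g: "g \<in> J" "g \<in> std_space n" "g \<noteq> 0" "le_exp n (\<prec>) g = \<alpha>"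
    using \<alpha> by (auto simp: l_set_def)
  obtain w where w: "w \<in> Poly_Mapping.keys g" "\<alpha> = wexp w"
    "\<And>v. v \<in> Poly_Mapping.keys g \<Longrightarrow> v = w \<or> wexp v \<prec> wexp w"
    using leading_word[OF g(2,3)] g(4) by metis
  have std: "v \<in> Poly_Mapping.keys g \<Longrightarrow> v \<in> words n" for v
    using g(2) std_words_subset by (auto simp: std_space_alt supported_on_def)
  define s where "s = std_word n \<gamma>"
  have s: "s \<in> words n" "wexp s = \<gamma>"
    using subsetD[OF std_words_subset std_word_in_std_words] wexp_std_word[OF \<gamma>] by (auto simp: s_def)
  define a where "a = Poly_Mapping.lookup g w"
  define Y where "Y = {v \<in> std_words n. wexp v \<prec> \<alpha> + \<gamma>}"
  define g1 where "g1 = g - const a * word w"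
  have g1: "g1 \<in> supported_on (Poly_Mapping.keys g - {w})"
    unfolding g1_def a_def by (rule minus_term_supported)
  have sw: "s @ w \<in> words n" "wexp (s @ w) = \<alpha> + \<gamma>" using s w std by (auto simp: add.commute)
  obtain c r where c: "c \<noteq> 0" "r \<in> supported_on Y"
    "word (s @ w) - (const c * word (sort (s @ w)) + r) \<in> J"
    using straighten_unweighted[OF J rels sw(1)] unfolding sw(2) Y_def .
  have "\<exists>h\<in>supported_on Y. word s * g1 * 1 - h \<in> J"
  proof (rule linear_congruence[OF J linear_map_sandwich linear_map_id _ g1])
    fix v assume v: "v \<in> Poly_Mapping.keys g - {w}"
    then have "wexp v \<prec> wexp w" "wexp v \<in> exps n" "wexp w \<in> exps n"
      using w std wexp_in_exps by auto
    then have lt: "wexp (s @ v) \<prec> \<alpha> + \<gamma>"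
      using add_mono[of "wexp v" "wexp w" \<gamma>] \<gamma> w s by (simp add: add.commute)
    have sv: "s @ v \<in> words n" using s v std by auto
    obtain c' r' where c': "r' \<in> supported_on {z \<in> std_words n. wexp z \<prec> wexp (s @ v)}"
      "word (s @ v) - (const c' * word (sort (s @ v)) + r') \<in> J"
      using straighten_unweighted[OF J rels sv] .
    have "{z \<in> std_words n. wexp z \<prec> wexp (s @ v)} \<subseteq> Y"
      using trans[OF _ lt] wexp_in_exps sv sw std_words_subset unfolding Y_def
      by (smt (verit) Collect_mono subsetD)
    moreover have "sort (s @ v) \<in> Y"
      using lt sort_in_std_words[OF sv] by (simp add: Y_def del: wexp_simps)
    ultimately have "const c' * word (sort (s @ v)) + r' \<in> supported_on Y"
      using c'(1) supported_on_mono by (intro supported_on_add supported_on_const_mult) auto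
    then show "\<exists>h\<in>supported_on Y. word s * word v * 1 - h \<in> J"
      using c'(2) by (auto simp: word_mult)
  qed
  then obtain h where h: "h \<in> supported_on Y" "word s * g1 - h \<in> J" by auto
  define b where "b = const a * r + h"
  define q where "q = const (a * c) * word (sort (s @ w)) + b"
  have b: "b \<in> supported_on Y" unfolding b_def using c h by (intro supported_on_add supported_on_const_mult)
  have "word s * g - q = const a * (word (s @ w) - (const c * word (sort (s @ w)) + r)) + (word s * g1 - h)"
  proof -
    have "word s * (const a * word w) = const a * word (s @ w)"
      by (metis const_commute mult.assoc word_mult)
    then show ?thesis by (simp add: g1_def q_def b_def algebra_simps)
  qed
  then have "word s * g - q \<in> J" using c(3) h(2) Jf(3,7) by metis
  moreover have "word s * g \<in> J" using Jf(5)[OF g(1)] s by simp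
  ultimately have "q \<in> J" using Jf(4)[of "word s * g" "word s * g - q"] by simp
  have ss: "sort (s @ w) \<in> std_words n" using sort_in_std_words[OF sw(1)] .
  then have qstd: "q \<in> std_space n"
    unfolding q_def std_space_alt using supported_on_mono[OF _ b, of "std_words n"]
    by (intro supported_on_add supported_on_const_mult) (auto simp: Y_def)
  have nY: "sort (s @ w) \<notin> Y"
    using irrefl[of "\<alpha> + \<gamma>"] sw wexp_in_exps[OF sw(1)] by (simp add: Y_def del: wexp_simps)
  have "a * c \<noteq> 0" using c w by (simp add: a_def in_keys_iff)
  have "Poly_Mapping.lookup q (sort (s @ w)) = a * c"
    using nY b by (auto simp: q_def lookup_add word_def supported_on_def in_keys_iff subset_iff simp del: const_hom)
  then have k: "sort (s @ w) \<in> Poly_Mapping.keys q" using \<open>a * c \<noteq> 0\<close> by (simp add: in_keys_iff)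
  have "Poly_Mapping.keys q \<subseteq> insert (sort (s @ w)) Y"
  proof -
    have "q \<in> supported_on (insert (sort (s @ w)) Y)"
      unfolding q_def using supported_on_mono[OF _ b, of "insert (sort (s @ w)) Y"]
      by (intro supported_on_add supported_on_const_mult) auto
    then show ?thesis by (simp add: supported_on_def)
  qed
  then have "le_exp n (\<prec>) q = wexp (sort (s @ w))"
    using sw(2) by (intro le_expI[OF qstd k]) (auto simp: Y_def)
  then have "le_exp n (\<prec>) q = \<alpha> + \<gamma>" using sw(2) by simp
  moreover have "q \<noteq> 0" using k by auto
  ultimately show ?thesis using \<open>q \<in> J\<close> qstd unfolding l_set_def
    by (intro CollectI exI[of _ q]) simp
qed

text \<open>
  Division: a standard element of the larger ideal loses its leading term on subtracting a multiple of
  an element of the smaller ideal with the same leading exponent. This ends at zero by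
  well-foundedness, and every element is congruent to a standard one
  modulo the smaller ideal.
\<close>

lemma ideal_determined_by_l_set:
  assumes J: "ideal J (free_alg n)" and J': "ideal J' (free_alg n)"
    and rels: "comm_rels D \<subseteq> J'" and sub: "J' \<subseteq> J"
    and l: "l_set n (\<prec>) (J \<inter> std_space n) \<subseteq> l_set n (\<prec>) (J' \<inter> std_space n)"
  shows "J \<subseteq> J'"
proof -
  note Jf = ideal_facts[OF J] and Jf' = ideal_facts[OF J']
  have std: "g \<in> J'" if "g \<in> J" "g \<in> std_space n" for g
    using that
  proof (induction "le_exp n (\<prec>) g" arbitrary: g rule: wf_induct_rule[OF wf_ordering])
    case (1 g)
    show ?case
    proof (cases "g = 0")
      case False
      then have "le_exp n (\<prec>) g \<in> l_set n (\<prec>) (J \<inter> std_space n)"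
        using "1.prems" by (auto simp: l_set_def)
      then obtain f where f: "f \<in> J'" "f \<in> std_space n" "f \<noteq> 0" "le_exp n (\<prec>) f = le_exp n (\<prec>) g"
        using l unfolding l_set_def by fastforce
      obtain w where w: "w \<in> Poly_Mapping.keys g" "le_exp n (\<prec>) g = wexp w"
        "\<And>v. v \<in> Poly_Mapping.keys g \<Longrightarrow> v = w \<or> wexp v \<prec> wexp w"
        using leading_word[OF "1.prems"(2) False] by metis
      obtain w' where w': "w' \<in> Poly_Mapping.keys f" "le_exp n (\<prec>) f = wexp w'"
        "\<And>v. v \<in> Poly_Mapping.keys f \<Longrightarrow> v = w' \<or> wexp v \<prec> wexp w'"
        using leading_word[OF f(2,3)] by metis
      have keys_std: "Poly_Mapping.keys f \<subseteq> std_words n" "Poly_Mapping.keys g \<subseteq> std_words n"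
        using f(2) "1.prems"(2) by (auto simp: std_space_alt supported_on_def)
      then have "w' = w" using wexp_inj_std[of w' n w] w(1,2) w'(1,2) f(4) by auto
      define c where "c = Poly_Mapping.lookup g w / Poly_Mapping.lookup f w"
      define h where "h = g - const c * f"
      have hJ: "h \<in> J" unfolding h_def using Jf(4,7) "1.prems"(1) f(1) sub by blast
      have hs: "h \<in> std_space n"
        using "1.prems"(2) f(2) by (simp add: h_def std_space_alt supported_on_diff supported_on_const_mult)
      have "Poly_Mapping.lookup f w \<noteq> 0" using w'(1) \<open>w' = w\<close> by (simp add: in_keys_iff)
      then have "Poly_Mapping.lookup h w = 0" by (simp add: h_def lookup_minus c_def)
      have low: "wexp v \<prec> wexp w" if "v \<in> Poly_Mapping.keys h" for v
      proof -
        have "v \<in> Poly_Mapping.keys g \<or> v \<in> Poly_Mapping.keys f" "v \<noteq> w"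
          using that \<open>Poly_Mapping.lookup h w = 0\<close> by (auto simp: h_def in_keys_iff lookup_minus)
        then show ?thesis using w(3) w'(3) \<open>w' = w\<close> by auto
      qed
      have "h \<in> J'"
      proof (cases "h = 0")
        case False
        obtain v where v: "v \<in> Poly_Mapping.keys h" "le_exp n (\<prec>) h = wexp v"
          using leading_word[OF hs False] by metis
        have "v \<in> words n" "w \<in> words n"
          using v(1) hs w(1) keys_std std_words_subset[of n] by (auto simp: std_space_alt supported_on_def)
        then show ?thesis
          using "1.hyps"[OF _ hJ hs] low[OF v(1)] v(2) w(2) by (simp add: wexp_in_exps)
      qed (use Jf'(2) in simp)
      then have "h + const c * f \<in> J'" using f(1) Jf'(3,7) by blast
      then show ?thesis by (simp add: h_def)
    qed (use Jf'(2) in simp)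
  qed
  show ?thesis
  proof
    fix f assume f: "f \<in> J"
    then obtain g where g: "g \<in> std_space n" "f - g \<in> J'"
      using standard_representative_mod[OF J' rels, of f] Jf(1) by blast
    have "g \<in> J" using Jf(4)[of f "f - g"] f g(2) sub by auto
    then have "g \<in> J'" using std g(1) by blast
    then have "(f - g) + g \<in> J'" using g(2) Jf'(3) by blast
    then show "f \<in> J'" by simp
  qed
qed

end


section \<open>A presentation of the degree zero part\<close>

text \<open>
  The variables \<open>1, \<dots>, m\<close> of the presentation stand for the standard monomials of \<open>A\<close> whose exponents
  \<open>h 1, \<dots>, h m\<close> are listed in \<open>hs\<close>. On words the substitution is \<open>H\<close>, on exponents it is \<open>\<phi>\<close>.
\<close>

locale filt_zero_presentation = weighted_relations +
  fixes hs :: "expo list"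
  assumes hs_exps: "\<alpha> \<in> set hs \<Longrightarrow> \<alpha> \<in> exps (nv D)" and hs_wt: "\<alpha> \<in> set hs \<Longrightarrow> wt (nv D) u \<alpha> \<le> 0"
    and hs_generate: "\<alpha> \<in> exps (nv D) \<Longrightarrow> wt (nv D) u \<alpha> \<le> 0 \<Longrightarrow> \<exists>vs. set vs \<subseteq> set hs \<and> sum_list vs = \<alpha>"
begin

definition m :: nat where "m = length hs"

definition h :: "nat \<Rightarrow> expo" where "h i = hs ! (i - 1)"

lemma h_in_hs: "i \<in> {1..m} \<Longrightarrow> h i \<in> set hs"
  by (auto simp: h_def m_def)

lemma h_exps: "i \<in> {1..m} \<Longrightarrow> h i \<in> exps n"
  using h_in_hs hs_exps by blast

definition H :: "nat list \<Rightarrow> nat list" where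
  "H w = concat (map (\<lambda>i. std_word n (h i)) w)"

lemma H_simps [simp]: "H [] = []" "H (i # w) = std_word n (h i) @ H w" "H (v @ w) = H v @ H w"
  by (simp_all add: H_def)

text \<open>
  The image of an exponent is the linear combination of the \<open>h i\<close> with its entries as coefficients:
  exponents form a semiring under convolution, in which multiplication by \<open>of_nat k\<close> is
  multiplication by the scalar \<open>k\<close>.
\<close>

definition \<phi> :: "expo \<Rightarrow> expo" where
  "\<phi> \<gamma> = (\<Sum>i\<in>{1..m}. of_nat (Poly_Mapping.lookup \<gamma> i) * h i)"

lemma \<phi>_add: "\<phi> (\<gamma> + \<delta>) = \<phi> \<gamma> + \<phi> \<delta>"
  by (simp add: \<phi>_def lookup_add algebra_simps sum.distrib)

lemma \<phi>_zero [simp]: "\<phi> 0 = 0"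
  by (simp add: \<phi>_def)

lemma \<phi>_single: 
  assumes "i \<in> {1..m}"
  shows "\<phi> (Poly_Mapping.single i 1) = h i"
proof -
  have "\<phi> (Poly_Mapping.single i 1) = (\<Sum>k\<in>{1..m}. if k = i then h i else 0)"
    unfolding \<phi>_def by (rule sum.cong) (auto simp: lookup_single when_def)
  then show ?thesis using assms by simp
qed

lemma \<phi>_exps: "\<phi> \<gamma> \<in> exps n"
proof -
  have *: "of_nat k * \<alpha> \<in> exps n" if "\<alpha> \<in> exps n" for k \<alpha>
    by (induction k) (auto simp: distrib_right that)
  have "(\<Sum>i\<in>X. of_nat (Poly_Mapping.lookup \<gamma> i) * h i) \<in> exps n" if "finite X" "X \<subseteq> {1..m}" for X
    using that by (induction X rule: finite_induct) (auto intro!: exps_closed(2) * h_exps)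
  then show ?thesis by (simp add: \<phi>_def)
qed

lemma wexp_H: "w \<in> words m \<Longrightarrow> wexp (H w) = \<phi> (wexp w)"
  by (induction w) (auto simp: \<phi>_add \<phi>_single[simplified] wexp_std_word h_exps)

lemma H_words: "H w \<in> words n"
  by (induction w) (auto intro: subsetD[OF std_words_subset std_word_in_std_words])

lemma \<phi>_wexp: "w \<in> words m \<Longrightarrow> \<phi> (wexp w) = sum_list (map h w)"
  by (induction w) (auto simp: \<phi>_add \<phi>_single[simplified])

lemma word_deg_H: "w \<in> words m \<Longrightarrow> word_deg u (H w) \<le> 0"
proof (induction w)
  case (Cons i w)
  then have i: "i \<in> {1..m}" by simp
  have "word_deg u (std_word n (h i)) = wt n u (h i)"
    using word_deg_wt[OF subsetD[OF std_words_subset std_word_in_std_words]] wexp_std_word[OF h_exps[OF i]] by simp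
  also have "\<dots> \<le> 0" using hs_wt h_in_hs[OF i] by blast
  finally show ?case using Cons by simp
qed (simp add: word_deg_def)

lemma H_upto: "w \<in> words m \<Longrightarrow> H w \<in> words_upto n u 0"
  using H_words word_deg_H by (simp add: words_upto_def)

lemma \<phi>_surj:
  assumes "\<alpha> \<in> exps n" "wt n u \<alpha> \<le> 0"
  obtains v where "v \<in> std_words m" "\<phi> (wexp v) = \<alpha>"
proof -
  obtain vs where vs: "set vs \<subseteq> set hs" "sum_list vs = \<alpha>" using hs_generate assms by blast
  have "\<exists>w\<in>words m. map h w = vs" using vs(1)
  proof (induction vs)
    case (Cons v vs)
    then obtain w where "w \<in> words m" "map h w = vs" by auto
    moreover obtain k where "k < m" "hs ! k = v" using Cons.prems by (auto simp: in_set_conv_nth m_def)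
    ultimately show ?case by (intro bexI[of _ "Suc k # w"]) (auto simp: h_def)
  qed (intro bexI[of _ "[]"], auto)
  then obtain w where "w \<in> words m" "map h w = vs" by blast
  then show thesis using that[of "sort w"] vs(2) sort_in_std_words by (simp add: \<phi>_wexp)
qed

text \<open>
  Exponents are compared through their images in the given algebra. A tie is broken by the
  lexicographic ordering of finitely supported functions, which is total and compatible with addition.
\<close>

definition prec' :: "expo \<Rightarrow> expo \<Rightarrow> bool" where
  "prec' \<gamma> \<delta> \<longleftrightarrow> \<phi> \<gamma> \<prec> \<phi> \<delta> \<or> \<phi> \<gamma> = \<phi> \<delta> \<and> \<gamma> < \<delta>"

lemma well_monomial_ordering': "well_monomial_ordering m prec'"
proof
  show "monomial_ordering m prec'"
    unfolding monomial_ordering_def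
  proof (intro conjI ballI impI)
    show "irreflp_on (exps m) prec'"
      by (rule irreflp_onI) (auto simp: prec'_def irrefl \<phi>_exps)
    show "transp_on (exps m) prec'"
    proof (rule transp_onI)
      fix x y z assume "prec' x y" "prec' y z"
      then show "prec' x z"
        unfolding prec'_def using trans[of "\<phi> x" "\<phi> y" "\<phi> z"] \<phi>_exps by (metis order.strict_trans)
    qed
    show "totalp_on (exps m) prec'"
      by (rule totalp_onI) (use total \<phi>_exps in \<open>force simp: prec'_def\<close>)
    fix \<alpha> \<beta> \<gamma> assume "prec' \<alpha> \<beta>"
    then show "prec' (\<alpha> + \<gamma>) (\<beta> + \<gamma>)"
      using add_mono[of "\<phi> \<alpha>" "\<phi> \<beta>" "\<phi> \<gamma>"] \<phi>_exps by (auto simp: prec'_def \<phi>_add)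
  qed
  show "well_ordering m prec'"
    unfolding well_ordering_def
  proof (intro ballI)
    fix \<alpha> :: expo
    have "\<not> \<alpha> < 0" by transfer (auto simp: less_fun_def)
    then have "\<alpha> = 0 \<or> 0 < \<alpha>" by auto
    moreover have "\<phi> \<alpha> = 0 \<or> 0 \<prec> \<phi> \<alpha>" using well \<phi>_exps by (auto simp: well_ordering_def)
    ultimately show "\<alpha> = 0 \<or> prec' 0 \<alpha>" by (auto simp: prec'_def)
  qed
qed

definition subst :: "'a ncpoly \<Rightarrow> 'a ncpoly" where
  "subst = lin_ext (\<lambda>w. word (H w))"

lemma linear_subst: "linear_map subst"
  unfolding subst_def by (rule linear_map_lin_ext)

lemma subst_word [simp]: "subst (word w) = word (H w)"
  by (simp add: subst_def)

lemma subst_mult: "subst (f * g) = subst f * subst g"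
  unfolding subst_def by (rule lin_ext_mult) (simp add: word_mult)

lemma subst_linear: "subst (f + g) = subst f + subst g" "subst (const a * f) = const a * subst f"
  "subst (f - g) = subst f - subst g" "subst 0 = 0"
  by (simp_all add: subst_def lin_ext_add lin_ext_const_mult lin_ext_diff)

lemma subst_one: "subst 1 = 1"
  using subst_word[of "[]"] by (simp add: word_Nil)

lemma subst_const: "subst (const a) = const a"
  using subst_linear(2)[of a 1] by (simp add: subst_one)

lemma subst_upto: "f \<in> supported_on (words m) \<Longrightarrow> subst f \<in> supported_on (words_upto n u 0)"
proof (induction rule: ncpoly_induct)
  case (add a w g)
  then show ?case
    using H_upto[OF add(1)] by (auto simp: subst_linear intro!: supported_on_add supported_on_const_mult)
qed (simp add: subst_linear)

lemma subst_words: "f \<in> supported_on (words m) \<Longrightarrow> subst f \<in> supported_on (words n)"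
  using subst_upto words_upto_subset by blast

text \<open>
  Straightening the image of a preimage of \<open>\<alpha>\<close> produces \<open>x\<^sup>\<alpha>\<close> and smaller terms, which lift by
  induction.
\<close>

lemma lift_std_word:
  assumes "\<alpha> \<in> exps n" "wt n u \<alpha> \<le> 0"
  shows "\<exists>g\<in>supported_on {v \<in> std_words m. \<phi> (wexp v) = \<alpha> \<or> \<phi> (wexp v) \<prec> \<alpha>}.
    word (std_word n \<alpha>) - subst g \<in> pbw_ideal D"
  using assms
proof (induction \<alpha> rule: wf_induct_rule[OF wf_ordering])
  case (1 \<alpha>)
  let ?Y = "\<lambda>\<alpha>. {v \<in> std_words m. \<phi> (wexp v) = \<alpha> \<or> \<phi> (wexp v) \<prec> \<alpha>}"
  note Jf = ideal_facts[OF ideal_pbw]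
  obtain v where v: "v \<in> std_words m" "\<phi> (wexp v) = \<alpha>" using \<phi>_surj "1.prems" .
  have vw: "v \<in> words m" using v std_words_subset by blast
  obtain c r where c: "c \<noteq> 0" "r \<in> supported_on (below u (H v))"
    "word (H v) - (const c * word (sort (H v)) + r) \<in> pbw_ideal D"
    using straighten_residue[OF H_words] .
  have s: "sort (H v) = std_word n \<alpha>" using std_word_wexp[OF H_words] wexp_H[OF vw] v by metis
  have "\<exists>g\<in>supported_on (?Y \<alpha>). r - subst g \<in> pbw_ideal D"
  proof (rule linear_congruence[OF ideal_pbw linear_map_id linear_subst _ c(2)])
    fix z assume "z \<in> below u (H v)"
    then have z: "z \<in> std_words n" "wexp z \<prec> \<alpha>" "word_deg u z \<le> 0"
      using wexp_H[OF vw] v(2) word_deg_H[OF vw] by (auto simp: below_def)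
    have zw: "z \<in> words n" using z std_words_subset by blast
    have wz: "wt n u (wexp z) \<le> 0" "wexp z \<in> exps n"
      using z(3) word_deg_wt[OF zw] wexp_in_exps[OF zw] by auto
    then obtain g where g: "g \<in> supported_on (?Y (wexp z))"
      "word (std_word n (wexp z)) - subst g \<in> pbw_ideal D"
      using "1.IH"[of "wexp z"] "1.prems" z(2) by auto
    have "?Y (wexp z) \<subseteq> ?Y \<alpha>"
      using trans[OF _ z(2)] z(2) \<phi>_exps wz(2) "1.prems"(1) by auto
    then show "\<exists>g\<in>supported_on (?Y \<alpha>). word z - subst g \<in> pbw_ideal D"
      using g(2) supported_on_mono[OF _ g(1)] by (simp add: std_word_wexp_std[OF z(1)]) blast
  qed
  then obtain g where g: "g \<in> supported_on (?Y \<alpha>)" "r - subst g \<in> pbw_ideal D" by blast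
  define f where "f = const (inverse c) * (word v - g)"
  have "f \<in> supported_on (?Y \<alpha>)"
    unfolding f_def using g(1) v by (intro supported_on_const_mult supported_on_diff) auto
  moreover have "word (std_word n \<alpha>) - subst f =
      const (- inverse c) * ((word (H v) - (const c * word (sort (H v)) + r)) + (r - subst g))"
  proof -
    have "const (inverse c) * (const c * word (std_word n \<alpha>)) = word (std_word n \<alpha>)"
      using c(1) by (simp add: mult.assoc[symmetric] flip: const_hom(6))
    then show ?thesis by (simp add: f_def subst_linear s algebra_simps)
  qed
  then have "word (std_word n \<alpha>) - subst f \<in> pbw_ideal D"
    using Jf(7)[OF Jf(3)[OF c(3) g(2)]] by metis
  ultimately show ?case by blast
qed

text \<open>
  Both products of two generators straighten to nonzero multiples of the same standard monomial plus
  smaller terms. Eliminating that monomial leaves smaller terms, which lift to the new variables.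
\<close>

lemma lift_relation:
  assumes ij: "1 \<le> i" "i < j" "j \<le> m"
  shows "\<exists>c d. c \<noteq> 0 \<and> d \<in> supported_on {v \<in> std_words m. \<phi> (wexp v) \<prec> h i + h j} \<and>
    subst (word [j, i] - const c * word [i, j] - d) \<in> pbw_ideal D"
proof -
  note Jf = ideal_facts[OF ideal_pbw]
  let ?Y = "{v \<in> std_words m. \<phi> (wexp v) \<prec> h i + h j}"
  have wm: "[j, i] \<in> words m" "[i, j] \<in> words m" using ij by auto
  have ex: "h i + h j \<in> exps n" using ij h_exps by auto
  have we: "wexp (H [i, j]) = h i + h j" "wexp (H [j, i]) = h i + h j"
    using wexp_H[OF wm(2)] wexp_H[OF wm(1)] ij by (simp_all add: \<phi>_add \<phi>_single[simplified] add.commute)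
  have s: "sort (H [i, j]) = sort (H [j, i])"
    using std_word_wexp[OF H_words] we by metis
  have low: "below u (H w) \<subseteq> {v \<in> std_words n. wexp v \<prec> h i + h j \<and> word_deg u v \<le> 0}"
    if "wexp (H w) = h i + h j" "w \<in> words m" for w
    using that word_deg_H[OF that(2)] by (auto simp: below_def)
  obtain c1 r1 where 1: "c1 \<noteq> 0" "r1 \<in> supported_on (below u (H [j, i]))"
    "word (H [j, i]) - (const c1 * word (sort (H [j, i])) + r1) \<in> pbw_ideal D"
    using straighten_residue[OF H_words] .
  obtain c2 r2 where 2: "c2 \<noteq> 0" "r2 \<in> supported_on (below u (H [i, j]))"
    "word (H [i, j]) - (const c2 * word (sort (H [i, j])) + r2) \<in> pbw_ideal D"
    using straighten_residue[OF H_words] .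
  define c where "c = c1 / c2"
  define r where "r = r1 - const c * r2"
  have r: "r \<in> supported_on {v \<in> std_words n. wexp v \<prec> h i + h j \<and> word_deg u v \<le> 0}"
    unfolding r_def
    by (intro supported_on_diff supported_on_const_mult
        supported_on_mono[OF low[OF we(2) wm(1)] 1(2)] supported_on_mono[OF low[OF we(1) wm(2)] 2(2)])
  have "\<exists>d\<in>supported_on ?Y. r - subst d \<in> pbw_ideal D"
  proof (rule linear_congruence[OF ideal_pbw linear_map_id linear_subst _ r])
    fix z assume "z \<in> {v \<in> std_words n. wexp v \<prec> h i + h j \<and> word_deg u v \<le> 0}"
    then have z: "z \<in> std_words n" "z \<in> words n" "wexp z \<prec> h i + h j" "word_deg u z \<le> 0"
      using std_words_subset by auto
    have wz: "wexp z \<in> exps n" "wt n u (wexp z) \<le> 0"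
      using z(4) word_deg_wt[OF z(2)] wexp_in_exps[OF z(2)] by auto
    obtain g where g: "g \<in> supported_on {v \<in> std_words m. \<phi> (wexp v) = wexp z \<or> \<phi> (wexp v) \<prec> wexp z}"
      "word z - subst g \<in> pbw_ideal D"
      using lift_std_word[OF wz] std_word_wexp_std[OF z(1)] by auto
    have "{v \<in> std_words m. \<phi> (wexp v) = wexp z \<or> \<phi> (wexp v) \<prec> wexp z} \<subseteq> ?Y"
      using z(3) trans[OF _ z(3)] \<phi>_exps wz ex by auto
    then show "\<exists>g\<in>supported_on ?Y. word z - subst g \<in> pbw_ideal D"
      using g supported_on_mono by blast
  qed
  then obtain d where d: "d \<in> supported_on ?Y" "r - subst d \<in> pbw_ideal D" by blast
  have "subst (word [j, i] - const c * word [i, j] - d) =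
     (word (H [j, i]) - (const c1 * word (sort (H [j, i])) + r1))
     + const (- c) * (word (H [i, j]) - (const c2 * word (sort (H [i, j])) + r2)) + (r - subst d)"
  proof -
    have "const c * (const c2 * word (sort (H [j, i]))) = const c1 * word (sort (H [j, i]))"
      using 2(1) by (simp add: c_def mult.assoc[symmetric] flip: const_hom(6))
    then show ?thesis unfolding s subst_linear subst_word r_def
      by (simp add: algebra_simps del: H_simps)
  qed
  then have "subst (word [j, i] - const c * word [i, j] - d) \<in> pbw_ideal D"
    using Jf(3)[OF Jf(3)[OF 1(3) Jf(7)[OF 2(3)]] d(2)] by metis
  moreover have "c \<noteq> 0" using 1(1) 2(1) by (simp add: c_def)
  ultimately show ?thesis using d(1) by blast
qed

end

text \<open>
  A choice of the commutation relations between the new variables. The Groebner basis \<open>G\<close> of the datum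
  remains a parameter, because it is read off from the leading exponents of the kernel, whose study
  already needs the ordering and the relations.
\<close>

locale filt_zero_relations = filt_zero_presentation +
  fixes c :: "nat \<Rightarrow> nat \<Rightarrow> 'a" and d :: "nat \<Rightarrow> nat \<Rightarrow> 'a ncpoly"
  assumes c_nonzero: "1 \<le> i \<Longrightarrow> i < j \<Longrightarrow> j \<le> m \<Longrightarrow> c i j \<noteq> 0"
    and d_lower: "1 \<le> i \<Longrightarrow> i < j \<Longrightarrow> j \<le> m \<Longrightarrow>
      d i j \<in> supported_on {v \<in> std_words m. \<phi> (wexp v) \<prec> h i + h j}"
    and subst_relation: "1 \<le> i \<Longrightarrow> i < j \<Longrightarrow> j \<le> m \<Longrightarrow>
      subst (word [j, i] - const (c i j) * word [i, j] - d i j) \<in> pbw_ideal D"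
begin

definition datum :: "'a ncpoly set \<Rightarrow> 'a pbw_data" where
  "datum G = \<lparr>nv = m, cc = c, dd = d, II = G, prec = prec'\<rparr>"

lemma datum_simps [simp]: "nv (datum G) = m" "cc (datum G) = c" "dd (datum G) = d" "II (datum G) = G"
  "prec (datum G) = prec'"
  by (simp_all add: datum_def)

lemma d_std: "1 \<le> i \<Longrightarrow> i < j \<Longrightarrow> j \<le> m \<Longrightarrow> d i j \<in> supported_on (std_words m)"
  using d_lower supported_on_mono[of "{v \<in> std_words m. \<phi> (wexp v) \<prec> h i + h j}" "std_words m"] by auto

lemma d_prec':
  assumes "1 \<le> i" "i < j" "j \<le> m" "w \<in> Poly_Mapping.keys (d i j)"
  shows "prec' (wexp w) (Poly_Mapping.single i 1 + Poly_Mapping.single j 1)"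
  using d_lower[OF assms(1-3)] assms
  by (auto simp: prec'_def \<phi>_add \<phi>_single[simplified] supported_on_def)

lemma commutation_relations_datum: "commutation_relations (datum G)"
  by unfold_locales (use well_monomial_ordering' c_nonzero d_std d_prec' in \<open>simp_all add: well_monomial_ordering_def\<close>)

abbreviation F0 :: "'a ncpoly set ring" where
  "F0 \<equiv> (pbw_alg D)\<lparr>carrier := filt D u 0\<rparr>"

lemma ring_F0: "ring F0"
  using ring.subring_is_ring[OF ring_pbw_alg subring_filt] .

lemma hom_F0: "ring_hom_ring (free_alg m) F0 (residue D \<circ> subst)"
proof (rule ring_hom_ringI[OF ring_free_alg ring_F0])
  fix f :: "'a ncpoly" assume "f \<in> carrier (free_alg m)"
  then show "(residue D \<circ> subst) f \<in> carrier F0"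
    by (simp add: carrier_free_alg filt_alt subst_upto)
next
  fix f g :: "'a ncpoly" assume "f \<in> carrier (free_alg m)" "g \<in> carrier (free_alg m)"
  then have fg: "subst f \<in> supported_on (words n)" "subst g \<in> supported_on (words n)"
    using subst_words by (simp_all add: carrier_free_alg)
  show "(residue D \<circ> subst) (f \<otimes>\<^bsub>free_alg m\<^esub> g) = (residue D \<circ> subst) f \<otimes>\<^bsub>F0\<^esub> (residue D \<circ> subst) g"
    using residue_mult[OF fg] by (simp add: subst_mult)
  show "(residue D \<circ> subst) (f \<oplus>\<^bsub>free_alg m\<^esub> g) = (residue D \<circ> subst) f \<oplus>\<^bsub>F0\<^esub> (residue D \<circ> subst) g"
    using residue_add[OF fg] by (simp add: subst_linear)
qed (simp add: subst_one residue_one)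

definition kernel :: "'a ncpoly set" where
  "kernel = {f \<in> supported_on (words m). subst f \<in> pbw_ideal D}"

lemma kernel_alt: "kernel = a_kernel (free_alg m) F0 (residue D \<circ> subst)"
  unfolding a_kernel_def' kernel_def
  using residue_eq_zero_iff[OF subst_words] by (auto simp: carrier_free_alg)

lemma ideal_kernel: "ideal kernel (free_alg m)"
  unfolding kernel_alt using ring_hom_ring.kernel_is_ideal[OF hom_F0] .

lemma image_subst: "(residue D \<circ> subst) ` carrier (free_alg m) = filt D u 0"
proof
  show "(residue D \<circ> subst) ` carrier (free_alg m) \<subseteq> filt D u 0"
    by (auto simp: carrier_free_alg filt_alt subst_upto)
  show "filt D u 0 \<subseteq> (residue D \<circ> subst) ` carrier (free_alg m)"
  proof
    fix x assume "x \<in> filt D u 0"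
    then obtain f where f: "x = residue D f" "f \<in> supported_on (words_upto n u 0)"
      by (auto simp: filt_alt)
    obtain g where g: "g \<in> supported_on (std_words n \<inter> words_upto n u 0)" "f - g \<in> pbw_ideal D"
      using standard_representative[OF f(2)] by blast
    have "\<exists>p\<in>supported_on (words m). g - subst p \<in> pbw_ideal D"
    proof (rule linear_congruence[OF ideal_pbw linear_map_id linear_subst _ g(1)])
      fix z assume "z \<in> std_words n \<inter> words_upto n u 0"
      then have z: "z \<in> std_words n" "z \<in> words n" "word_deg u z \<le> 0" by (auto simp: words_upto_def)
      have wz: "wexp z \<in> exps n" "wt n u (wexp z) \<le> 0"
        using z(3) word_deg_wt[OF z(2)] wexp_in_exps[OF z(2)] by auto
      obtain p where p: "p \<in> supported_on {v \<in> std_words m. \<phi> (wexp v) = wexp z \<or> \<phi> (wexp v) \<prec> wexp z}"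
        "word z - subst p \<in> pbw_ideal D"
        using lift_std_word[OF wz] std_word_wexp_std[OF z(1)] by auto
      have "p \<in> supported_on (words m)"
        by (rule supported_on_mono[OF _ p(1)]) (use std_words_subset in auto)
      then show "\<exists>p\<in>supported_on (words m). word z - subst p \<in> pbw_ideal D" using p(2) by blast
    qed
    then obtain p where p: "p \<in> supported_on (words m)" "g - subst p \<in> pbw_ideal D" by blast
    have "f - subst p \<in> pbw_ideal D"
      using ideal_facts(3)[OF ideal_pbw g(2) p(2)] by simp
    then have "x = residue D (subst p)"
      using f residue_eq_iff[OF subsetD[OF words_upto_subset f(2)] subst_words[OF p(1)]] by simp
    then show "x \<in> (residue D \<circ> subst) ` carrier (free_alg m)" using p(1) by (auto simp: carrier_free_alg)
  qed
qed

text \<open>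
  The basis \<open>G\<close> consists of elements of the kernel whose leading exponents are the finitely many
  generators of all leading exponents of the kernel.
\<close>

theorem presentation_exists: "\<exists>G. pbw_datum (datum G) \<and> iso_to_pbw_alg D (filt D u 0) (datum G)"
proof -
  let ?std = "std_space m :: 'a ncpoly set"
  define L where "L = l_set m prec' (kernel \<inter> ?std)"
  interpret B0: commutation_relations "datum {}" by (rule commutation_relations_datum)
  have rels: "comm_rels (datum G) \<subseteq> kernel" for G
  proof
    fix f assume "f \<in> comm_rels (datum G)"
    then obtain i j where ij: "1 \<le> i" "i < j" "j \<le> m"
      and f: "f = word [j, i] - const (c i j) * word [i, j] - d i j"
      unfolding comm_rels_def by auto
    have "f \<in> supported_on (words m)"
      unfolding f using ij supported_on_mono[OF std_words_subset d_std[OF ij]]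
      by (intro supported_on_diff supported_on_const_mult) auto
    then show "f \<in> kernel" using subst_relation[OF ij] f by (simp add: kernel_def)
  qed
  have L_exps: "L \<subseteq> exps m"
  proof
    fix \<alpha> assume "\<alpha> \<in> L"
    then obtain g where g: "g \<in> std_space m" "g \<noteq> 0" "\<alpha> = le_exp m prec' g" "g \<in> kernel"
      unfolding L_def l_set_def by auto
    obtain w where w: "w \<in> Poly_Mapping.keys g" "\<alpha> = wexp w"
      using B0.leading_word[unfolded datum_simps, OF g(1,2)] g(3) by metis
    then have "w \<in> words m" using g(1) std_words_subset by (auto simp: std_space_alt supported_on_def)
    then show "\<alpha> \<in> exps m" using w wexp_in_exps by simp
  qed
  have L_add: "\<alpha> + \<gamma> \<in> L" if "\<alpha> \<in> L" "\<gamma> \<in> exps m" for \<alpha> \<gamma>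
    using B0.l_set_add_closed[unfolded datum_simps, OF ideal_kernel rels] that by (simp add: L_def)
  obtain E where E: "finite E" "E \<subseteq> L" "L = {\<alpha> + \<gamma> | \<alpha> \<gamma>. \<alpha> \<in> E \<and> \<gamma> \<in> exps m}"
    using dickson_finite_generators[OF L_exps L_add] .
  have "\<forall>\<alpha>\<in>E. \<exists>g. g \<in> kernel \<inter> ?std \<and> g \<noteq> 0 \<and> le_exp m prec' g = \<alpha>"
    using E(2) unfolding L_def l_set_def by blast
  then obtain p where p: "\<And>\<alpha>. \<alpha> \<in> E \<Longrightarrow> p \<alpha> \<in> kernel \<inter> ?std \<and> p \<alpha> \<noteq> 0 \<and> le_exp m prec' (p \<alpha>) = \<alpha>"
    by metis
  define G where "G = p ` E"
  have G: "finite G" "G \<subseteq> kernel" "G \<subseteq> ?std" using E(1) p by (auto simp: G_def)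
  have lG: "l_set m prec' G = E" using p by (force simp: l_set_def G_def)
  interpret B: commutation_relations "datum G" by (rule commutation_relations_datum)
  interpret B: pbw_relations "datum G"
    by unfold_locales (use G(3) in \<open>simp add: std_space_alt\<close>)
  note B_ideal = B.ideal_pbw[unfolded datum_simps]
  have sub: "pbw_ideal (datum G) \<subseteq> kernel"
    unfolding pbw_ideal_def datum_simps
    using G(2) rels by (intro ring.genideal_minimal[OF ring_free_alg ideal_kernel]) auto
  have GB: "G \<subseteq> pbw_ideal (datum G)" using B.generators_in_ideal by simp
  have l_sub: "L \<subseteq> l_set m prec' (pbw_ideal (datum G) \<inter> ?std)"
  proof
    fix \<delta> assume "\<delta> \<in> L"
    then obtain \<alpha> \<gamma> where ag: "\<delta> = \<alpha> + \<gamma>" "\<alpha> \<in> E" "\<gamma> \<in> exps m" using E(3) by blast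
    have "\<alpha> \<in> l_set m prec' (pbw_ideal (datum G) \<inter> ?std)"
      using ag(2) p[OF ag(2)] GB unfolding l_set_def G_def by (intro CollectI exI[of _ "p \<alpha>"]) auto
    then show "\<delta> \<in> l_set m prec' (pbw_ideal (datum G) \<inter> ?std)"
      using B.l_set_add_closed[unfolded datum_simps, OF B_ideal B.comm_rels_in_ideal _ ag(3)] ag(1) by simp
  qed
  have kernel_eq: "kernel = pbw_ideal (datum G)"
    using B.ideal_determined_by_l_set[unfolded datum_simps, OF ideal_kernel B_ideal B.comm_rels_in_ideal sub]
      l_sub sub by (simp add: L_def)
  have "commutation_system (datum G)"
    unfolding commutation_system_def datum_simps
  proof (intro conjI allI impI ballI)
    show "monomial_ordering m prec'" using well_monomial_ordering' by (simp add: well_monomial_ordering_def)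
    fix i j assume "1 \<le> i \<and> i < j \<and> j \<le> m"
    then have ij: "1 \<le> i" "i < j" "j \<le> m" by auto
    show "c i j \<noteq> 0" using c_nonzero ij .
    show ds: "d i j \<in> std_space m" using d_std[OF ij] by (simp add: std_space_alt)
    show "d i j = 0 \<or> prec' (le_exp m prec' (d i j)) (Poly_Mapping.single i 1 + Poly_Mapping.single j 1)"
    proof (cases "d i j = 0")
      case False
      then obtain w where "w \<in> Poly_Mapping.keys (d i j)" "le_exp m prec' (d i j) = wexp w"
        using B.leading_word[unfolded datum_simps, OF ds] by metis
      then show ?thesis using d_prec'[OF ij] by simp
    qed simp
  next
    fix f assume "f \<in> carrier (free_alg m :: 'a ncpoly ring)"
    then show "\<exists>g\<in>std_space m. (reduces (datum G))\<^sup>*\<^sup>* f g"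
      using B.reduces_to_standard by (simp add: carrier_free_alg)
  qed
  moreover have "well_ordering m prec'" using well_monomial_ordering' by (simp add: well_monomial_ordering_def)
  moreover have "L_set m prec' G = l_set m prec' (pbw_ideal (datum G) \<inter> ?std)"
    using E(3) unfolding L_set_def lG by (simp add: L_def kernel_eq)
  ultimately have datum: "pbw_datum (datum G)"
    unfolding pbw_datum_def datum_simps using G by blast
  \<comment> \<open>The homomorphism theorem gives an isomorphism onto \<open>F\<^sub>0 A\<close>, whose inverse is the one required.\<close>
  define \<theta> where "\<theta> X = the_elem ((residue D \<circ> subst) ` X)" for X
  interpret hom: ring_hom_ring "free_alg m" F0 "residue D \<circ> subst" by (rule hom_F0)
  have alg: "free_alg m Quot a_kernel (free_alg m) F0 (residue D \<circ> subst) = pbw_alg (datum G)"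
    unfolding kernel_alt[symmetric] kernel_eq by (simp add: pbw_alg_def)
  have iso: "\<theta> \<in> ring_iso (pbw_alg (datum G)) F0"
    using hom.FactRing_iso_set image_subst unfolding \<theta>_def alg by simp
  have \<theta>_const: "\<theta> (residue (datum G) (const a)) = residue D (const a)" for a
    using hom.the_elem_simp[OF const_in_carrier, of a]
    unfolding \<theta>_def residue_def[of "datum G"] datum_simps kernel_alt[symmetric] kernel_eq
    by (simp add: subst_const)
  have "inv_into (carrier (pbw_alg (datum G))) \<theta> \<in> ring_iso F0 (pbw_alg (datum G))"
    by (rule ring_iso_set_sym[OF B.ring_pbw_alg iso])
  moreover have "inv_into (carrier (pbw_alg (datum G))) \<theta> (residue D (const a)) = residue (datum G) (const a)" for a
  proof -
    have "inj_on \<theta> (carrier (pbw_alg (datum G)))" using iso by (auto simp: ring_iso_def bij_betw_def)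
    moreover have "residue (datum G) (const a) \<in> carrier (pbw_alg (datum G))"
      by (rule B.residue_carrier) (use const_in_carrier[of a m] in \<open>simp add: carrier_free_alg\<close>)
    ultimately show ?thesis using \<theta>_const inv_into_f_f by metis
  qed
  ultimately have "iso_to_pbw_alg D (filt D u 0) (datum G)"
    unfolding iso_to_pbw_alg_def by blast
  with datum show ?thesis by blast
qed

end

lemma finite_box: "finite (box n u j)"
proof -
  define N where "N = nat (coord_bound n u j)"
  let ?F = "{f. (\<forall>i. (i \<in> {1..n} \<longrightarrow> f i \<in> {0..N}) \<and> (i \<notin> {1..n} \<longrightarrow> f i = (0::nat)))}"
  have "Poly_Mapping.lookup ` box n u j \<subseteq> ?F"
  proof (intro subsetI CollectI allI conjI impI, elim imageE)
    fix f \<alpha> i assume "\<alpha> \<in> box n u j" "f = Poly_Mapping.lookup \<alpha>" "i \<in> {1..n}"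
    then have "int (f i) \<le> coord_bound n u j" by (simp add: box_def)
    then show "f i \<in> {0..N}" by (simp add: N_def le_nat_iff)
  next
    fix f i assume "f \<in> Poly_Mapping.lookup ` box n u j" "i \<notin> {1..n}"
    then show "f i = 0" by (auto simp: box_def exps_def in_keys_iff simp del: atLeastAtMost_iff)
  qed
  moreover have "finite ?F" by (rule finite_set_of_finite_funs) auto
  ultimately have "finite (Poly_Mapping.lookup ` box n u j)" by (rule finite_subset)
  moreover have "inj_on Poly_Mapping.lookup (box n u j)" by (intro inj_onI poly_mapping_eqI) simp
  ultimately show ?thesis by (rule finite_imageD)
qed

text \<open>
  Splitting repeatedly decreases the total degree of the parts, because both are nonzero.
\<close>

lemma box_generates:
  assumes "\<alpha> \<in> exps n" "wt n u \<alpha> \<le> 0"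
  shows "\<exists>vs. set vs \<subseteq> box n u 0 \<and> sum_list vs = \<alpha>"
  using assms
proof (induction "\<Sum>i\<in>{1..n}. Poly_Mapping.lookup \<alpha> i" arbitrary: \<alpha> rule: less_induct)
  case less
  show ?case
  proof (cases "\<alpha> \<in> box n u 0")
    case True
    then show ?thesis by (intro exI[of _ "[\<alpha>]"]) simp
  next
    case False
    then obtain \<beta> \<gamma> where bg: "\<alpha> = \<gamma> + \<beta>" "\<gamma> \<noteq> 0" "\<beta> \<noteq> 0" "\<gamma> \<in> exps n" "\<beta> \<in> exps n"
      "wt n u \<gamma> \<le> 0" "wt n u \<beta> \<le> 0"
      using box_induct_split[OF less.prems] by blast
    have pos: "(\<Sum>i\<in>{1..n}. Poly_Mapping.lookup \<delta> i) > 0" if "\<delta> \<in> exps n" "\<delta> \<noteq> 0" for \<delta>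
    proof -
      obtain k where "k \<in> Poly_Mapping.keys \<delta>" using \<open>\<delta> \<noteq> 0\<close> by (metis all_not_in_conv keys_eq_empty)
      then have "k \<in> {1..n}" "Poly_Mapping.lookup \<delta> k > 0"
        using that(1) by (auto simp: exps_def in_keys_iff simp del: atLeastAtMost_iff)
      then show ?thesis by (meson finite_atLeastAtMost sum_pos2 zero_le)
    qed
    have "(\<Sum>i\<in>{1..n}. Poly_Mapping.lookup \<alpha> i) =
        (\<Sum>i\<in>{1..n}. Poly_Mapping.lookup \<gamma> i) + (\<Sum>i\<in>{1..n}. Poly_Mapping.lookup \<beta> i)"
      by (simp add: bg(1) lookup_add sum.distrib)
    then obtain vs vs' where "set vs \<subseteq> box n u 0" "sum_list vs = \<gamma>" "set vs' \<subseteq> box n u 0" "sum_list vs' = \<beta>"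
      using less.hyps[OF _ bg(4,6)] less.hyps[OF _ bg(5,7)] pos[OF bg(4,2)] pos[OF bg(5,3)] by fastforce
    then show ?thesis using bg(1) by (intro exI[of _ "vs @ vs'"]) simp
  qed
qed

theorem filt_zero_iso_pbw_alg:
  fixes A :: "'k::field pbw_data"
  assumes "pbw_datum A" "weight_vector A u"
  shows "\<exists>B :: 'k pbw_data. pbw_datum B \<and> iso_to_pbw_alg A (filt A u 0) B"
proof -
  interpret weighted_relations A u by (rule pbw_datum_weighted[OF assms])
  obtain hs where hs: "set hs = box n u 0" using finite_list[OF finite_box] by blast
  interpret filt_zero_presentation A u hs
  proof unfold_locales
    show "\<alpha> \<in> exps n" "wt n u \<alpha> \<le> 0" if "\<alpha> \<in> set hs" for \<alpha> using that by (simp_all add: hs box_def)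
    show "\<exists>vs. set vs \<subseteq> set hs \<and> sum_list vs = \<alpha>" if "\<alpha> \<in> exps n" "wt n u \<alpha> \<le> 0" for \<alpha>
      using box_generates[OF that] by (simp add: hs)
  qed
  let ?rel = "\<lambda>i j c d. c \<noteq> 0 \<and> d \<in> supported_on {v \<in> std_words m. prec A (\<phi> (wexp v)) (h i + h j)} \<and>
      subst (word [j, i] - const c * word [i, j] - d) \<in> pbw_ideal A"
  have ex: "\<exists>p. 1 \<le> i \<and> i < j \<and> j \<le> m \<longrightarrow> ?rel i j (fst p) (snd p)" for i j
    using lift_relation[of i j] by (cases "1 \<le> i \<and> i < j \<and> j \<le> m") auto
  define p where "p i j = (SOME p. 1 \<le> i \<and> i < j \<and> j \<le> m \<longrightarrow> ?rel i j (fst p) (snd p))" for i j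
  have p: "1 \<le> i \<Longrightarrow> i < j \<Longrightarrow> j \<le> m \<Longrightarrow> ?rel i j (fst (p i j)) (snd (p i j))" for i j
    using someI_ex[OF ex[of i j]] unfolding p_def by blast
  interpret filt_zero_relations A u hs "\<lambda>i j. fst (p i j)" "\<lambda>i j. snd (p i j)"
    by unfold_locales (use p in simp_all)
  show ?thesis using presentation_exists by blast
qed


section \<open>Total correctness of WHILE programs\<close>

text \<open>
  Existence of a terminating run suffices for \<open>computes\<close>, so a weakest precondition for total
  correctness is used.
\<close>

definition wp :: "('k::field val \<Rightarrow> 'k val \<Rightarrow> bool) \<Rightarrow> wcom \<Rightarrow> ((nat \<Rightarrow> 'k val) \<Rightarrow> bool) \<Rightarrow> (nat \<Rightarrow> 'k val) \<Rightarrow> bool" where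
  "wp P p Q s \<longleftrightarrow> (\<exists>s'. exec P p s s' \<and> Q s')"

lemma wp_Assign: "Q (s(x := wexp_val P s e)) \<Longrightarrow> wp P (Assign x e) Q s"
  unfolding wp_def using exec.Assign by blast

lemma wp_Seq: "wp P p (wp P q Q) s \<Longrightarrow> wp P (Seq p q) Q s"
  unfolding wp_def using exec.Seq by blast

lemma wp_mono: "wp P p Q s \<Longrightarrow> (\<And>s'. Q s' \<Longrightarrow> R s') \<Longrightarrow> wp P p R s"
  unfolding wp_def by blast

text \<open>
  The index of the invariant counts the remaining iterations, which makes termination part of it.
\<close>

lemma wp_While_nat:
  assumes "Inv k s"
    and "\<And>s. Inv 0 s \<Longrightarrow> wexp_val P s e = VInt 0 \<and> Q s"
    and "\<And>k s. Inv (Suc k) s \<Longrightarrow> wexp_val P s e \<noteq> VInt 0 \<and> wp P p (Inv k) s"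
  shows "wp P (While e p) Q s"
  using assms(1)
proof (induction k arbitrary: s)
  case 0
  then show ?case using assms(2) exec.WhileF unfolding wp_def by blast
next
  case (Suc k)
  then obtain s' where "exec P p s s'" "Inv k s'" "wexp_val P s e \<noteq> VInt 0"
    using assms(3) unfolding wp_def by blast
  moreover from this Suc.IH obtain s'' where "exec P (While e p) s' s''" "Q s''" unfolding wp_def by blast
  ultimately show ?case unfolding wp_def using exec.WhileT by blast
qed

lemma wp_While_list:
  assumes "Inv xs s"
    and "\<And>s. Inv [] s \<Longrightarrow> wexp_val P s e = VInt 0 \<and> Q s"
    and "\<And>x xs s. Inv (x # xs) s \<Longrightarrow> wexp_val P s e \<noteq> VInt 0 \<and> wp P p (Inv xs) s"
  shows "wp P (While e p) Q s"
proof (rule wp_While_nat[where Inv = "\<lambda>k s. \<exists>xs. length xs = k \<and> Inv xs s" and k = "length xs"])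
  fix k s assume "\<exists>xs. length xs = Suc k \<and> Inv xs s"
  then obtain x xs where "length xs = k" "Inv (x # xs) s" by (metis length_Suc_conv)
  then show "wexp_val P s e \<noteq> VInt 0 \<and> wp P p (\<lambda>s. \<exists>xs. length xs = k \<and> Inv xs s) s"
    using assms(3) by (metis (mono_tags, lifting) wp_mono)
qed (use assms(1,2) in auto)

text \<open>Loops run as long as their test differs from \<open>0\<close>, so the comparison with the empty list is negated.\<close>

definition nonnil :: "nat \<Rightarrow> wexp" where
  "nonnil x = Minus (IntC 1) (Eq (Var x) NilC)"

lemma nonnil_val: "wexp_val P s (nonnil x) = VInt 0 \<longleftrightarrow> s x = VNil"
  by (simp add: nonnil_def vbool_def)

section \<open>Enumerating the exponents of a box\<close>

abbreviation vints :: "int list \<Rightarrow> 'k val" where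
  "vints xs \<equiv> vlist (map VInt xs)"

text \<open>
  Exponent vectors are built from the last coordinate to the first, because coordinates are
  prepended to lists. Each partial vector is stored together with its weight, so that the final
  selection is a single comparison.
\<close>

definition vstates :: "(int list \<times> int) list \<Rightarrow> 'k val" where
  "vstates L = vlist (map (\<lambda>(xs, d). VPair (vints xs) (VInt d)) L)"

lemma vstates_simps [simp]: "vstates [] = VNil" "vstates ((xs, d) # L) = VPair (VPair (vints xs) (VInt d)) (vstates L)"
  by (simp_all add: vstates_def)

text \<open>
  The following functions describe what the loops of the program compute, including the order of their
  results; the accumulators \<open>M\<close> and \<open>out\<close> are program variables.
\<close>

definition children :: "int \<Rightarrow> int \<Rightarrow> int list \<times> int \<Rightarrow> (int list \<times> int) list \<Rightarrow> (int list \<times> int) list" where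
  "children B a p M = map (\<lambda>t. (t # fst p, snd p + t * a)) [0..B] @ M"

definition extend :: "int \<Rightarrow> int \<Rightarrow> (int list \<times> int) list \<Rightarrow> (int list \<times> int) list" where
  "extend B a L = fold (children B a) L []"

definition select :: "int \<Rightarrow> int list \<times> int \<Rightarrow> int list list \<Rightarrow> int list list" where
  "select j p out = (if snd p \<le> j then fst p # out else out)"

definition enumerate_box :: "int \<Rightarrow> int \<Rightarrow> int list \<Rightarrow> int list list" where
  "enumerate_box B j us = fold (select j) (fold (extend B) (rev us) [([], 0)]) []"

text \<open>
  Variables: 1 and 2 hold the remaining weights in order and reversed, 3 holds \<open>j\<close>, 4 the bound for coordinates,
  5 the current list of partial vectors, 6 the next such list, 7 the coordinate to be prepended and
  8 the outcome of a test.
\<close>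

definition scan_prog :: wcom where
  "scan_prog = While (nonnil 1)
    (Seq (Assign 4 (Plus (Var 4) (Times (Head (Var 1)) (Head (Var 1)))))
    (Seq (Assign 2 (Pair (Head (Var 1)) (Var 2)))
    (Assign 1 (Tail (Var 1)))))"

definition children_prog :: wcom where
  "children_prog = While (Leq (IntC 0) (Var 7))
    (Seq (Assign 6 (Pair (Pair (Pair (Var 7) (Head (Head (Var 5))))
        (Plus (Tail (Head (Var 5))) (Times (Var 7) (Head (Var 2))))) (Var 6)))
    (Assign 7 (Minus (Var 7) (IntC 1))))"

definition extend_prog :: wcom where
  "extend_prog = While (nonnil 5)
    (Seq (Assign 7 (Var 4)) (Seq children_prog (Assign 5 (Tail (Var 5)))))"

definition build_prog :: wcom where
  "build_prog = While (nonnil 2)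
    (Seq (Assign 6 NilC) (Seq extend_prog (Seq (Assign 5 (Var 6)) (Assign 2 (Tail (Var 2))))))"

text \<open>
  The language has no conditional; the inner loop resets its own test and thus runs at most once.
\<close>

definition select_prog :: wcom where
  "select_prog = While (nonnil 5)
    (Seq (Assign 8 (Leq (Tail (Head (Var 5))) (Var 3)))
    (Seq (While (Var 8) (Seq (Assign 0 (Pair (Head (Head (Var 5))) (Var 0))) (Assign 8 (IntC 0))))
    (Assign 5 (Tail (Var 5)))))"

definition box_prog :: "wexp \<Rightarrow> wcom" where
  "box_prog e = Seq (Assign 3 e) (Seq (Assign 1 (Head (Tail (Var 0)))) (Seq (Assign 0 NilC)
    (Seq (Assign 2 NilC) (Seq (Assign 4 (Plus (Times (Var 3) (Var 3)) (IntC 1)))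
    (Seq scan_prog (Seq (Assign 5 (Pair (Pair NilC (IntC 0)) NilC))
    (Seq build_prog select_prog)))))))"

lemma scan_prog_wp:
  assumes "s 1 = vints us" "s 2 = VNil" "s 4 = VInt B"
  shows "wp P scan_prog (\<lambda>s'. s' 2 = vints (rev us) \<and> s' 4 = VInt (B + (\<Sum>a\<leftarrow>us. a * a)) \<and>
    (\<forall>x. x \<notin> {1, 2, 4} \<longrightarrow> s' x = s x)) s"
  unfolding scan_prog_def
proof (rule wp_While_list[where xs = us and Inv = "\<lambda>xs s'. s' 1 = vints xs \<and>
    (\<exists>r C. s' 2 = vints r \<and> rev xs @ r = rev us \<and> s' 4 = VInt C \<and>
      C + (\<Sum>a\<leftarrow>xs. a * a) = B + (\<Sum>a\<leftarrow>us. a * a)) \<and> (\<forall>x. x \<notin> {1, 2, 4} \<longrightarrow> s' x = s x)"])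
  fix x xs s'
  assume a: "s' 1 = vints (x # xs) \<and>
    (\<exists>r C. s' 2 = vints r \<and> rev (x # xs) @ r = rev us \<and> s' 4 = VInt C \<and>
      C + (\<Sum>a\<leftarrow>x # xs. a * a) = B + (\<Sum>a\<leftarrow>us. a * a)) \<and> (\<forall>x. x \<notin> {1, 2, 4} \<longrightarrow> s' x = s x)"
  then obtain r C where rC: "s' 2 = vints r" "rev (x # xs) @ r = rev us" "s' 4 = VInt C"
      "C + (\<Sum>a\<leftarrow>x # xs. a * a) = B + (\<Sum>a\<leftarrow>us. a * a)" by blast
  show "wexp_val P s' (nonnil 1) \<noteq> VInt 0 \<and> wp P (Seq (Assign 4 (Plus (Var 4) (Times (Head (Var 1)) (Head (Var 1)))))
    (Seq (Assign 2 (Pair (Head (Var 1)) (Var 2)))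
    (Assign 1 (Tail (Var 1))))) (\<lambda>s'. s' 1 = vints xs \<and>
    (\<exists>r C. s' 2 = vints r \<and> rev xs @ r = rev us \<and> s' 4 = VInt C \<and>
      C + (\<Sum>a\<leftarrow>xs. a * a) = B + (\<Sum>a\<leftarrow>us. a * a)) \<and> (\<forall>x. x \<notin> {1, 2, 4} \<longrightarrow> s' x = s x)) s'"
    using a rC by (auto simp: nonnil_val intro!: wp_Seq wp_Assign exI[of _ "x # r"])
qed (use assms in \<open>auto simp: nonnil_val\<close>)

lemma children_prog_wp:
  assumes "s 5 = VPair (VPair (vints xs) (VInt d)) v" "s 2 = VPair (VInt a) w" "s 6 = vstates M"
    and "s 7 = VInt B" "B \<ge> 0"
  shows "wp P children_prog (\<lambda>s'. s' 6 = vstates (children B a (xs, d) M) \<and>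
    (\<forall>x. x \<notin> {6, 7} \<longrightarrow> s' x = s x)) s"
  unfolding children_prog_def
proof (rule wp_While_nat[where k = "nat (B + 1)" and Inv = "\<lambda>k s'. s' 7 = VInt (int k - 1) \<and> int k \<le> B + 1 \<and>
    s' 6 = vstates (map (\<lambda>t. (t # xs, d + t * a)) [int k..B] @ M) \<and> (\<forall>x. x \<notin> {6, 7} \<longrightarrow> s' x = s x)"])
  fix k s'
  assume a: "s' 7 = VInt (int (Suc k) - 1) \<and> int (Suc k) \<le> B + 1 \<and>
    s' 6 = vstates (map (\<lambda>t. (t # xs, d + t * a)) [int (Suc k)..B] @ M) \<and> (\<forall>x. x \<notin> {6, 7} \<longrightarrow> s' x = s x)"
  then have "s' 5 = VPair (VPair (vints xs) (VInt d)) v" "s' 2 = VPair (VInt a) w" using assms by auto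
  moreover have "[int k..B] = int k # [int k + 1..B]" using a by (intro upto_rec1) simp
  ultimately show "wexp_val P s' (Leq (IntC 0) (Var 7)) \<noteq> VInt 0 \<and>
    wp P (Seq (Assign 6 (Pair (Pair (Pair (Var 7) (Head (Head (Var 5))))
        (Plus (Tail (Head (Var 5))) (Times (Var 7) (Head (Var 2))))) (Var 6)))
    (Assign 7 (Minus (Var 7) (IntC 1)))) (\<lambda>s'. s' 7 = VInt (int k - 1) \<and> int k \<le> B + 1 \<and>
    s' 6 = vstates (map (\<lambda>t. (t # xs, d + t * a)) [int k..B] @ M) \<and> (\<forall>x. x \<notin> {6, 7} \<longrightarrow> s' x = s x)) s'"
    using a by (auto simp: vbool_def add.commute intro!: wp_Seq wp_Assign)
qed (use assms in \<open>auto simp: vbool_def children_def\<close>)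

lemma extend_prog_wp:
  assumes "s 5 = vstates L" "s 6 = VNil" "s 2 = VPair (VInt a) w" "s 4 = VInt B" "B \<ge> 0"
  shows "wp P extend_prog (\<lambda>s'. s' 6 = vstates (extend B a L) \<and>
    (\<forall>x. x \<notin> {5, 6, 7} \<longrightarrow> s' x = s x)) s"
  unfolding extend_prog_def
proof (rule wp_While_list[where xs = L and Inv = "\<lambda>R s'. s' 5 = vstates R \<and>
    (\<exists>M. s' 6 = vstates M \<and> fold (children B a) R M = extend B a L) \<and>
    (\<forall>x. x \<notin> {5, 6, 7} \<longrightarrow> s' x = s x)"])
  fix p R s'
  assume inv: "s' 5 = vstates (p # R) \<and>
    (\<exists>M. s' 6 = vstates M \<and> fold (children B a) (p # R) M = extend B a L) \<and>
    (\<forall>x. x \<notin> {5, 6, 7} \<longrightarrow> s' x = s x)"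
  obtain xs d where p: "p = (xs, d)" by fastforce
  obtain M where M: "s' 6 = vstates M" "fold (children B a) R (children B a p M) = extend B a L"
    using inv by auto
  have "wp P children_prog (wp P (Assign 5 (Tail (Var 5))) (\<lambda>s'. s' 5 = vstates R \<and>
    (\<exists>M. s' 6 = vstates M \<and> fold (children B a) R M = extend B a L) \<and>
    (\<forall>x. x \<notin> {5, 6, 7} \<longrightarrow> s' x = s x))) (s'(7 := VInt B))"
    by (rule wp_mono[OF children_prog_wp[where xs = xs and d = d and a = a and M = M and B = B]])
       (use inv assms M p in \<open>auto intro!: wp_Assign\<close>)
  then show "wexp_val P s' (nonnil 5) \<noteq> VInt 0 \<and>
    wp P (Seq (Assign 7 (Var 4)) (Seq children_prog (Assign 5 (Tail (Var 5))))) (\<lambda>s'. s' 5 = vstates R \<and>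
    (\<exists>M. s' 6 = vstates M \<and> fold (children B a) R M = extend B a L) \<and>
    (\<forall>x. x \<notin> {5, 6, 7} \<longrightarrow> s' x = s x)) s'"
    using inv assms(4) p by (auto simp: nonnil_val intro!: wp_Seq wp_Assign)
qed (use assms in \<open>auto simp: nonnil_val extend_def intro: exI[of _ "[]"]\<close>)

lemma build_prog_wp:
  assumes "s 2 = vints us" "s 5 = vstates L" "s 4 = VInt B" "B \<ge> 0"
  shows "wp P build_prog (\<lambda>s'. s' 5 = vstates (fold (extend B) us L) \<and>
    (\<forall>x. x \<notin> {2, 5, 6, 7} \<longrightarrow> s' x = s x)) s"
  unfolding build_prog_def
proof (rule wp_While_list[where xs = us and Inv = "\<lambda>as s'. s' 2 = vints as \<and>
    (\<exists>M. s' 5 = vstates M \<and> fold (extend B) as M = fold (extend B) us L) \<and>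
    (\<forall>x. x \<notin> {2, 5, 6, 7} \<longrightarrow> s' x = s x)"])
  fix a as s'
  assume inv: "s' 2 = vints (a # as) \<and>
    (\<exists>M. s' 5 = vstates M \<and> fold (extend B) (a # as) M = fold (extend B) us L) \<and>
    (\<forall>x. x \<notin> {2, 5, 6, 7} \<longrightarrow> s' x = s x)"
  then obtain M where M: "s' 5 = vstates M" "fold (extend B) as (extend B a M) = fold (extend B) us L" by auto
  let ?Q = "\<lambda>s'. s' 2 = vints as \<and>
    (\<exists>M. s' 5 = vstates M \<and> fold (extend B) as M = fold (extend B) us L) \<and>
    (\<forall>x. x \<notin> {2, 5, 6, 7} \<longrightarrow> s' x = s x)"
  have "wp P extend_prog (wp P (Seq (Assign 5 (Var 6)) (Assign 2 (Tail (Var 2)))) ?Q) (s'(6 := VNil))"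
    by (rule wp_mono[OF extend_prog_wp[where a = a and L = M and B = B]])
       (use inv assms M in \<open>auto intro!: wp_Seq wp_Assign\<close>)
  then show "wexp_val P s' (nonnil 2) \<noteq> VInt 0 \<and>
    wp P (Seq (Assign 6 NilC) (Seq extend_prog (Seq (Assign 5 (Var 6)) (Assign 2 (Tail (Var 2)))))) ?Q s'"
    using inv by (auto simp: nonnil_val intro!: wp_Seq wp_Assign)
qed (use assms in \<open>auto simp: nonnil_val\<close>)

lemma select_prog_wp:
  fixes s :: "nat \<Rightarrow> 'k::field val"
  assumes "s 5 = vstates L" "s 0 = VNil" "s 3 = VInt j"
  shows "wp P select_prog (\<lambda>s'. s' 0 = vlist (map vints (fold (select j) L []))) s"
  unfolding select_prog_def
proof (rule wp_While_list[where xs = L and Inv = "\<lambda>R s'. s' 5 = vstates R \<and> s' 3 = VInt j \<and>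
    (\<exists>out. s' 0 = vlist (map vints out) \<and> fold (select j) R out = fold (select j) L [])"])
  fix p R and s' :: "nat \<Rightarrow> 'k val"
  assume inv: "s' 5 = vstates (p # R) \<and> s' 3 = VInt j \<and>
    (\<exists>out. s' 0 = vlist (map vints out) \<and> fold (select j) (p # R) out = fold (select j) L [])"
  obtain xs d where p: "p = (xs, d)" by fastforce
  obtain out where out: "s' 0 = vlist (map vints out)"
    "fold (select j) R (select j (xs, d) out) = fold (select j) L []" using inv p by auto
  let ?Q = "\<lambda>s'. s' 5 = vstates R \<and> s' 3 = VInt j \<and>
    (\<exists>out. s' 0 = vlist (map vints out) \<and> fold (select j) R out = fold (select j) L [])"
  let ?test = "While (Var 8) (Seq (Assign 0 (Pair (Head (Head (Var 5))) (Var 0))) (Assign 8 (IntC 0)))"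
  have "wp P ?test (wp P (Assign 5 (Tail (Var 5))) ?Q) (s'(8 := vbool (d \<le> j)))"
  proof (rule wp_While_nat[where k = "if d \<le> j then 1 else 0" and
      Inv = "\<lambda>k s''. s'' 8 = VInt (int k) \<and> k \<le> 1 \<and> s'' 5 = vstates (p # R) \<and> s'' 3 = VInt j \<and>
        (\<exists>out. s'' 0 = vlist (map vints out) \<and>
          fold (select j) R (if k = 0 then out else xs # out) = fold (select j) L [])"])
  qed (use inv out p in \<open>auto simp: vbool_def select_def intro!: wp_Seq wp_Assign intro: exI[of _ "xs # _"]\<close>)
  then show "wexp_val P s' (nonnil 5) \<noteq> VInt 0 \<and>
    wp P (Seq (Assign 8 (Leq (Tail (Head (Var 5))) (Var 3))) (Seq ?test (Assign 5 (Tail (Var 5))))) ?Q s'"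
    using inv p by (auto simp: nonnil_val intro!: wp_Seq wp_Assign)
qed (use assms in \<open>auto simp: nonnil_val intro: exI[of _ "[]"]\<close>)

lemma box_prog_wp:
  fixes s :: "nat \<Rightarrow> 'k::field val"
  assumes "wexp_val P s e = VInt j" "s 0 = VPair v (VPair (vints us) w)"
  shows "wp P (box_prog e) (\<lambda>s'. s' 0 = vlist (map vints
    (enumerate_box (j * j + 1 + (\<Sum>a\<leftarrow>us. a * a)) j us))) s"
proof -
  let ?B = "j * j + 1 + (\<Sum>a\<leftarrow>us. a * a)"
  let ?Q = "\<lambda>s'. s' 0 = vlist (map vints (enumerate_box ?B j us))"
  have "(\<Sum>a\<leftarrow>us. a * a) \<ge> 0" by (induction us) auto
  then have B: "?B \<ge> 0" by simp
  have select: "wp P select_prog ?Q s'" if "s' 5 = vstates (fold (extend ?B) (rev us) [([], 0)])"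
    "s' 0 = VNil" "s' 3 = VInt j" for s'
    using select_prog_wp[OF that, of P] by (simp add: enumerate_box_def)
  have build: "wp P (Seq build_prog select_prog) ?Q s'"
    if "s' 2 = vints (rev us)" "s' 5 = vstates [([], 0)]" "s' 4 = VInt ?B" "s' 0 = VNil" "s' 3 = VInt j" for s'
    by (rule wp_Seq, rule wp_mono[OF build_prog_wp[OF that(1-3) B]], rule select) (use that in auto)
  have scan: "wp P (Seq scan_prog (Seq (Assign 5 (Pair (Pair NilC (IntC 0)) NilC)) (Seq build_prog select_prog))) ?Q s'"
    if "s' 1 = vints us" "s' 2 = VNil" "s' 4 = VInt (j * j + 1)" "s' 0 = VNil" "s' 3 = VInt j" for s'
    by (rule wp_Seq, rule wp_mono[OF scan_prog_wp[OF that(1-3)]], rule wp_Seq, rule wp_Assign, rule build)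
       (use that in auto)
  show ?thesis
    unfolding box_prog_def
    by (intro wp_Seq wp_Assign scan) (use assms in simp_all)
qed

section \<open>Correctness of the enumeration\<close>

definition dot :: "int list \<Rightarrow> int list \<Rightarrow> int" where
  "dot xs us = sum_list (map2 (*) xs us)"

lemma set_fold_children:
  "set (fold (children B a) L M) = {(t # xs, d + t * a) | t xs d. (xs, d) \<in> set L \<and> t \<in> {0..B}} \<union> set M"
  by (induction L arbitrary: M) (auto simp: children_def)

lemma set_extend: "set (extend B a L) = {(t # xs, d + t * a) | t xs d. (xs, d) \<in> set L \<and> t \<in> {0..B}}"
  by (simp add: extend_def set_fold_children)

lemma set_fold_extend:
  "set (fold (extend B) (rev us) [([], 0)]) = {(xs, dot xs us) | xs. length xs = length us \<and> set xs \<subseteq> {0..B}}"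
proof (induction us)
  case (Cons a us)
  have "set (fold (extend B) (rev (a # us)) [([], 0)]) =
      {(t # xs, dot xs us + t * a) | t xs. length xs = length us \<and> set xs \<subseteq> {0..B} \<and> t \<in> {0..B}}"
    by (simp add: set_extend Cons.IH)
  also have "\<dots> = {(xs, dot xs (a # us)) | xs. length xs = length (a # us) \<and> set xs \<subseteq> {0..B}}"
    by (auto simp: dot_def length_Suc_conv add.commute)
  finally show ?case .
qed (simp add: dot_def)

lemma set_fold_select: "set (fold (select j) L out) = {xs. \<exists>d. (xs, d) \<in> set L \<and> d \<le> j} \<union> set out"
  by (induction L arbitrary: out) (auto simp: select_def)

lemma set_enumerate_box:
  "set (enumerate_box B j us) = {xs. length xs = length us \<and> set xs \<subseteq> {0..B} \<and> dot xs us \<le> j}"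
  by (auto simp: enumerate_box_def set_fold_select set_fold_extend)

definition exp_list :: "nat \<Rightarrow> expo \<Rightarrow> int list" where
  "exp_list n \<alpha> = map (\<lambda>i. int (Poly_Mapping.lookup \<alpha> i)) [1..<Suc n]"

lemma code_exp_alt: "code_exp n \<alpha> = vints (exp_list n \<alpha>)"
  by (simp add: code_exp_def exp_list_def comp_def del: upt_Suc)

lemma inj_on_exp_list: "inj_on (exp_list n) (exps n)"
proof (intro inj_onI poly_mapping_eqI)
  fix \<alpha> \<beta> i assume ab: "\<alpha> \<in> exps n" "\<beta> \<in> exps n" "exp_list n \<alpha> = exp_list n \<beta>"
  show "Poly_Mapping.lookup \<alpha> i = Poly_Mapping.lookup \<beta> i"
  proof (cases "i \<in> {1..n}")
    case True
    then have "i \<in> set [1..<Suc n]" by (simp del: upt_Suc)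
    then show ?thesis using ab(3) by (simp add: exp_list_def del: upt_Suc)
  next
    case False
    then have "i \<notin> Poly_Mapping.keys \<alpha>" "i \<notin> Poly_Mapping.keys \<beta>" using ab(1,2) by (auto simp: exps_def)
    then show ?thesis by (simp add: in_keys_iff)
  qed
qed

lemma exp_list_surj:
  assumes "length xs = n" "set xs \<subseteq> {0..B}"
  obtains \<alpha> where "\<alpha> \<in> exps n" "exp_list n \<alpha> = xs"
proof -
  let ?a = "Poly_Mapping.nth (0 # map nat xs)"
  have l: "Poly_Mapping.lookup ?a (Suc i) = (if i < n then nat (xs ! i) else 0)" for i
    using assms(1) by (simp add: nth_default_def)
  have l0: "Poly_Mapping.lookup ?a 0 = 0" by (simp add: nth_default_def)
  have "?a \<in> exps n"
  proof -
    have "k \<in> {1..n}" if "k \<in> Poly_Mapping.keys ?a" for k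
      using that l l0 by (cases k) (auto simp: in_keys_iff simp del: lookup_nth keys_nth split: if_splits)
    then show ?thesis unfolding exps_def by blast
  qed
  moreover have "exp_list n ?a = xs"
  proof (rule nth_equalityI)
    fix i assume "i < length (exp_list n ?a)"
    then have "i < n" by (simp add: exp_list_def del: upt_Suc)
    moreover have "xs ! i \<in> {0..B}" using \<open>i < n\<close> assms nth_mem[of i xs] by blast
    then have "xs ! i \<ge> 0" by simp
    ultimately show "exp_list n ?a ! i = xs ! i"
      by (simp add: exp_list_def l del: upt_Suc lookup_nth)
  qed (simp add: exp_list_def assms(1) del: upt_Suc)
  ultimately show thesis using that by blast
qed

lemma dot_exp_list: "dot (exp_list n \<alpha>) (map u [1..<Suc n]) = wt n u \<alpha>"
proof -
  have "dot (map f xs) (map u xs) = (\<Sum>i\<leftarrow>xs. u i * f i)" for f :: "nat \<Rightarrow> int" and xs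
    by (induction xs) (auto simp: dot_def mult.commute)
  then have "dot (exp_list n \<alpha>) (map u [1..<Suc n]) = (\<Sum>i\<leftarrow>[1..<Suc n]. u i * int (Poly_Mapping.lookup \<alpha> i))"
    by (simp add: exp_list_def del: upt_Suc)
  also have "\<dots> = (\<Sum>i\<in>set [1..<Suc n]. u i * int (Poly_Mapping.lookup \<alpha> i))"
    by (rule sum_list_distinct_conv_sum_set) simp
  also have "set [1..<Suc n] = {1..n}" by auto
  finally show ?thesis by (simp add: wt_def)
qed

text \<open>
  The bound is stated by a sum over a set, whereas the program adds up the list of weights.
\<close>

lemma coord_bound_list: "j * j + 1 + (\<Sum>a\<leftarrow>map u [1..<Suc n]. a * a) = coord_bound n u j"
proof -
  have "(\<Sum>a\<leftarrow>map u [1..<Suc n]. a * a) = (\<Sum>i\<in>set [1..<Suc n]. u i * u i)"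
    by (simp add: comp_def sum_list_distinct_conv_sum_set del: upt_Suc set_upt)
  also have "set [1..<Suc n] = {1..n}" by auto
  finally show ?thesis by (simp add: coord_bound_def)
qed

lemma enumerate_box_codes:
  obtains es where "map (exp_list n) es = enumerate_box (coord_bound n u j) j (map u [1..<Suc n])" "set es = box n u j"
proof -
  let ?out = "enumerate_box (coord_bound n u j) j (map u [1..<Suc n])"
  have out: "set ?out = {xs. length xs = n \<and> set xs \<subseteq> {0..coord_bound n u j} \<and> dot xs (map u [1..<Suc n]) \<le> j}"
    unfolding set_enumerate_box by (simp del: upt_Suc)
  have img: "set ?out = exp_list n ` box n u j"
  proof (intro equalityI subsetI)
    fix xs assume "xs \<in> set ?out"
    then have xs: "length xs = n" "set xs \<subseteq> {0..coord_bound n u j}" "dot xs (map u [1..<Suc n]) \<le> j"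
      unfolding out by auto
    obtain \<alpha> where \<alpha>: "\<alpha> \<in> exps n" "exp_list n \<alpha> = xs" using exp_list_surj[OF xs(1,2)] .
    have "int (Poly_Mapping.lookup \<alpha> i) \<in> set xs" if "i \<in> {1..n}" for i
      using that \<alpha>(2) by (auto simp: exp_list_def simp del: upt_Suc)
    then have "int (Poly_Mapping.lookup \<alpha> i) \<le> coord_bound n u j" if "i \<in> {1..n}" for i
      using that xs(2) by (meson atLeastAtMost_iff subsetD)
    moreover have "wt n u \<alpha> \<le> j" using xs(3) unfolding \<alpha>(2)[symmetric] dot_exp_list .
    ultimately have "\<alpha> \<in> box n u j" using \<alpha>(1) by (simp add: box_def)
    then show "xs \<in> exp_list n ` box n u j" using \<alpha>(2) by blast
  next
    fix xs assume "xs \<in> exp_list n ` box n u j"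
    then obtain \<alpha> where \<alpha>: "\<alpha> \<in> box n u j" "xs = exp_list n \<alpha>" by blast
    then show "xs \<in> set ?out"
      unfolding out mem_Collect_eq \<alpha>(2) dot_exp_list
      by (auto simp: box_def exp_list_def simp del: upt_Suc)
  qed
  then have "?out \<in> lists (exp_list n ` box n u j)" by (simp add: lists_eq_set)
  then obtain es where es: "?out = map (exp_list n) es" "set es \<subseteq> box n u j"
    unfolding lists_image by (auto simp: lists_eq_set)
  have "exp_list n ` set es = exp_list n ` box n u j" using img es(1) by (metis set_map)
  then have "set es = box n u j"
    using inj_on_image_eq_iff[OF inj_on_exp_list, of "set es" n "box n u j"] es(2) by (auto simp: box_def)
  then show thesis using that es(1) by metis
qed

theorem box_prog_computes:
  fixes v :: "'k::field val"
  assumes "\<And>s. s 0 = VPair v (VPair (code_weight n u) w) \<Longrightarrow> wexp_val P s e = VInt j"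
  shows "\<exists>es. computes P (box_prog e) (VPair v (VPair (code_weight n u) w)) (code_exps n es) \<and> set es = box n u j"
proof -
  obtain es where es: "map (exp_list n) es = enumerate_box (coord_bound n u j) j (map u [1..<Suc n])" "set es = box n u j"
    using enumerate_box_codes .
  let ?s = "(\<lambda>_. VNil)(0 := VPair v (VPair (code_weight n u) w))"
  have "code_weight n u = (vints (map u [1..<Suc n]) :: 'k val)"
    by (simp add: code_weight_def comp_def del: upt_Suc)
  then have wp: "wp P (box_prog e) (\<lambda>s'. s' 0 = vlist (map vints (map (exp_list n) es))) ?s"
    unfolding es(1) coord_bound_list[symmetric] by (intro box_prog_wp assms) simp_all
  have "computes P (box_prog e) (VPair v (VPair (code_weight n u) w)) (code_exps n es)"
  proof -
    have "map (code_exp n) es = (map vints (map (exp_list n) es) :: 'k val list)"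
      by (simp add: code_exp_alt)
    then show ?thesis using wp unfolding wp_def computes_def code_exps_def by metis
  qed
  then show ?thesis using es(2) by blast
qed

section \<open>Generation, presentation and computability\<close>

theorem lemma2p4:
  shows
    "(\<forall>(A :: 'k::field pbw_data) u. pbw_datum A \<and> weight_vector A u \<longrightarrow>
        (\<exists>E. finite E \<and> E \<subseteq> exps (nv A) \<and> filt A u 0 = subalg_gen A (std_residue A ` E))) \<and>
     (\<exists>p. \<forall>(A :: 'k pbw_data) u v. pbw_datum A \<and> weight_vector A u \<and> encodes_datum v A \<longrightarrow>
        (\<exists>es. computes (prec_oracle A) p (vlist [v, code_weight (nv A) u]) (code_exps (nv A) es) \<and>
              set es \<subseteq> exps (nv A) \<and> filt A u 0 = subalg_gen A (std_residue A ` set es))) \<and>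
     (\<forall>(A :: 'k pbw_data) u. pbw_datum A \<and> weight_vector A u \<longrightarrow>
        (\<exists>B :: 'k pbw_data. pbw_datum B \<and> iso_to_pbw_alg A (filt A u 0) B)) \<and>
     (\<forall>(A :: 'k pbw_data) u j. pbw_datum A \<and> weight_vector A u \<longrightarrow>
        (\<exists>E. finite E \<and> E \<subseteq> exps (nv A) \<and>
             filt A u j = submod_gen A (filt A u 0) (std_residue A ` E))) \<and>
     (\<exists>p. \<forall>(A :: 'k pbw_data) u j v. pbw_datum A \<and> weight_vector A u \<and> encodes_datum v A \<longrightarrow>
        (\<exists>es. computes (prec_oracle A) p (vlist [v, code_weight (nv A) u, VInt j])
                (code_exps (nv A) es) \<and>
              set es \<subseteq> exps (nv A) \<and>
              filt A u j = submod_gen A (filt A u 0) (std_residue A ` set es)))"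
proof -
  have box: "box n u j \<subseteq> exps n" for n u j by (auto simp: box_def)
  have alg: "filt A u 0 = subalg_gen A (std_residue A ` box (nv A) u 0)"
    if "pbw_datum A" "weight_vector A u" for A :: "'k pbw_data" and u
    using weighted_relations.filt_generated_as_algebra[OF pbw_datum_weighted[OF that]] .
  have module: "filt A u j = submod_gen A (filt A u 0) (std_residue A ` box (nv A) u j)"
    if "pbw_datum A" "weight_vector A u" for A :: "'k pbw_data" and u j
    using weighted_relations.filt_generated_as_module[OF pbw_datum_weighted[OF that]] .
  show ?thesis
  proof (intro conjI)
    show "\<forall>(A :: 'k pbw_data) u. pbw_datum A \<and> weight_vector A u \<longrightarrow>
        (\<exists>E. finite E \<and> E \<subseteq> exps (nv A) \<and> filt A u 0 = subalg_gen A (std_residue A ` E))"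
    proof (intro allI impI, elim conjE)
      fix A :: "'k pbw_data" and u assume "pbw_datum A" "weight_vector A u"
      then show "\<exists>E. finite E \<and> E \<subseteq> exps (nv A) \<and> filt A u 0 = subalg_gen A (std_residue A ` E)"
        by (intro exI[of _ "box (nv A) u 0"] conjI finite_box box alg)
    qed
    show "\<forall>(A :: 'k pbw_data) u j. pbw_datum A \<and> weight_vector A u \<longrightarrow>
        (\<exists>E. finite E \<and> E \<subseteq> exps (nv A) \<and> filt A u j = submod_gen A (filt A u 0) (std_residue A ` E))"
    proof (intro allI impI, elim conjE)
      fix A :: "'k pbw_data" and u j assume "pbw_datum A" "weight_vector A u"
      then show "\<exists>E. finite E \<and> E \<subseteq> exps (nv A) \<and> filt A u j = submod_gen A (filt A u 0) (std_residue A ` E)"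
        by (intro exI[of _ "box (nv A) u j"] conjI finite_box box module)
    qed
    show "\<forall>(A :: 'k pbw_data) u. pbw_datum A \<and> weight_vector A u \<longrightarrow>
        (\<exists>B :: 'k pbw_data. pbw_datum B \<and> iso_to_pbw_alg A (filt A u 0) B)"
      using filt_zero_iso_pbw_alg by blast
    show "\<exists>p. \<forall>(A :: 'k pbw_data) u v. pbw_datum A \<and> weight_vector A u \<and> encodes_datum v A \<longrightarrow>
        (\<exists>es. computes (prec_oracle A) p (vlist [v, code_weight (nv A) u]) (code_exps (nv A) es) \<and>
              set es \<subseteq> exps (nv A) \<and> filt A u 0 = subalg_gen A (std_residue A ` set es))"
    proof (intro exI[of _ "box_prog (IntC 0)"] allI impI, elim conjE)
      fix A :: "'k pbw_data" and u v assume A: "pbw_datum A" "weight_vector A u"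
      have "\<exists>es. computes (prec_oracle A) (box_prog (IntC 0)) (VPair v (VPair (code_weight (nv A) u) VNil))
          (code_exps (nv A) es) \<and> set es = box (nv A) u 0"
        by (rule box_prog_computes) simp
      then obtain es where "computes (prec_oracle A) (box_prog (IntC 0)) (VPair v (VPair (code_weight (nv A) u) VNil))
          (code_exps (nv A) es)" "set es = box (nv A) u 0" by blast
      then show "\<exists>es. computes (prec_oracle A) (box_prog (IntC 0)) (vlist [v, code_weight (nv A) u]) (code_exps (nv A) es) \<and>
          set es \<subseteq> exps (nv A) \<and> filt A u 0 = subalg_gen A (std_residue A ` set es)"
        using alg[OF A] box by (intro exI[of _ es]) simp
    qed
    show "\<exists>p. \<forall>(A :: 'k pbw_data) u j v. pbw_datum A \<and> weight_vector A u \<and> encodes_datum v A \<longrightarrow>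
        (\<exists>es. computes (prec_oracle A) p (vlist [v, code_weight (nv A) u, VInt j]) (code_exps (nv A) es) \<and>
              set es \<subseteq> exps (nv A) \<and> filt A u j = submod_gen A (filt A u 0) (std_residue A ` set es))"
    proof (intro exI[of _ "box_prog (Head (Tail (Tail (Var 0))))"] allI impI, elim conjE)
      fix A :: "'k pbw_data" and u j v assume A: "pbw_datum A" "weight_vector A u"
      have "\<exists>es. computes (prec_oracle A) (box_prog (Head (Tail (Tail (Var 0)))))
          (VPair v (VPair (code_weight (nv A) u) (VPair (VInt j) VNil))) (code_exps (nv A) es) \<and>
        set es = box (nv A) u j"
        by (rule box_prog_computes) simp
      then obtain es where "computes (prec_oracle A) (box_prog (Head (Tail (Tail (Var 0)))))
          (VPair v (VPair (code_weight (nv A) u) (VPair (VInt j) VNil))) (code_exps (nv A) es)"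
        "set es = box (nv A) u j" by blast
      then show "\<exists>es. computes (prec_oracle A) (box_prog (Head (Tail (Tail (Var 0)))))
            (vlist [v, code_weight (nv A) u, VInt j]) (code_exps (nv A) es) \<and>
          set es \<subseteq> exps (nv A) \<and> filt A u j = submod_gen A (filt A u 0) (std_residue A ` set es)"
        using module[OF A, of j] box by (intro exI[of _ es]) simp
    qed
  qed
qed

end
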